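(* In the symmetric-ordering setup, for all $f,g\in S(\mathfrak g)$, $$f\star g=\sum_{i_1,\ldots,i_n\ge0}\frac{x_1^{i_1}x_2^{i_2}\cdots x_n^{i_n}}{i_1!\cdots i_n!}\;m\Big(\Big(\prod_{l=1}^n\big(\Delta(\partial^l)-\Delta_0(\partial^l)\big)^{i_l}\Big)(f\otimes g)\Big),$$ where only finitely many terms are nonzero; equivalently $f\star g=m\!:\!\exp\big(\sum_\alpha x_\alpha(\Delta-\Delta_0)(\partial^\alpha)\big)\!:\!(f\otimes g)$ with all $x$'s placed to the left of all derivatives.
   Context: Symmetric-ordering setup: $\Bbbk$ is a field of characteristic $0$, $\mathfrak g$ an $n$-dimensional Lie algebra with basis $\hat x_1,\ldots,\hat x_n$; $S(\mathfrak g)=\Bbbk[x_1,\ldots,x_n]$ and $\partial^\mu$ acts on $S(\mathfrak g)$ as $\partial/\partial x_\mu$. The coexponential map $\xi:S(\mathfrak g)\to U(\mathfrak g)$ is the linear isomorphism $\xi(x_{\alpha_1}\cdots x_{\alpha_k})=\frac1{k!}\sum_{\sigma\in\Sigma_k}\hat x_{\alpha_{\sigma(1)}}\cdots\hat x_{\alpha_{\sigma(k)}}$, and the star product is $f\star g=\xi^{-1}(\xi(f)\xi(g))$. The deformed coproduct $\Delta(\partial^\mu)$ is the unique formal power series $\sum_{I,J}c_{IJ}\,\partial^I\otimes\partial^J$ in the $2n$ commuting variables $\partial^\alpha\otimes1$, $1\otimes\partial^\alpha$ (multi-index notation $\partial^I=\prod(\partial^\alpha)^{I_\alpha}$) such that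 $\partial^\mu(f\star g)=\sum_{I,J}c_{IJ}(\partial^If)\star(\partial^Jg)$ for all $f,g\in S(\mathfrak g)$; $\Delta_0(\partial^\mu)=\partial^\mu\otimes1+1\otimes\partial^\mu$. A series $\sum c_{IJ}\partial^I\otimes\partial^J$ acts on $f\otimes g$ by $\sum c_{IJ}\,\partial^If\otimes\partial^Jg$, products of such series being taken in the commutative ring of formal power series, and $m:S(\mathfrak g)\otimes S(\mathfrak g)\to S(\mathfrak g)$ is multiplication of polynomials. *)

theory Defs
  imports "HOL-Combinatorics.Permutations"
begin

text \<open>Conventions. The basis of the Lie algebra is indexed by 0..n-1 (the paper's 1..n).
  Multi-indices / exponent vectors are functions nat => nat vanishing outside {..<n}.
  An element of S(g) = k[x_0..x_(n-1)] is a coefficient function (nat => nat) => 'k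
  with finite support contained in the multi-indices.  An element of S(g) (x) S(g)
  = k[x] (x) k[x] is a coefficient function of two exponent vectors.  An element of the
  tensor algebra T(g) (free associative algebra) is a coefficient function on words
  nat list => 'k.  The Lie algebra is given by structure constants
  [x_i, x_j] = sum_k c i j k x_k.\<close>

definition mi :: "nat \<Rightarrow> (nat \<Rightarrow> nat) \<Rightarrow> bool" where
  "mi n I \<longleftrightarrow> (\<forall>i\<ge>n. I i = 0)"

definition spoly :: "nat \<Rightarrow> ((nat \<Rightarrow> nat) \<Rightarrow> 'k::zero) \<Rightarrow> bool" where
  "spoly n f \<longleftrightarrow> finite {m. f m \<noteq> 0} \<and> (\<forall>m. f m \<noteq> 0 \<longrightarrow> mi n m)"

definition fsum :: "('a \<Rightarrow> 'b::comm_monoid_add) \<Rightarrow> 'a set \<Rightarrow> 'b" where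
  "fsum P S = sum P {x\<in>S. P x \<noteq> 0}"

definition is_lie_algebra :: "nat \<Rightarrow> (nat \<Rightarrow> nat \<Rightarrow> nat \<Rightarrow> 'k::field) \<Rightarrow> bool" where
  "is_lie_algebra n c \<longleftrightarrow>
     (\<forall>i<n. \<forall>j<n. \<forall>k<n. c i j k = - c j i k) \<and>
     (\<forall>i<n. \<forall>j<n. \<forall>l<n. \<forall>m<n.
        (\<Sum>k<n. c j l k * c i k m + c l i k * c j k m + c i j k * c l k m) = 0)"

definition pmul :: "((nat \<Rightarrow> nat) \<Rightarrow> 'k::comm_ring_1) \<Rightarrow> ((nat \<Rightarrow> nat) \<Rightarrow> 'k) \<Rightarrow> (nat \<Rightarrow> nat) \<Rightarrow> 'k" where
  "pmul p q M = (\<Sum>A\<in>{A. \<forall>i. A i \<le> M i}. p A * q (\<lambda>i. M i - A i))"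

definition mono :: "(nat \<Rightarrow> nat) \<Rightarrow> (nat \<Rightarrow> nat) \<Rightarrow> 'k::comm_ring_1" where
  "mono I M = (if M = I then 1 else 0)"

definition pder :: "nat \<Rightarrow> ((nat \<Rightarrow> nat) \<Rightarrow> 'k::comm_ring_1) \<Rightarrow> (nat \<Rightarrow> nat) \<Rightarrow> 'k" where
  "pder \<alpha> p M = of_nat (M \<alpha> + 1) * p (M(\<alpha> := M \<alpha> + 1))"

definition pderI :: "nat \<Rightarrow> (nat \<Rightarrow> nat) \<Rightarrow> ((nat \<Rightarrow> nat) \<Rightarrow> 'k::comm_ring_1) \<Rightarrow> (nat \<Rightarrow> nat) \<Rightarrow> 'k" where
  "pderI n I = foldr (\<lambda>\<alpha> h. (pder \<alpha> ^^ I \<alpha>) \<circ> h) [0..<n] id"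

definition fmul :: "(nat list \<Rightarrow> 'k::comm_ring_1) \<Rightarrow> (nat list \<Rightarrow> 'k) \<Rightarrow> nat list \<Rightarrow> 'k" where
  "fmul a b w = (\<Sum>i\<le>length w. a (take i w) * b (drop i w))"

definition fgen :: "nat \<Rightarrow> nat list \<Rightarrow> 'k::comm_ring_1" where
  "fgen i w = (if w = [i] then 1 else 0)"

definition tpoly :: "nat \<Rightarrow> (nat list \<Rightarrow> 'k::zero) \<Rightarrow> bool" where
  "tpoly n a \<longleftrightarrow> finite {w. a w \<noteq> 0} \<and> (\<forall>w. a w \<noteq> 0 \<longrightarrow> set w \<subseteq> {..<n})"

definition rel :: "nat \<Rightarrow> (nat \<Rightarrow> nat \<Rightarrow> nat \<Rightarrow> 'k::comm_ring_1) \<Rightarrow> nat \<Rightarrow> nat \<Rightarrow> nat list \<Rightarrow> 'k" where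
  "rel n c i j w = fmul (fgen i) (fgen j) w - fmul (fgen j) (fgen i) w - (\<Sum>k<n. c i j k * fgen k w)"

inductive_set lie_ideal :: "nat \<Rightarrow> (nat \<Rightarrow> nat \<Rightarrow> nat \<Rightarrow> 'k::comm_ring_1) \<Rightarrow> (nat list \<Rightarrow> 'k) set"
  for n c where
  zero: "(\<lambda>w. 0) \<in> lie_ideal n c"
| gen: "\<lbrakk>tpoly n a; tpoly n b; i < n; j < n\<rbrakk> \<Longrightarrow> fmul (fmul a (rel n c i j)) b \<in> lie_ideal n c"
| add: "\<lbrakk>u \<in> lie_ideal n c; v \<in> lie_ideal n c\<rbrakk> \<Longrightarrow> (\<lambda>w. u w + v w) \<in> lie_ideal n c"

definition letters :: "nat \<Rightarrow> (nat \<Rightarrow> nat) \<Rightarrow> nat list" where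
  "letters n m = concat (map (\<lambda>\<alpha>. replicate (m \<alpha>) \<alpha>) [0..<n])"

text \<open>xi(x_a1 ... x_ak) = 1/k! sum_sigma xhat_a(sigma 1) ... xhat_a(sigma k), as coefficient function on words\<close>
definition xi_mon :: "nat \<Rightarrow> (nat \<Rightarrow> nat) \<Rightarrow> nat list \<Rightarrow> 'k::field_char_0" where
  "xi_mon n m w = (let ls = letters n m; k = length ls in
     of_nat (card {\<sigma>. \<sigma> permutes {..<k} \<and> map (\<lambda>j. ls ! \<sigma> j) [0..<k] = w}) / fact k)"

definition xi :: "nat \<Rightarrow> ((nat \<Rightarrow> nat) \<Rightarrow> 'k::field_char_0) \<Rightarrow> nat list \<Rightarrow> 'k" where
  "xi n f w = (\<Sum>m\<in>{m. f m \<noteq> 0}. f m * xi_mon n m w)"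

text \<open>f * g = xi^-1 (xi f xi g), computed in U(g) = T(g)/I\<close>
definition star :: "nat \<Rightarrow> (nat \<Rightarrow> nat \<Rightarrow> nat \<Rightarrow> 'k::field_char_0) \<Rightarrow> ((nat \<Rightarrow> nat) \<Rightarrow> 'k) \<Rightarrow> ((nat \<Rightarrow> nat) \<Rightarrow> 'k) \<Rightarrow> (nat \<Rightarrow> nat) \<Rightarrow> 'k" where
  "star n c f g = (THE h. spoly n h \<and>
      (\<lambda>w. xi n h w - fmul (xi n f) (xi n g) w) \<in> lie_ideal n c)"

text \<open>a series sum c_IJ partial^I (x) partial^J is its coefficient function c\<close>
definition tensor :: "((nat \<Rightarrow> nat) \<Rightarrow> 'k::comm_ring_1) \<Rightarrow> ((nat \<Rightarrow> nat) \<Rightarrow> 'k) \<Rightarrow> (nat \<Rightarrow> nat) \<Rightarrow> (nat \<Rightarrow> nat) \<Rightarrow> 'k" where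
  "tensor f g A B = f A * g B"

definition dd :: "nat \<Rightarrow> (nat \<Rightarrow> nat) \<Rightarrow> (nat \<Rightarrow> nat) \<Rightarrow> ((nat \<Rightarrow> nat) \<Rightarrow> (nat \<Rightarrow> nat) \<Rightarrow> 'k::comm_ring_1) \<Rightarrow> (nat \<Rightarrow> nat) \<Rightarrow> (nat \<Rightarrow> nat) \<Rightarrow> 'k" where
  "dd n I J T A B = pderI n J (\<lambda>B'. pderI n I (\<lambda>A'. T A' B') A) B"

definition act :: "nat \<Rightarrow> ((nat \<Rightarrow> nat) \<Rightarrow> (nat \<Rightarrow> nat) \<Rightarrow> 'k::comm_ring_1) \<Rightarrow> ((nat \<Rightarrow> nat) \<Rightarrow> (nat \<Rightarrow> nat) \<Rightarrow> 'k) \<Rightarrow> (nat \<Rightarrow> nat) \<Rightarrow> (nat \<Rightarrow> nat) \<Rightarrow> 'k" where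
  "act n C T A B = fsum (\<lambda>(I, J). C I J * dd n I J T A B) {(I, J). mi n I \<and> mi n J}"

definition mT :: "((nat \<Rightarrow> nat) \<Rightarrow> (nat \<Rightarrow> nat) \<Rightarrow> 'k::comm_ring_1) \<Rightarrow> (nat \<Rightarrow> nat) \<Rightarrow> 'k" where
  "mT T M = (\<Sum>A\<in>{A. \<forall>i. A i \<le> M i}. T A (\<lambda>i. M i - A i))"

definition ser_one :: "(nat \<Rightarrow> nat) \<Rightarrow> (nat \<Rightarrow> nat) \<Rightarrow> 'k::comm_ring_1" where
  "ser_one I J = (if I = (\<lambda>_. 0) \<and> J = (\<lambda>_. 0) then 1 else 0)"

definition ser_mul :: "((nat \<Rightarrow> nat) \<Rightarrow> (nat \<Rightarrow> nat) \<Rightarrow> 'k::comm_ring_1) \<Rightarrow> ((nat \<Rightarrow> nat) \<Rightarrow> (nat \<Rightarrow> nat) \<Rightarrow> 'k) \<Rightarrow> (nat \<Rightarrow> nat) \<Rightarrow> (nat \<Rightarrow> nat) \<Rightarrow> 'k" where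
  "ser_mul C D I J = (\<Sum>(I', J')\<in>{I'. \<forall>i. I' i \<le> I i} \<times> {J'. \<forall>i. J' i \<le> J i}.
       C I' J' * D (\<lambda>i. I i - I' i) (\<lambda>i. J i - J' i))"

definition ser_pow :: "((nat \<Rightarrow> nat) \<Rightarrow> (nat \<Rightarrow> nat) \<Rightarrow> 'k::comm_ring_1) \<Rightarrow> nat \<Rightarrow> (nat \<Rightarrow> nat) \<Rightarrow> (nat \<Rightarrow> nat) \<Rightarrow> 'k" where
  "ser_pow C k = (ser_mul C ^^ k) ser_one"

definition unitv :: "nat \<Rightarrow> nat \<Rightarrow> nat" where
  "unitv \<mu> = (\<lambda>i. if i = \<mu> then 1 else 0)"

definition Delta0 :: "nat \<Rightarrow> (nat \<Rightarrow> nat) \<Rightarrow> (nat \<Rightarrow> nat) \<Rightarrow> 'k::comm_ring_1" where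
  "Delta0 \<mu> I J = (if I = unitv \<mu> \<and> J = (\<lambda>_. 0) then 1 else 0)
                 + (if I = (\<lambda>_. 0) \<and> J = unitv \<mu> then 1 else 0)"

definition Delta :: "nat \<Rightarrow> (nat \<Rightarrow> nat \<Rightarrow> nat \<Rightarrow> 'k::field_char_0) \<Rightarrow> nat \<Rightarrow> (nat \<Rightarrow> nat) \<Rightarrow> (nat \<Rightarrow> nat) \<Rightarrow> 'k" where
  "Delta n c \<mu> = (THE C. (\<forall>I J. \<not> (mi n I \<and> mi n J) \<longrightarrow> C I J = 0) \<and>
     (\<forall>f g. spoly n f \<and> spoly n g \<longrightarrow>
        pder \<mu> (star n c f g) =
        (\<lambda>M. fsum (\<lambda>(I, J). C I J * star n c (pderI n I f) (pderI n J g) M)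
                   {(I, J). mi n I \<and> mi n J})))"

definition star_term :: "nat \<Rightarrow> (nat \<Rightarrow> nat \<Rightarrow> nat \<Rightarrow> 'k::field_char_0) \<Rightarrow> ((nat \<Rightarrow> nat) \<Rightarrow> 'k) \<Rightarrow> ((nat \<Rightarrow> nat) \<Rightarrow> 'k) \<Rightarrow> (nat \<Rightarrow> nat) \<Rightarrow> (nat \<Rightarrow> nat) \<Rightarrow> 'k" where
  "star_term n c f g i =
     (let P = foldr (\<lambda>l D. ser_mul (ser_pow (\<lambda>I J. Delta n c l I J - Delta0 l I J) (i l)) D) [0..<n] ser_one
      in (\<lambda>M. (1 / (\<Prod>l<n. fact (i l))) * pmul (mono i) (mT (act n P (tensor f g))) M))"

end

theory Submission
  imports Defs "HOL-Combinatorics.Multiset_Permutations"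
begin

text \<open>Write U(g) as T(g) modulo the ideal I.  For each exponent vector K let phi K be the linear
  functional on words reading off K! times the coefficient of x^K in the inverse image under xi;
  it exists because xi induces a bijection onto T(g)/I (Poincare-Birkhoff-Witt), and it kills I.
  Since the defining relations are primitive, functionals killing I are closed under the product
  dual to unshuffling of words, and comparing values on symmetrized words gives
  phi (K + L) = phi K * phi L.  Evaluating phi K on xi(x^A) xi(x^B) / (A! B!) yields the coefficients of a
  series Z_K (star_coeff K) in two sets of variables with Z_(K+L) = Z_K Z_L, and the coefficient of x^K in f * g is
  the value at the origin of Z_K (f (x) g), divided by K!.  The same multiplicativity
  shows that the deformed coproduct of the l-th derivative is Z at the l-th unit vector, hence
  Z_K is the product of the Delta(partial^l)^(K_l).  The formula is then the binomial expansion of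
  Delta = (Delta - Delta_0) + Delta_0, because ordinary multiplication is
  the case in which Delta is replaced by Delta_0.\<close>

section \<open>Pairings with finitely supported functions\<close>

text \<open>The hard input is that xi is bijective onto T(g)/I. Spanning is a rewriting of words by
  length. Independence cannot be read off from \<open>lie_ideal\<close>, which is known only through
  generators; what is needed is an invariant that kills I and still sees leading monomials. The
  representation \<open>pbw\<close> on polynomials supplies it, and it is the one place where the
  Jacobi identity enters. The factor K! makes the functionals phi K dual to the divided powers
  xi(x^m)/m!. Their coproduct, the sum over a of xi(x^a)/a! (x) xi(x^(m-a))/(m-a)!, has no
  coefficients, which is why Z_K is exactly multiplicative in K. \<open>Delta\<close> is a definite
  description, so existence and uniqueness of the series both have to be shown. Uniqueness comes
  from constant coefficients: Z_0 = 1, so testing on a pair of monomials isolates a single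
  coefficient. The sum is finite because Delta - Delta_0 has no constant term, so that high powers
  of it kill a fixed f (x) g.\<close>

definition fpair :: "('a \<Rightarrow> 'k::comm_ring_1) \<Rightarrow> ('a \<Rightarrow> 'k) \<Rightarrow> 'k" where
  "fpair F p = (\<Sum>x | p x \<noteq> 0. p x * F x)"

abbreviation fin_supp :: "('a \<Rightarrow> 'k::zero) \<Rightarrow> bool" where
  "fin_supp p \<equiv> finite {x. p x \<noteq> 0}"

lemma fpair_superset:
  assumes "finite S" "\<And>x. p x \<noteq> 0 \<Longrightarrow> x \<in> S"
  shows "fpair F p = (\<Sum>x\<in>S. p x * F x)"
  unfolding fpair_def using assms by (intro sum.mono_neutral_left) auto

lemma fpair_cong:
  assumes "\<And>x. p x \<noteq> 0 \<Longrightarrow> F x = G x"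
  shows "fpair F p = fpair G p"
  unfolding fpair_def using assms by (intro sum.cong) auto

lemma fin_supp_add: "fin_supp p \<Longrightarrow> fin_supp q \<Longrightarrow> fin_supp (\<lambda>x. p x + (q x :: 'k::comm_ring_1))"
  by (rule finite_subset[of _ "{x. p x \<noteq> 0} \<union> {x. q x \<noteq> 0}"]) auto

lemma fin_supp_scale: "fin_supp p \<Longrightarrow> fin_supp (\<lambda>x. r * (p x :: 'k::comm_ring_1))"
  by (rule finite_subset[of _ "{x. p x \<noteq> 0}"]) auto

lemma fin_supp_diff: "fin_supp p \<Longrightarrow> fin_supp q \<Longrightarrow> fin_supp (\<lambda>x. p x - (q x :: 'k::comm_ring_1))"
  by (rule finite_subset[of _ "{x. p x \<noteq> 0} \<union> {x. q x \<noteq> 0}"]) auto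

lemma fin_supp_sum:
  assumes "finite T" "\<And>t. t \<in> T \<Longrightarrow> fin_supp (p t)"
  shows "fin_supp (\<lambda>x. \<Sum>t\<in>T. (p t x :: 'k::comm_ring_1))"
proof (rule finite_subset)
  show "{x. (\<Sum>t\<in>T. p t x) \<noteq> 0} \<subseteq> (\<Union>t\<in>T. {x. p t x \<noteq> 0})"
    by (auto dest: sum.not_neutral_contains_not_neutral)
qed (use assms in auto)

lemma fin_supp_single: "fin_supp (\<lambda>y. if y = x then r else 0)"
  by (rule finite_subset[of _ "{x}"]) auto

lemma fpair_add:
  assumes "fin_supp p" "fin_supp q"
  shows "fpair F (\<lambda>x. p x + q x) = fpair F p + fpair F q"
proof -
  let ?S = "{x. p x \<noteq> 0} \<union> {x. q x \<noteq> 0}"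
  have fin: "finite ?S" using assms by simp
  show ?thesis
    by (subst (1 2 3) fpair_superset[OF fin])
      (auto simp: sum.distrib distrib_right)
qed

lemma fpair_scale:
  assumes "fin_supp p"
  shows "fpair F (\<lambda>x. r * p x) = r * fpair F p"
  by (subst (1 2) fpair_superset[OF assms]) (auto simp: sum_distrib_left mult.assoc)

lemma fpair_diff:
  assumes "fin_supp p" "fin_supp q"
  shows "fpair F (\<lambda>x. p x - q x) = fpair F p - fpair F q"
  using fpair_add[OF assms(1) fin_supp_scale[OF assms(2), of "-1"], of F]
    fpair_scale[OF assms(2), of F "-1"] by simp

lemma fpair_sum:
  assumes "finite T" "\<And>t. t \<in> T \<Longrightarrow> fin_supp (p t)"
  shows "fpair F (\<lambda>x. \<Sum>t\<in>T. p t x) = (\<Sum>t\<in>T. fpair F (p t))"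
  using assms
proof (induction T rule: finite_induct)
  case empty
  then show ?case by (simp add: fpair_def)
next
  case (insert t T)
  then show ?case by (simp add: fpair_add fin_supp_sum)
qed

lemma fpair_single: "fpair F (\<lambda>y. if y = x then r else 0) = r * F x"
  by (subst fpair_superset[of "{x}"]) (auto split: if_splits)

lemma fpair_lincomb:
  assumes "fin_supp p" "finite T" "\<And>k. k \<in> T \<Longrightarrow> fin_supp (q k)"
  shows "fpair F (\<lambda>x. p x + (\<Sum>k\<in>T. r k * q k x)) = fpair F p + (\<Sum>k\<in>T. r k * fpair F (q k))"
proof -
  have fs: "fin_supp (\<lambda>x. r k * q k x)" if "k \<in> T" for k
    using assms that by (intro fin_supp_scale) auto
  show ?thesis
    using assms fs fpair_scale[of "q _"]
    by (simp add: fpair_add fpair_sum fin_supp_sum del: mult_eq_0_iff)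
qed

lemma fpair_lincomb_fun:
  "fpair (\<lambda>x. F x + (\<Sum>k\<in>T. r k * G k x)) p = fpair F p + (\<Sum>k\<in>T. r k * fpair (G k) p)"
proof -
  have "(\<Sum>x | p x \<noteq> 0. p x * (\<Sum>k\<in>T. r k * G k x)) = (\<Sum>k\<in>T. r k * fpair (G k) p)"
    unfolding fpair_def sum_distrib_left
    by (subst sum.swap) (simp add: algebra_simps)
  then show ?thesis
    by (simp add: fpair_def distrib_left sum.distrib)
qed

lemma fin_supp_fpair:
  assumes "fin_supp p" "\<And>M. p M \<noteq> 0 \<Longrightarrow> fin_supp (G M)"
  shows "fin_supp (\<lambda>K. fpair (\<lambda>M. G M K) p)"
  unfolding fpair_def using assms by (intro fin_supp_sum fin_supp_scale) auto

lemma fpair_comp: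
  assumes "fin_supp p" "\<And>M. p M \<noteq> 0 \<Longrightarrow> fin_supp (G M)"
  shows "fpair F (\<lambda>K. fpair (\<lambda>M. G M K) p) = fpair (\<lambda>M. fpair F (G M)) p"
proof -
  have "fpair F (\<lambda>K. fpair (\<lambda>M. G M K) p) = fpair F (\<lambda>K. \<Sum>M | p M \<noteq> 0. p M * G M K)"
    by (simp add: fpair_def[of _ p])
  also have "\<dots> = (\<Sum>M | p M \<noteq> 0. fpair F (\<lambda>K. p M * G M K))"
    using assms by (intro fpair_sum fin_supp_scale) auto
  also have "\<dots> = fpair (\<lambda>M. fpair F (G M)) p"
    unfolding fpair_def[of _ p] using assms by (intro sum.cong) (auto simp: fpair_scale)
  finally show ?thesis .
qed

section \<open>Total degree of exponent vectors\<close>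

definition deg :: "nat \<Rightarrow> (nat \<Rightarrow> nat) \<Rightarrow> nat" where
  "deg n M = (\<Sum>i<n. M i)"

abbreviation inc :: "nat \<Rightarrow> (nat \<Rightarrow> nat) \<Rightarrow> nat \<Rightarrow> nat" where
  "inc i M \<equiv> M(i := Suc (M i))"

definition Mon :: "nat \<Rightarrow> nat \<Rightarrow> (nat \<Rightarrow> nat) set" where
  "Mon n d = {M. mi n M \<and> deg n M \<le> d}"

lemma deg_inc: "i < n \<Longrightarrow> deg n (inc i M) = Suc (deg n M)"
  unfolding deg_def by (subst (1 2) sum.remove[of "{..<n}" i]) auto

lemma mi_inc: "i < n \<Longrightarrow> mi n M \<Longrightarrow> mi n (inc i M)"
  unfolding mi_def by auto

lemma deg_ge: "i < n \<Longrightarrow> M i \<le> deg n M"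
  unfolding deg_def by (rule member_le_sum) auto

lemma finite_Mon: "finite (Mon n d)"
proof (rule finite_subset)
  show "Mon n d \<subseteq> {f. \<forall>x. (x \<in> {..<n} \<longrightarrow> f x \<in> {..d}) \<and> (x \<notin> {..<n} \<longrightarrow> f x = 0)}"
  proof (intro subsetI CollectI allI conjI impI)
    fix M x assume M: "M \<in> Mon n d"
    show "M x \<in> {..d}" if "x \<in> {..<n}"
      using deg_ge[of x n M] M that by (simp add: Mon_def)
    show "M x = 0" if "x \<notin> {..<n}"
      using M that by (simp add: Mon_def mi_def)
  qed
  show "finite {f. \<forall>x. (x \<in> {..<n} \<longrightarrow> f x \<in> {..d}) \<and> (x \<notin> {..<n} \<longrightarrow> f x = (0::nat))}"
    by (rule finite_set_of_finite_funs) auto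
qed

lemma fpair_mono: "fpair F (mono M) = F M"
  unfolding mono_def[abs_def] by (simp add: fpair_single)

lemma fin_supp_mono: "fin_supp (mono M :: _ \<Rightarrow> 'k::comm_ring_1)"
  unfolding mono_def[abs_def] by (rule fin_supp_single)

section \<open>The Poincare-Birkhoff-Witt action\<close>

text \<open>The action of the generator \<open>i\<close> of U(g) on the monomial M in the proof of the
  Poincare-Birkhoff-Witt theorem.  Where j is the least letter of M = j N, the action is
  forced by i j N = j i N + [i, j] N together with j (i N) = i M + j (i . N - i N).\<close>
function pbw :: "nat \<Rightarrow> (nat \<Rightarrow> nat \<Rightarrow> nat \<Rightarrow> 'k::comm_ring_1) \<Rightarrow> nat \<Rightarrow> (nat \<Rightarrow> nat) \<Rightarrow> (nat \<Rightarrow> nat) \<Rightarrow> 'k" where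
  "pbw n c i M K =
     (if i < n \<and> (\<exists>l<i. M l \<noteq> 0) then
        mono (inc i M) K
        + (\<Sum>P\<in>Mon n (deg n (M((LEAST l. M l \<noteq> 0) := M (LEAST l. M l \<noteq> 0) - 1))).
            (pbw n c i (M((LEAST l. M l \<noteq> 0) := M (LEAST l. M l \<noteq> 0) - 1)) P
             - mono (inc i (M((LEAST l. M l \<noteq> 0) := M (LEAST l. M l \<noteq> 0) - 1))) P)
            * pbw n c (LEAST l. M l \<noteq> 0) P K)
        + (\<Sum>k<n. c i (LEAST l. M l \<noteq> 0) k
            * pbw n c k (M((LEAST l. M l \<noteq> 0) := M (LEAST l. M l \<noteq> 0) - 1)) K)
      else mono (inc i M) K)"
  by pat_completeness auto
termination
proof -
  \<comment> \<open>Every recursive call is made on N, which is M without its least letter, or on a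
    monomial from \<open>Mon n (deg n N)\<close>. Summing over that finite set, before anything is
    known about the support of the action, is what makes the recursion well founded.\<close>
  have *: "deg n (M((LEAST l. M l \<noteq> 0) := M (LEAST l. M l \<noteq> 0) - Suc 0)) < deg n M"
    if "i < n" "l < i" "0 < M l" for n i l and M :: "nat \<Rightarrow> nat"
  proof -
    let ?j = "LEAST l. M l \<noteq> 0"
    have "M ?j \<noteq> 0" by (rule LeastI[of _ l]) (use that in auto)
    moreover have "?j < n" by (rule le_less_trans[OF Least_le[of _ l]]) (use that in auto)
    moreover have "inc ?j (M(?j := M ?j - Suc 0)) = M" using \<open>M ?j \<noteq> 0\<close> by auto
    ultimately show ?thesis
      using deg_inc[of ?j n "M(?j := M ?j - Suc 0)"] by simp
  qed
  show ?thesis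
    by (relation "measure (\<lambda>(n, c, i, M, K). deg n M)") (auto simp: Mon_def dest: * le_less_trans[OF _ *])
qed

declare pbw.simps[simp del]

lemma pbw_ordered: "(\<And>l. l < i \<Longrightarrow> M l = 0) \<Longrightarrow> pbw n c i M = mono (inc i M)"
  by (rule ext, subst pbw.simps, rule if_not_P) auto

lemma pbw_step:
  assumes "i < n" "j < i" "\<And>l. l < j \<Longrightarrow> N l = 0"
  shows "pbw n c i (inc j N) K = mono (inc i (inc j N)) K
    + (\<Sum>P\<in>Mon n (deg n N). (pbw n c i N P - mono (inc i N) P) * pbw n c j P K)
    + (\<Sum>k<n. c i j k * pbw n c k N K)"
proof -
  have L: "(LEAST l. (inc j N) l \<noteq> 0) = j"
    by (rule Least_equality) (use assms in \<open>auto simp: not_less[symmetric]\<close>)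
  have N: "(inc j N)(j := (inc j N) j - 1) = N" by simp
  show ?thesis
    by (subst pbw.simps, unfold L N, rule if_P) (use assms in auto)
qed

lemma least_letter:
  assumes "mi n M" "M l \<noteq> 0"
  obtains j N where "j \<le> l" "j < n" "M = inc j N" "\<And>k. k < j \<Longrightarrow> N k = 0" "mi n N"
proof -
  define j where "j = (LEAST l. M l \<noteq> 0)"
  define N where "N = M(j := M j - 1)"
  have j: "M j \<noteq> 0" unfolding j_def by (rule LeastI[of _ l]) (use assms in auto)
  moreover have "j \<le> l" unfolding j_def by (rule Least_le) (use assms in auto)
  moreover have "j < n" using j assms by (auto simp: mi_def not_less[symmetric])
  moreover have "M = inc j N" using j by (auto simp: N_def)
  moreover have "N k = 0" if "k < j" for k
    using not_less_Least[of k "\<lambda>l. M l \<noteq> 0"] that by (auto simp: N_def j_def)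
  moreover have "mi n N" using assms \<open>j < n\<close> by (auto simp: N_def mi_def)
  ultimately show thesis using that by blast
qed

text \<open>Every correction in the recursion applies a generator to a monomial of degree at most
  \<open>deg n M - 1\<close>, and so stays in degree at most \<open>deg n M\<close>. Acting by i is
  thus multiplication by x_i up to such terms; this also shows that cutting the sum in
  \<open>pbw\<close> down to \<open>Mon\<close> discards nothing.\<close>

lemma pbw_lower:
  assumes "i < n" "mi n M" "pbw n c i M K \<noteq> mono (inc i M) K"
  shows "K \<in> Mon n (deg n M)"
  using assms
proof (induction "deg n M" arbitrary: i M K rule: less_induct)
  case less
  obtain l where l: "l < i" "M l \<noteq> 0"
    using less.prems pbw_ordered[of i M n c] by fastforce
  obtain j N where j: "j \<le> l" "j < n" "M = inc j N" "\<And>k. k < j \<Longrightarrow> N k = 0" "mi n N"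
    using least_letter[OF less.prems(2) l(2)] by metis
  have d: "deg n M = Suc (deg n N)" using j by (simp add: deg_inc)
  have N: "N \<in> Mon n (deg n N)" using j by (simp add: Mon_def)
  have supp: "K \<in> Mon n (deg n M)"
    if "k < n" "P \<in> Mon n (deg n N)" "pbw n c k P K \<noteq> 0" for k P
  proof (cases "K = inc k P")
    case True
    then show ?thesis using that d by (auto simp: Mon_def deg_inc mi_inc)
  next
    case False
    then have "K \<in> Mon n (deg n P)"
      using less.hyps[of P k K] that d by (auto simp: Mon_def mono_def)
    then show ?thesis using that d by (auto simp: Mon_def)
  qed
  have "(\<Sum>P\<in>Mon n (deg n N). (pbw n c i N P - mono (inc i N) P) * pbw n c j P K) \<noteq> 0
      \<or> (\<Sum>k<n. c i j k * pbw n c k N K) \<noteq> 0"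
    using less.prems(3) pbw_step[of i n j N c K] l j less.prems(1) by auto
  then show ?case
  proof
    assume "(\<Sum>P\<in>Mon n (deg n N). (pbw n c i N P - mono (inc i N) P) * pbw n c j P K) \<noteq> 0"
    then show ?thesis
      by (rule sum.not_neutral_contains_not_neutral) (use supp j in \<open>metis mult_zero_right\<close>)
  next
    assume "(\<Sum>k<n. c i j k * pbw n c k N K) \<noteq> 0"
    then show ?thesis
      by (rule sum.not_neutral_contains_not_neutral) (use supp[OF _ N] in \<open>metis mult_zero_right lessThan_iff\<close>)
  qed
qed

lemma pbw_supp:
  assumes "i < n" "mi n M" "pbw n c i M K \<noteq> 0"
  shows "K = inc i M \<or> K \<in> Mon n (deg n M)"
proof (cases "K = inc i M")
  case False
  then have z: "mono (inc i M) K = (0 :: 'a)" unfolding mono_def by (rule if_not_P)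
  have "K \<in> Mon n (deg n M)"
    by (rule pbw_lower[OF assms(1,2), of c]) (unfold z, rule assms(3))
  then show ?thesis ..
qed (rule disjI1)

lemma pbw_mi:
  assumes "i < n" "mi n M" "pbw n c i M K \<noteq> 0"
  shows "mi n K"
  using pbw_supp[OF assms] mi_inc[OF assms(1,2)] by (elim disjE) (simp_all only: Mon_def mem_Collect_eq)

lemma fin_supp_pbw:
  assumes "i < n" "mi n M"
  shows "fin_supp (pbw n c i M)"
proof (rule finite_subset)
  show "{K. pbw n c i M K \<noteq> 0} \<subseteq> insert (inc i M) (Mon n (deg n M))"
    using pbw_supp[OF assms] by blast
qed (simp add: finite_Mon)

definition xact :: "nat \<Rightarrow> (nat \<Rightarrow> nat \<Rightarrow> nat \<Rightarrow> 'k::comm_ring_1) \<Rightarrow> nat \<Rightarrow> ((nat \<Rightarrow> nat) \<Rightarrow> 'k) \<Rightarrow> (nat \<Rightarrow> nat) \<Rightarrow> 'k" where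
  "xact n c i p K = fpair (\<lambda>M. pbw n c i M K) p"

text \<open>The recursion of \<open>pbw\<close> was obtained by solving this equation for its left
  side. To go back, \<open>pbw_lower\<close> lets the sum over \<open>Mon\<close> be read as the
  full action of j on i . N - i N.\<close>

lemma pbw_commute_ordered:
  assumes "i < n" "j < i" "\<And>l. l < j \<Longrightarrow> N l = 0" "mi n N"
  shows "pbw n c i (inc j N) K = xact n c j (pbw n c i N) K + (\<Sum>k<n. c i j k * pbw n c k N K)"
proof -
  let ?w = "\<lambda>P. pbw n c i N P - mono (inc i N) P"
  have fw: "?w P \<noteq> 0 \<Longrightarrow> P \<in> Mon n (deg n N)" for P
    using pbw_lower[of i n N c P] assms(1,4) by (simp only: right_minus_eq not_False_eq_True)
  have "(\<Sum>P\<in>Mon n (deg n N). ?w P * pbw n c j P K) = fpair (\<lambda>P. pbw n c j P K) ?w"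
    by (rule fpair_superset[symmetric]) (auto simp: finite_Mon fw)
  also have "\<dots> = xact n c j (pbw n c i N) K - pbw n c j (inc i N) K"
    unfolding xact_def using assms
    by (subst fpair_diff) (auto simp: fin_supp_pbw fin_supp_mono fpair_mono)
  \<comment> \<open>No letter of i N is below j, so j acts by plain multiplication.\<close>
  also have "pbw n c j (inc i N) = mono (inc j (inc i N))"
    by (rule pbw_ordered) (use assms in auto)
  also have "inc j (inc i N) = inc i (inc j N)" using assms by auto
  finally have "(\<Sum>P\<in>Mon n (deg n N). ?w P * pbw n c j P K)
      = xact n c j (pbw n c i N) K - mono (inc i (inc j N)) K" .
  then show ?thesis
    by (subst pbw_step[OF assms(1-3)]) (simp_all del: fun_upd_apply)
qed

section \<open>The commutation relations of the action\<close>

locale lie_alg =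
  fixes n :: nat and c :: "nat \<Rightarrow> nat \<Rightarrow> nat \<Rightarrow> 'k::field_char_0"
  assumes lie: "is_lie_algebra n c"
begin

abbreviation "X \<equiv> xact n c"
abbreviation "E \<equiv> pbw n c"

lemma antisym: "i < n \<Longrightarrow> j < n \<Longrightarrow> k < n \<Longrightarrow> c i j k = - c j i k"
  using lie unfolding is_lie_algebra_def by blast

lemma c_diag: "i < n \<Longrightarrow> k < n \<Longrightarrow> c i i k = 0"
proof -
  assume "i < n" "k < n"
  then have "2 * c i i k = 0" using antisym[of i i k] by (simp only: mult_2 eq_neg_iff_add_eq_0)
  then show ?thesis by simp
qed

lemma jacobi:
  "i < n \<Longrightarrow> j < n \<Longrightarrow> l < n \<Longrightarrow> m < n \<Longrightarrow>
    (\<Sum>k<n. c j l k * c i k m + c l i k * c j k m + c i j k * c l k m) = 0"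
  using lie unfolding is_lie_algebra_def by blast

lemma X_mono: "X i (mono M) = E i M"
  by (rule ext) (simp add: xact_def fpair_mono)

lemma fin_supp_X:
  assumes "i < n" "fin_supp p" "\<And>M. p M \<noteq> 0 \<Longrightarrow> mi n M"
  shows "fin_supp (X i p)"
proof -
  have "fin_supp (\<lambda>K. fpair (\<lambda>M. E i M K) p)"
    using assms by (intro fin_supp_fpair fin_supp_pbw) auto
  then show ?thesis by (simp add: xact_def[abs_def])
qed

lemma fin_supp_XE: "i < n \<Longrightarrow> j < n \<Longrightarrow> mi n N \<Longrightarrow> fin_supp (X i (E j N))"
  by (rule fin_supp_X) (auto simp: fin_supp_pbw intro: pbw_mi)

lemma X_lincomb:
  assumes "fin_supp p" "\<And>k. k < n \<Longrightarrow> fin_supp (q k)"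
  shows "X i (\<lambda>K. p K + (\<Sum>k<n. r k * q k K)) K = X i p K + (\<Sum>k<n. r k * X i (q k) K)"
  unfolding xact_def using assms by (intro fpair_lincomb) auto

text \<open>By linearity the relation is needed only on the monomials in the support of q. This
  generality matters inside \<open>pbw_commute\<close>, where it is not yet available on all
  monomials.\<close>

lemma X_comm_lift:
  assumes "i < n" "l < n" "fin_supp q" "\<And>P. q P \<noteq> 0 \<Longrightarrow> mi n P"
    and "\<And>P K. q P \<noteq> 0 \<Longrightarrow> X i (E l P) K = X l (E i P) K + (\<Sum>k<n. c i l k * E k P K)"
  shows "X i (X l q) K = X l (X i q) K + (\<Sum>k<n. c i l k * X k q K)"
proof -
  have XX: "X i (X l q) K = fpair (\<lambda>P. X i (E l P) K) q" if "i < n" "l < n" for i l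
    unfolding xact_def[abs_def] using assms that by (subst fpair_comp) (auto intro: fin_supp_pbw)
  have "X i (X l q) K = fpair (\<lambda>P. X l (E i P) K + (\<Sum>k<n. c i l k * E k P K)) q"
    unfolding XX[OF assms(1,2)] by (rule fpair_cong) (use assms in auto)
  also have "\<dots> = X l (X i q) K + (\<Sum>k<n. c i l k * X k q K)"
    unfolding fpair_lincomb_fun XX[OF assms(2,1)] by (simp add: xact_def)
  finally show ?thesis .
qed

text \<open>Induction on the degree of M. If no letter of M lies below both i and j, the recursion
  or antisymmetry gives the relation. Otherwise M = l N with l below both; then i j l N and j i l N
  are rewritten with l in front, and the leftover double brackets cancel by the Jacobi identity.
  This makes the polynomials a module over g.\<close>

lemma pbw_commute:
  assumes "i < n" "j < n" "mi n M"
  shows "X i (E j M) K = X j (E i M) K + (\<Sum>k<n. c i j k * E k M K)"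
  using assms
proof (induction "deg n M" arbitrary: i j M K rule: less_induct)
  case less
  have ord: "X i (E j M) K = X j (E i M) K + (\<Sum>k<n. c i j k * E k M K)"
    if "i < n" "j < i" "\<And>l. l < j \<Longrightarrow> M l = 0" "mi n M" for i j M K
    using pbw_commute_ordered[OF that] pbw_ordered[of j M n c] that(3) by (simp add: X_mono)
  consider "i = j" | "j < i" "\<And>l. l < j \<Longrightarrow> M l = 0" | "i < j" "\<And>l. l < i \<Longrightarrow> M l = 0"
    | l where "l < i" "l < j" "M l \<noteq> 0"
    by (metis linorder_less_linear order.strict_trans)
  then show ?case
  proof cases
    case 1
    then show ?thesis using less.prems c_diag by simp
  next
    case 2
    then show ?thesis using ord less.prems by blast
  next
    case 3
    have "X j (E i M) K = X i (E j M) K + (\<Sum>k<n. c j i k * E k M K)"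
      using ord less.prems 3 by blast
    moreover have "(\<Sum>k<n. c j i k * E k M K) = - (\<Sum>k<n. c i j k * E k M K)"
      unfolding sum_negf[symmetric] using less.prems antisym[of j i]
      by (intro sum.cong) auto
    ultimately show ?thesis by simp
  next
    case (4 l')
    obtain l N where l: "l \<le> l'" "l < n" "M = inc l N" "\<And>k. k < l \<Longrightarrow> N k = 0" "mi n N"
      using least_letter[OF less.prems(3) 4(3)] by metis
    have d: "deg n M = Suc (deg n N)" using l by (simp add: deg_inc)
    have IH: "X a (E b P) K = X b (E a P) K + (\<Sum>k<n. c a b k * E k P K)"
      if "a < n" "b < n" "P \<in> Mon n (deg n N)" for a b P K
      using less.hyps[of P a b K] that d by (auto simp: Mon_def)
    have N: "N \<in> Mon n (deg n N)" using l by (simp add: Mon_def)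
    have main: "X i (E j M) K = X l (X i (E j N)) K + (\<Sum>k<n. c i l k * X k (E j N) K)
        + (\<Sum>k<n. c j l k * X k (E i N) K) + (\<Sum>k<n. c j l k * (\<Sum>m<n. c i k m * E m N K))"
      if ij: "i < n" "j < n" "l < i" "l < j" for i j
    proof -
      have "E j M = (\<lambda>K. X l (E j N) K + (\<Sum>k<n. c j l k * E k N K))"
        unfolding l(3) using pbw_commute_ordered[of j n l N c] ij l by blast
      then have "X i (E j M) K = X i (X l (E j N)) K + (\<Sum>k<n. c j l k * X i (E k N) K)"
        using X_lincomb[of "X l (E j N)" "\<lambda>k. E k N" i "c j l" K]
        by (simp add: fin_supp_XE fin_supp_pbw ij l)
      also have "X i (X l (E j N)) K = X l (X i (E j N)) K + (\<Sum>k<n. c i l k * X k (E j N) K)"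
      proof (rule X_comm_lift)
        fix P K assume P: "E j N P \<noteq> 0"
        show "mi n P" using pbw_mi[OF _ _ P] ij l by auto
        \<comment> \<open>The top monomial j N has the degree of M, out of reach of the induction
          hypothesis, but all its letters are at least l, so \<open>ord\<close> applies. The lower
          monomials fall under the induction hypothesis.\<close>
        from pbw_supp[OF _ _ P] ij l consider "P = inc j N" | "P \<in> Mon n (deg n N)" by auto
        then show "X i (E l P) K = X l (E i P) K + (\<Sum>k<n. c i l k * E k P K)"
        proof cases
          case 1
          show ?thesis by (rule ord) (use 1 ij l in \<open>auto simp: mi_inc\<close>)
        next
          case 2
          then show ?thesis using IH ij l by blast
        qed
      qed (use ij l in \<open>auto simp: fin_supp_pbw\<close>)
      also have "(\<Sum>k<n. c j l k * X i (E k N) K)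
          = (\<Sum>k<n. c j l k * X k (E i N) K) + (\<Sum>k<n. c j l k * (\<Sum>m<n. c i k m * E m N K))"
        unfolding sum.distrib[symmetric] distrib_left[symmetric]
        by (rule sum.cong[OF refl], subst IH[OF ij(1) _ N]) auto
      finally show ?thesis by (simp add: algebra_simps)
    qed
    \<comment> \<open>In the difference of \<open>main\<close> for (i, j) and for (j, i), the two
      sums with one bracket against l trade places and cancel. The first summands are compared by
      applying l to the relation for i and j on N.\<close>
    have "X l (X i (E j N)) K = X l (\<lambda>K. X j (E i N) K + (\<Sum>k<n. c i j k * E k N K)) K"
      by (rule arg_cong[of _ _ "\<lambda>p. X l p K"], rule ext, rule IH[OF less.prems(1,2) N])
    also have "\<dots> = X l (X j (E i N)) K + (\<Sum>k<n. c i j k * X l (E k N) K)"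
      using X_lincomb[of "X j (E i N)" "\<lambda>k. E k N" l "c i j" K]
      by (simp add: fin_supp_XE fin_supp_pbw less.prems l)
    also have "(\<Sum>k<n. c i j k * X l (E k N) K)
        = (\<Sum>k<n. c i j k * E k M K) + (\<Sum>k<n. c i j k * (\<Sum>m<n. c l k m * E m N K))"
    proof -
      have "X k (E l N) K = E k M K" for k
        using pbw_ordered[of l N n c] l by (simp add: X_mono)
      then show ?thesis
        unfolding sum.distrib[symmetric] distrib_left[symmetric]
        by (intro sum.cong[OF refl], subst IH[OF l(2) _ N]) auto
    qed
    finally have top: "X l (X i (E j N)) K = X l (X j (E i N)) K + (\<Sum>k<n. c i j k * E k M K)
        + (\<Sum>k<n. c i j k * (\<Sum>m<n. c l k m * E m N K))" by simp
    \<comment> \<open>These are all the remaining terms, collected by \<open>E m N\<close>;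
      antisymmetry in i and l turns each coefficient into the Jacobi sum.\<close>
    have "(\<Sum>k<n. c j l k * (\<Sum>m<n. c i k m * E m N K)) - (\<Sum>k<n. c i l k * (\<Sum>m<n. c j k m * E m N K))
        + (\<Sum>k<n. c i j k * (\<Sum>m<n. c l k m * E m N K))
      = (\<Sum>m<n. (\<Sum>k<n. c j l k * c i k m - c i l k * c j k m + c i j k * c l k m) * E m N K)"
      unfolding sum_distrib_left sum_distrib_right sum_subtractf[symmetric] sum.distrib[symmetric]
      by (subst sum.swap) (simp add: algebra_simps sum.distrib sum_subtractf)
    also have "\<dots> = (\<Sum>m<n. 0)"
    proof (rule sum.cong[OF refl])
      fix m assume m: "m \<in> {..<n}"
      have "(\<Sum>k<n. c j l k * c i k m - c i l k * c j k m + c i j k * c l k m)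
          = (\<Sum>k<n. c j l k * c i k m + c l i k * c j k m + c i j k * c l k m)"
        using antisym[of i l] less.prems l by (intro sum.cong) auto
      then show "(\<Sum>k<n. c j l k * c i k m - c i l k * c j k m + c i j k * c l k m) * E m N K = 0"
        using jacobi[of i j l m] less.prems l m by simp
    qed
    finally show ?thesis
      using main[of i j] main[of j i] top less.prems l 4 by (simp add: algebra_simps)
  qed
qed

end

section \<open>Words and the free algebra\<close>

abbreviation cnt :: "nat list \<Rightarrow> nat \<Rightarrow> nat" where
  "cnt w \<equiv> count (mset w)"

abbreviation over :: "nat \<Rightarrow> nat list \<Rightarrow> bool" where
  "over n w \<equiv> set w \<subseteq> {..<n}"

lemma cnt_Nil: "cnt [] = (\<lambda>_. 0)"
  by (rule ext) simp

lemma cnt_Cons: "cnt (i # w) = inc i (cnt w)"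
  by (rule ext) simp

lemma mi_cnt: "mi n (cnt w) \<longleftrightarrow> over n w"
  unfolding mi_def by (auto simp: subset_iff count_eq_zero_iff) (meson not_le)

lemma deg_cnt: "over n w \<Longrightarrow> deg n (cnt w) = length w"
proof (induction w)
  case Nil
  then show ?case by (simp add: deg_def)
next
  case (Cons i w)
  then show ?case by (simp only: cnt_Cons) (simp add: deg_inc del: fun_upd_apply)
qed

definition single :: "nat list \<Rightarrow> nat list \<Rightarrow> 'k::comm_ring_1" where
  "single u w = (if w = u then 1 else 0)"

lemma fin_supp_word: "fin_supp (single u :: _ \<Rightarrow> 'k::comm_ring_1)"
  unfolding single_def[abs_def] by (rule fin_supp_single)

lemma fpair_word: "fpair F (single u) = F u"
  unfolding single_def[abs_def] by (simp add: fpair_single)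

lemma fgen_single: "fgen i = single [i]"
  by (rule ext) (simp add: fgen_def single_def)

lemma fmul_single: "fmul (single u) (single v) = (single (u @ v) :: _ \<Rightarrow> 'k::comm_ring_1)"
proof (rule ext)
  fix w
  have "fmul (single u) (single v) w
      = (\<Sum>i\<le>length w. if i = length u then (if w = u @ v then 1 else 0) else (0::'k))"
    unfolding fmul_def
  proof (rule sum.cong[OF refl])
    fix i assume "i \<in> {..length w}"
    then have "(take i w = u \<and> drop i w = v) \<longleftrightarrow> (i = length u \<and> w = u @ v)"
      by (metis append_take_drop_id append_eq_conv_conj atMost_iff length_take min.absorb2)
    moreover have "single u (take i w) * single v (drop i w)
        = (if take i w = u \<and> drop i w = v then 1 else (0::'k))"
      by (simp add: single_def)
    ultimately show "single u (take i w) * single v (drop i w)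
        = (if i = length u then (if w = u @ v then 1 else 0) else (0::'k))"
      by simp
  qed
  also have "\<dots> = single (u @ v) w"
    by (auto simp: single_def)
  finally show "fmul (single u) (single v) w = (single (u @ v) w :: 'k)" .
qed

lemma fmul_split:
  "fmul a b w = (\<Sum>(u, v)\<in>(\<lambda>i. (take i w, drop i w)) ` {..length w}. a u * b v)"
proof -
  have "inj_on (\<lambda>i. (take i w, drop i w)) {..length w}"
    by (rule inj_onI) (metis Pair_inject atMost_iff length_take min.absorb2)
  then show ?thesis by (simp add: sum.reindex fmul_def)
qed

lemma fmul_nonzeroE:
  assumes "fmul a b w \<noteq> (0::'k::comm_ring_1)"
  obtains u v where "w = u @ v" "a u \<noteq> 0" "b v \<noteq> 0"
proof -
  have "(\<Sum>i\<le>length w. a (take i w) * b (drop i w)) \<noteq> 0"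
    using assms by (simp add: fmul_def)
  then obtain i where "a (take i w) * b (drop i w) \<noteq> 0"
    by (rule sum.not_neutral_contains_not_neutral)
  then have "a (take i w) \<noteq> 0" "b (drop i w) \<noteq> 0" by auto
  then show thesis using that[of "take i w" "drop i w"] by simp
qed

lemma fmul_supp:
  "{w. fmul a b w \<noteq> 0} \<subseteq> (\<lambda>(u, v). u @ v) ` ({u. a u \<noteq> 0} \<times> {v. b v \<noteq> (0::'k::comm_ring_1)})"
proof
  fix w assume "w \<in> {w. fmul a b w \<noteq> 0}"
  then have "fmul a b w \<noteq> 0" by simp
  then obtain u v where "w = u @ v" "a u \<noteq> 0" "b v \<noteq> 0" by (rule fmul_nonzeroE)
  then show "w \<in> (\<lambda>(u, v). u @ v) ` ({u. a u \<noteq> 0} \<times> {v. b v \<noteq> 0})"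
    by (intro image_eqI[of _ _ "(u, v)"]) simp_all
qed

lemma fin_supp_fmul: "fin_supp a \<Longrightarrow> fin_supp b \<Longrightarrow> fin_supp (fmul a b)"
  by (rule finite_subset[OF fmul_supp]) simp

lemma tpoly_fmul:
  assumes "tpoly n a" "tpoly n b"
  shows "tpoly n (fmul a (b :: _ \<Rightarrow> 'k::comm_ring_1))"
  unfolding tpoly_def
proof (intro conjI allI impI)
  show "fin_supp (fmul a b)" using assms by (simp add: tpoly_def fin_supp_fmul)
  fix w assume "fmul a b w \<noteq> 0"
  then obtain u v where "w = u @ v" "a u \<noteq> 0" "b v \<noteq> 0" by (rule fmul_nonzeroE)
  then show "over n w" using assms by (simp add: tpoly_def)
qed

text \<open>The pairs (u, v) from the two supports are grouped by their concatenation w; each group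
  consists of the splittings of w with nonzero factors, so its weights add up to the coefficient of
  w in the product.\<close>

lemma fpair_fmul:
  assumes "fin_supp a" "fin_supp b"
  shows "fpair F (fmul a b) = fpair (\<lambda>u. fpair (\<lambda>v. F (u @ v)) b) a"
proof -
  let ?A = "{u. a u \<noteq> 0}" and ?B = "{v. b v \<noteq> 0}"
  let ?app = "\<lambda>(u, v). u @ v"
  have "fpair (\<lambda>u. fpair (\<lambda>v. F (u @ v)) b) a = (\<Sum>(u, v)\<in>?A \<times> ?B. a u * (b v * F (u @ v)))"
    by (simp add: fpair_def sum_distrib_left sum.cartesian_product)
  also have "\<dots> = (\<Sum>w\<in>?app ` (?A \<times> ?B). \<Sum>(u, v)\<in>{z \<in> ?A \<times> ?B. ?app z = w}. a u * (b v * F (u @ v)))"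
    using assms by (intro sum.image_gen) simp
  also have "\<dots> = (\<Sum>w\<in>?app ` (?A \<times> ?B). fmul a b w * F w)"
  proof (rule sum.cong[OF refl])
    fix w
    have "(\<Sum>(u, v)\<in>{z \<in> ?A \<times> ?B. ?app z = w}. a u * (b v * F (u @ v)))
        = (\<Sum>(u, v)\<in>{z \<in> ?A \<times> ?B. ?app z = w}. a u * b v) * F w"
      by (auto simp: sum_distrib_right mult.assoc intro!: sum.cong)
    also have "(\<Sum>(u, v)\<in>{z \<in> ?A \<times> ?B. ?app z = w}. a u * b v) = fmul a b w"
      unfolding fmul_split
    proof (rule sum.mono_neutral_left)
      show "{z \<in> ?A \<times> ?B. ?app z = w} \<subseteq> (\<lambda>i. (take i w, drop i w)) ` {..length w}"
      proof
        fix z assume "z \<in> {z \<in> ?A \<times> ?B. ?app z = w}"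
        then have "z = (take (length (fst z)) w, drop (length (fst z)) w) \<and> length (fst z) \<le> length w"
          by auto
        then show "z \<in> (\<lambda>i. (take i w, drop i w)) ` {..length w}" by blast
      qed
    qed auto
    finally show "(\<Sum>(u, v)\<in>{z \<in> ?A \<times> ?B. ?app z = w}. a u * (b v * F (u @ v))) = fmul a b w * F w" .
  qed
  also have "\<dots> = fpair F (fmul a b)"
    using assms fmul_supp[of a b] by (intro fpair_superset[symmetric]) auto
  finally show ?thesis by simp
qed

lemma fmul_lincomb_right:
  "fmul a (\<lambda>w. p w - q w - (\<Sum>k\<in>T. r k * s k w)) w
    = fmul a p w - fmul a q w - (\<Sum>k\<in>T. r k * fmul a (s k) w)"
proof -
  have "(\<Sum>i\<le>length w. a (take i w) * (\<Sum>k\<in>T. r k * s k (drop i w)))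
      = (\<Sum>k\<in>T. r k * fmul a (s k) w)"
    unfolding fmul_def sum_distrib_left by (subst sum.swap) (simp add: mult.left_commute)
  then show ?thesis by (simp add: fmul_def right_diff_distrib sum_subtractf)
qed

lemma fmul_lincomb_left:
  "fmul (\<lambda>w. p w - q w - (\<Sum>k\<in>T. r k * s k w)) a w
    = fmul p a w - fmul q a w - (\<Sum>k\<in>T. r k * fmul (s k) a w)"
proof -
  have "(\<Sum>i\<le>length w. (\<Sum>k\<in>T. r k * s k (take i w)) * a (drop i w))
      = (\<Sum>k\<in>T. r k * fmul (s k) a w)"
    unfolding fmul_def sum_distrib_left sum_distrib_right by (subst sum.swap) (simp add: mult.assoc)
  then show ?thesis by (simp add: fmul_def left_diff_distrib sum_subtractf)
qed

lemma rel_single: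
  "rel n c i j = (\<lambda>w. single [i, j] w - single [j, i] w - (\<Sum>k<n. c i j k * single [k] w))"
  by (rule ext) (simp add: rel_def fgen_single fmul_single)

lemma tpoly_add: "tpoly n a \<Longrightarrow> tpoly n b \<Longrightarrow> tpoly n (\<lambda>w. a w + (b w :: 'k::comm_ring_1))"
  unfolding tpoly_def using fin_supp_add[of a b] by (metis add.right_neutral)

lemma tpoly_scale: "tpoly n a \<Longrightarrow> tpoly n (\<lambda>w. r * (a w :: 'k::comm_ring_1))"
  unfolding tpoly_def using fin_supp_scale[of a r] by (metis mult_zero_right)

lemma tpoly_diff: "tpoly n a \<Longrightarrow> tpoly n b \<Longrightarrow> tpoly n (\<lambda>w. a w - (b w :: 'k::comm_ring_1))"
  using tpoly_add[of n a "\<lambda>w. -1 * b w"] tpoly_scale[of n b "-1"] by simp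

lemma tpoly_zero: "tpoly n (\<lambda>w. 0)"
  by (simp add: tpoly_def)

lemma tpoly_sum:
  "finite T \<Longrightarrow> (\<And>t. t \<in> T \<Longrightarrow> tpoly n (a t)) \<Longrightarrow> tpoly n (\<lambda>w. \<Sum>t\<in>T. (a t w :: 'k::comm_ring_1))"
  by (induction T rule: finite_induct) (auto simp: tpoly_zero intro: tpoly_add)

lemma tpoly_single: "over n w \<Longrightarrow> tpoly n (single w :: _ \<Rightarrow> 'k::comm_ring_1)"
  unfolding tpoly_def using fin_supp_word[of w] by (auto simp: single_def split: if_splits)

lemma tpoly_rel: "i < n \<Longrightarrow> j < n \<Longrightarrow> tpoly n (rel n c i j)"
  unfolding rel_single by (intro tpoly_diff tpoly_sum tpoly_scale tpoly_single) auto

lemma lie_ideal_tpoly: "a \<in> lie_ideal n c \<Longrightarrow> tpoly n a"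
  by (induction rule: lie_ideal.induct) (auto intro: tpoly_zero tpoly_fmul tpoly_add tpoly_rel)

text \<open>The closure rules of \<open>lie_ideal\<close> contain no scalar multiplication; the
  scalar is absorbed into the left factor of each generator.\<close>

lemma lie_ideal_scale:
  assumes "a \<in> lie_ideal n c"
  shows "(\<lambda>w. r * a w) \<in> lie_ideal n c"
  using assms
proof (induction rule: lie_ideal.induct)
  case zero
  then show ?case using lie_ideal.zero by simp
next
  case (gen a b i j)
  have "(\<lambda>w. r * fmul (fmul a (rel n c i j)) b w) = fmul (fmul (\<lambda>w. r * a w) (rel n c i j)) b"
    by (rule ext) (simp add: fmul_def sum_distrib_left sum_distrib_right mult.assoc)
  then show ?case using gen lie_ideal.gen[of n "\<lambda>w. r * a w" b i j c] by (simp add: tpoly_scale)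
next
  case (add u v)
  then show ?case using lie_ideal.add by (simp add: distrib_left)
qed

lemma lie_ideal_words:
  assumes "over n u" "over n v" "i < n" "j < n"
  shows "(\<lambda>w. single (u @ [i, j] @ v) w - single (u @ [j, i] @ v) w
    - (\<Sum>k<n. c i j k * single (u @ [k] @ v) w)) \<in> lie_ideal n c"
proof -
  have "fmul (fmul (single u) (rel n c i j)) (single v)
    = (\<lambda>w. single (u @ [i, j] @ v) w - single (u @ [j, i] @ v) w
    - (\<Sum>k<n. c i j k * single (u @ [k] @ v) w))"
    unfolding rel_single fmul_lincomb_right[abs_def] fmul_lincomb_left[abs_def] fmul_single by simp
  then show ?thesis
    using lie_ideal.gen[OF tpoly_single tpoly_single assms(3,4), OF assms(1,2), of c] by simp
qed

section \<open>Functionals vanishing on the ideal\<close>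

definition annih :: "nat \<Rightarrow> (nat \<Rightarrow> nat \<Rightarrow> nat \<Rightarrow> 'k::comm_ring_1) \<Rightarrow> (nat list \<Rightarrow> 'k) \<Rightarrow> bool" where
  "annih n c F \<longleftrightarrow> (\<forall>u v i j. over n u \<longrightarrow> over n v \<longrightarrow> i < n \<longrightarrow> j < n \<longrightarrow>
     F (u @ [i, j] @ v) = F (u @ [j, i] @ v) + (\<Sum>k<n. c i j k * F (u @ [k] @ v)))"

lemma annihD:
  "annih n c F \<Longrightarrow> over n u \<Longrightarrow> over n v \<Longrightarrow> i < n \<Longrightarrow> j < n \<Longrightarrow>
     F (u @ [i, j] @ v) = F (u @ [j, i] @ v) + (\<Sum>k<n. c i j k * F (u @ [k] @ v))"
  unfolding annih_def by blast

lemma fpair_words: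
  "fpair F (\<lambda>w. single x w - single y w - (\<Sum>k<n::nat. r k * single (z k) w))
    = F x - F y - (\<Sum>k<n. r k * F (z k))"
proof -
  have fk: "fin_supp (\<lambda>w. r k * single (z k) w)" for k
    by (rule fin_supp_scale[OF fin_supp_word])
  have "fpair F (\<lambda>w. \<Sum>k<n. r k * single (z k) w) = (\<Sum>k<n. r k * F (z k))"
    by (subst fpair_sum[OF _ fk]) (simp_all add: fpair_scale[OF fin_supp_word] fpair_word)
  then show ?thesis
    by (simp only: fpair_diff[OF fin_supp_diff[OF fin_supp_word fin_supp_word] fin_supp_sum[OF finite_lessThan fk]]
        fpair_diff[OF fin_supp_word fin_supp_word] fpair_word)
qed

text \<open>For a fixed word u of a, the functional \<open>G\<close> that sends y to the value of F
  on u y b satisfies the defining relation, since \<open>annih\<close> gives it for each word of b.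
  Testing F on words is therefore enough for the whole two-sided ideal.\<close>

lemma annih_lie_ideal:
  assumes F: "annih n c F" and "a \<in> lie_ideal n c"
  shows "fpair F a = 0"
  using assms(2)
proof (induction rule: lie_ideal.induct)
  case zero
  then show ?case by (simp add: fpair_def)
next
  case (gen a b i j)
  have fin: "fin_supp a" "fin_supp b" "fin_supp (rel n c i j)"
    using gen tpoly_rel[of i n j c] by (auto simp: tpoly_def)
  have "fpair F (fmul (fmul a (rel n c i j)) b)
      = fpair (\<lambda>u. fpair (\<lambda>y. fpair (\<lambda>v. F ((u @ y) @ v)) b) (rel n c i j)) a"
    by (simp only: fpair_fmul fin fin_supp_fmul)
  also have "\<dots> = fpair (\<lambda>u. 0) a"
  proof (rule fpair_cong)
    fix u assume "a u \<noteq> 0"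
    then have u: "over n u" using gen by (simp add: tpoly_def)
    define G where "G y = fpair (\<lambda>v. F ((u @ y) @ v)) b" for y
    have "G [i, j] = fpair (\<lambda>v. F ((u @ [j, i]) @ v) + (\<Sum>k<n. c i j k * F ((u @ [k]) @ v))) b"
      unfolding G_def
    proof (rule fpair_cong)
      fix v assume "b v \<noteq> 0"
      then have "over n v" using gen by (simp add: tpoly_def)
      then show "F ((u @ [i, j]) @ v) = F ((u @ [j, i]) @ v) + (\<Sum>k<n. c i j k * F ((u @ [k]) @ v))"
        using annihD[OF F u _ gen(3,4)] by simp
    qed
    then have "G [i, j] = G [j, i] + (\<Sum>k<n. c i j k * G [k])"
      unfolding fpair_lincomb_fun G_def .
    then have "fpair G (rel n c i j) = 0"
      unfolding rel_single fpair_words by simp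
    then show "fpair (\<lambda>y. fpair (\<lambda>v. F ((u @ y) @ v)) b) (rel n c i j) = 0"
      unfolding G_def .
  qed
  finally show ?case by (simp add: fpair_def)
next
  case (add u v)
  then show ?case using lie_ideal_tpoly by (subst fpair_add) (auto simp: tpoly_def)
qed

section \<open>Symmetrization\<close>

definition mfact :: "nat \<Rightarrow> (nat \<Rightarrow> nat) \<Rightarrow> 'k::field_char_0" where
  "mfact n m = (\<Prod>l<n. fact (m l))"

definition words :: "(nat \<Rightarrow> nat) \<Rightarrow> nat list set" where
  "words m = {w. cnt w = m}"

lemma mfact_nonzero [simp]: "mfact n m \<noteq> 0"
  by (simp add: mfact_def)

lemma cnt_letters: "mi n m \<Longrightarrow> cnt (letters n m) = m"
proof
  fix i assume m: "mi n m"
  have "cnt (letters n m) i = (if i < n then m i else 0)" for n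
    by (induction n) (auto simp: letters_def less_Suc_eq)
  then show "cnt (letters n m) i = m i" using m by (simp add: mi_def)
qed

lemma over_letters: "mi n m \<Longrightarrow> over n (letters n m)"
  using mi_cnt[of n "letters n m"] by (simp add: cnt_letters)

lemma length_letters: "mi n m \<Longrightarrow> length (letters n m) = deg n m"
  using deg_cnt[OF over_letters] by (simp add: cnt_letters)

lemma words_letters: "mi n m \<Longrightarrow> words m = permutations_of_multiset (mset (letters n m))"
  unfolding words_def permutations_of_multiset_def
  by (subst cnt_letters[symmetric], assumption) (simp only: count_inject)

lemma finite_words: "mi n m \<Longrightarrow> finite (words m)"
  by (simp add: words_letters)

lemma words_over: "mi n m \<Longrightarrow> w \<in> words m \<Longrightarrow> over n w"
  using mi_cnt[of n w] by (simp add: words_def)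

lemma words_length: "mi n m \<Longrightarrow> w \<in> words m \<Longrightarrow> length w = deg n m"
  using deg_cnt[OF words_over] by (simp add: words_def)

lemma card_words_nat: "mi n m \<Longrightarrow> card (words m) * (\<Prod>l<n. fact (m l)) = fact (deg n m)"
proof -
  assume m: "mi n m"
  let ?A = "mset (letters n m)"
  have "card (words m) * (\<Prod>x\<in>set_mset ?A. fact (count ?A x)) = fact (size ?A)"
    unfolding words_letters[OF m] by (rule card_permutations_of_multiset_aux)
  moreover have "(\<Prod>x\<in>set_mset ?A. fact (count ?A x)) = (\<Prod>x<n. fact (count ?A x) :: nat)"
  proof (rule prod.mono_neutral_left)
    show "\<forall>x\<in>{..<n} - set_mset ?A. fact (count ?A x) = (1 :: nat)"
      by (metis DiffD2 fact_0 not_in_iff)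
  qed (use over_letters[OF m] in simp_all)
  ultimately show ?thesis by (simp add: cnt_letters m length_letters)
qed

lemma card_words: "mi n m \<Longrightarrow> of_nat (card (words m)) * mfact n m = (fact (deg n m) :: 'k::field_char_0)"
  using arg_cong[OF card_words_nat, of n m "of_nat :: nat \<Rightarrow> 'k"] by (simp add: mfact_def)

text \<open>Composing with a permutation that carries one word to another injects the fibre over the
  one into the fibre over the other, so all fibres over \<open>words m\<close> have the same size.
  Together they exhaust the \<open>fact (deg n m)\<close> permutations, and
  \<open>card_words_nat\<close> gives the common size.\<close>

lemma card_stabilizer:
  assumes "mi n m" "w \<in> words m"
  shows "card {\<sigma>. \<sigma> permutes {..<deg n m} \<and> permute_list \<sigma> (letters n m) = w} = (\<Prod>l<n. fact (m l))"
proof -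
  let ?l = "letters n m" and ?k = "deg n m"
  define S where "S w = {\<sigma>. \<sigma> permutes {..<?k} \<and> permute_list \<sigma> ?l = w}" for w
  have fin: "finite (S w)" for w
    unfolding S_def by (rule finite_subset[OF _ finite_permutations[of "{..<?k}"]]) auto
  have le: "card (S v) \<le> card (S u)" if uv: "u \<in> words m" "v \<in> words m" for u v
  proof -
    have "mset u = mset v" using uv by (simp add: words_letters[OF assms(1)] permutations_of_multiset_def)
    then obtain p where p: "p permutes {..<length v}" "permute_list p v = u" by (rule mset_eq_permutation)
    have p': "p permutes {..<?k}" using p words_length[OF assms(1) uv(2)] by simp
    show ?thesis
    proof (rule card_inj_on_le)
      show "inj_on (\<lambda>\<sigma>. \<sigma> \<circ> p) (S v)"
      proof (rule inj_onI)
        fix \<sigma> \<tau> assume "\<sigma> \<circ> p = \<tau> \<circ> p"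
        then have "(\<sigma> \<circ> p) \<circ> inv p = (\<tau> \<circ> p) \<circ> inv p" by simp
        then show "\<sigma> = \<tau>" using permutes_inv_o[OF p'] by (simp add: comp_assoc)
      qed
      show "(\<lambda>\<sigma>. \<sigma> \<circ> p) ` S v \<subseteq> S u"
        using p p' permute_list_compose[of p ?l] length_letters[OF assms(1)]
        by (auto simp: S_def intro: permutes_compose)
    qed (rule fin)
  qed
  have const: "card (S v) = card (S w)" if "v \<in> words m" for v
    using le[OF that assms(2)] le[OF assms(2) that] by simp
  have "(\<Union>v\<in>words m. S v) = {\<sigma>. \<sigma> permutes {..<?k}}"
  proof -
    have "permute_list \<sigma> ?l \<in> words m" if "\<sigma> permutes {..<?k}" for \<sigma>
      using that by (simp add: words_letters[OF assms(1)] permutations_of_multiset_def length_letters[OF assms(1)])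
    then show ?thesis by (auto simp: S_def)
  qed
  moreover have "card (\<Union>v\<in>words m. S v) = (\<Sum>v\<in>words m. card (S v))"
    by (rule card_UN_disjoint) (use fin finite_words[OF assms(1)] in \<open>auto simp: S_def\<close>)
  ultimately have "(\<Sum>v\<in>words m. card (S v)) = fact ?k"
    by (simp add: card_permutations)
  then have "card (words m) * card (S w) = card (words m) * (\<Prod>l<n. fact (m l))"
    using const card_words_nat[OF assms(1)] by simp
  moreover have "card (words m) \<noteq> 0"
    using assms finite_words[OF assms(1)] by auto
  ultimately show ?thesis by (simp add: S_def)
qed

lemma xi_mon_eq:
  assumes "mi n m"
  shows "xi_mon n m w = (if cnt w = m then mfact n m / fact (length w) else (0 :: 'k::field_char_0))"
proof -
  have *: "xi_mon n m w = (of_nat (card {\<sigma>. \<sigma> permutes {..<deg n m} \<and> permute_list \<sigma> (letters n m) = w})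
      / fact (deg n m) :: 'k)"
    by (simp add: xi_mon_def Let_def permute_list_def length_letters[OF assms])
  show ?thesis
  proof (cases "cnt w = m")
    case True
    then have w: "w \<in> words m" by (simp add: words_def)
    show ?thesis
      unfolding * card_stabilizer[OF assms w] words_length[OF assms w] using True by (simp add: mfact_def)
  next
    case False
    then have "{\<sigma>. \<sigma> permutes {..<deg n m} \<and> permute_list \<sigma> (letters n m) = w} = {}"
      using length_letters[OF assms] cnt_letters[OF assms] by auto
    then show ?thesis unfolding * by (simp only: card.empty False if_False of_nat_0 div_0)
  qed
qed

lemma xi_eq:
  assumes "spoly n f"
  shows "xi n f w = f (cnt w) * mfact n (cnt w) / fact (length w)"
proof -
  have "xi n f w = (\<Sum>m | f m \<noteq> 0. if m = cnt w then f m * (mfact n m / fact (length w)) else 0)"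
    unfolding xi_def
  proof (rule sum.cong[OF refl])
    fix m assume "m \<in> {m. f m \<noteq> 0}"
    then have "mi n m" using assms by (simp add: spoly_def)
    then show "f m * xi_mon n m w = (if m = cnt w then f m * (mfact n m / fact (length w)) else 0)"
      by (auto simp: xi_mon_eq)
  qed
  also have "\<dots> = f (cnt w) * (mfact n (cnt w) / fact (length w))"
    using assms by (simp add: spoly_def sum.delta)
  finally show ?thesis by simp
qed

lemma xi_nonzero: "spoly n f \<Longrightarrow> xi n f w \<noteq> 0 \<longleftrightarrow> f (cnt w) \<noteq> 0"
  by (simp add: xi_eq)

lemma spolyD: "spoly n f \<Longrightarrow> f m \<noteq> 0 \<Longrightarrow> mi n m"
  by (simp add: spoly_def)

lemma spoly_fin: "spoly n f \<Longrightarrow> fin_supp f"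
  by (simp add: spoly_def)

lemma xi_supp: "spoly n f \<Longrightarrow> {w. xi n f w \<noteq> 0} = (\<Union>m\<in>{m. f m \<noteq> 0}. words m)"
  by (auto simp: xi_nonzero words_def)

lemma tpoly_xi: "spoly n f \<Longrightarrow> tpoly n (xi n f)"
  unfolding tpoly_def xi_supp
  by (auto simp: spoly_def xi_nonzero mi_cnt[symmetric] intro!: finite_words)

text \<open>This is the value of F on xi(x^m) / m! and not the arithmetic mean over
  \<open>words m\<close>, which would be larger by the factor \<open>mfact n m\<close> (see
  \<open>card_words\<close>). Divided powers keep binomial coefficients out of the coproduct formula
  \<open>avg_unshuffle\<close>.\<close>

definition avg :: "nat \<Rightarrow> (nat \<Rightarrow> nat) \<Rightarrow> (nat list \<Rightarrow> 'k::field_char_0) \<Rightarrow> 'k" where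
  "avg n m F = (\<Sum>w\<in>words m. F w) / fact (deg n m)"

lemma avg_cong:
  assumes "mi n m" "\<And>w. w \<in> words m \<Longrightarrow> over n w \<Longrightarrow> F w = G w"
  shows "avg n m F = avg n m G"
proof -
  have "(\<Sum>w\<in>words m. F w) = (\<Sum>w\<in>words m. G w)"
    using assms words_over[OF assms(1)] by (intro sum.cong) auto
  then show ?thesis by (simp add: avg_def)
qed

lemma fpair_xi:
  assumes "spoly n f"
  shows "fpair F (xi n f) = fpair (\<lambda>m. mfact n m * avg n m F) f"
proof -
  have "fpair F (xi n f) = (\<Sum>w\<in>(\<Union>m\<in>{m. f m \<noteq> 0}. words m). xi n f w * F w)"
    by (simp add: fpair_def xi_supp[OF assms])
  also have "\<dots> = (\<Sum>m | f m \<noteq> 0. \<Sum>w\<in>words m. xi n f w * F w)"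
    by (rule sum.UNION_disjoint)
      (use assms in \<open>auto simp: spoly_def words_def intro!: finite_words[unfolded words_def]\<close>)
  also have "\<dots> = (\<Sum>m | f m \<noteq> 0. f m * (mfact n m * avg n m F))"
  proof (rule sum.cong[OF refl])
    fix m assume "m \<in> {m. f m \<noteq> 0}"
    then have "mi n m" using assms by (simp add: spoly_def)
    have "(\<Sum>w\<in>words m. xi n f w * F w) = (\<Sum>w\<in>words m. (f m * mfact n m / fact (deg n m)) * F w)"
    proof (rule sum.cong[OF refl])
      fix w assume w: "w \<in> words m"
      then show "xi n f w * F w = (f m * mfact n m / fact (deg n m)) * F w"
        using words_length[OF \<open>mi n m\<close> w] by (simp add: xi_eq[OF assms] words_def)
    qed
    then show "(\<Sum>w\<in>words m. xi n f w * F w) = f m * (mfact n m * avg n m F)"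
      by (simp only: sum_distrib_left[symmetric]) (simp add: avg_def)
  qed
  finally show ?thesis by (simp add: fpair_def)
qed

lemma spoly_add: "spoly n f \<Longrightarrow> spoly n g \<Longrightarrow> spoly n (\<lambda>m. f m + (g m :: 'k::comm_ring_1))"
  unfolding spoly_def using fin_supp_add[of f g] by (metis add.right_neutral)

lemma spoly_scale: "spoly n f \<Longrightarrow> spoly n (\<lambda>m. r * (f m :: 'k::comm_ring_1))"
  unfolding spoly_def using fin_supp_scale[of f r] by (metis mult_zero_right)

lemma spoly_zero: "spoly n (\<lambda>m. 0)"
  by (simp add: spoly_def)

lemma spoly_mono: "mi n m \<Longrightarrow> spoly n (mono m :: _ \<Rightarrow> 'k::comm_ring_1)"
  unfolding spoly_def using fin_supp_mono[of m] by (auto simp: mono_def split: if_splits)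

lemma xi_add: "spoly n f \<Longrightarrow> spoly n g \<Longrightarrow> xi n (\<lambda>m. f m + g m) w = xi n f w + xi n g w"
  by (simp add: xi_eq spoly_add add_divide_distrib distrib_right)

lemma xi_scale: "spoly n f \<Longrightarrow> xi n (\<lambda>m. r * f m) w = r * xi n f w"
  by (simp add: xi_eq spoly_scale)

lemma xi_zero: "xi n (\<lambda>m. 0) w = 0"
  by (simp add: xi_def)

lemma xi_mono: "mi n m \<Longrightarrow> xi n (mono m) w = (if w \<in> words m then 1 / of_nat (card (words m)) else (0::'k::field_char_0))"
proof -
  assume m: "mi n m"
  have "of_nat (card (words m)) * mfact n m / fact (deg n m) = (1::'k)"
    using card_words[OF m] by simp
  then have "mfact n m / fact (deg n m) = (1 / of_nat (card (words m)) :: 'k)"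
    using inverse_unique[of "of_nat (card (words m)) :: 'k" "mfact n m / fact (deg n m)"]
    by (simp add: inverse_eq_divide)
  then show ?thesis
    using words_length[OF m, of w] by (auto simp: xi_eq spoly_mono m mono_def words_def)
qed

section \<open>Poincare-Birkhoff-Witt: linear independence\<close>

context lie_alg
begin

text \<open>A word of generators applied to the vector 1 of the module. This factors through U(g),
  and its leading term is the commutative image of the word, so it separates symmetrized monomials
  modulo the ideal.\<close>

fun rep :: "nat list \<Rightarrow> (nat \<Rightarrow> nat) \<Rightarrow> 'k" where
  "rep [] = mono (\<lambda>_. 0)"
| "rep (i # w) = X i (rep w)"

text \<open>The error terms of \<open>pbw\<close> have degree at most the length of the word acted
  on, which is one less than that of the new word. Finite support and the bound on the variables are
  carried along because the induction step applies X to the whole remainder.\<close>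

lemma rep_lower:
  assumes "over n w"
  shows "(rep w K \<noteq> mono (cnt w) K \<longrightarrow> mi n K \<and> deg n K < length w) \<and> fin_supp (rep w) \<and> (rep w K \<noteq> 0 \<longrightarrow> mi n K)"
  using assms
proof (induction w arbitrary: K)
  case Nil
  have "fin_supp (mono (\<lambda>_. 0) :: _ \<Rightarrow> 'k)" by (rule fin_supp_mono)
  moreover have "mono (\<lambda>_. 0) K \<noteq> (0::'k) \<Longrightarrow> mi n K" by (auto simp: mono_def mi_def split: if_splits)
  moreover have "rep [] K = mono (cnt []) K" unfolding cnt_Nil by simp
  ultimately show ?case by simp
next
  case (Cons i w)
  have i: "i < n" and w: "over n w" using Cons.prems by auto
  note IH = Cons.IH[OF w]
  have miw: "mi n (cnt w)" using w by (simp add: mi_cnt)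
  have fs: "fin_supp (rep w)" using IH by blast
  have fin: "fin_supp (rep (i # w))" unfolding rep.simps by (rule fin_supp_X[OF i fs]) (use IH in blast)
  let ?r = "\<lambda>P. rep w P - mono (cnt w) P"
  have fr: "fin_supp ?r" by (rule fin_supp_diff[OF fs fin_supp_mono])
  have "X i ?r K = X i (rep w) K - E i (cnt w) K"
    unfolding xact_def fpair_diff[OF fs fin_supp_mono] fpair_mono ..
  then have eq: "rep (i # w) K = E i (cnt w) K + X i ?r K" by simp
  have low: "mi n K \<and> deg n K < length (i # w)" if ne: "rep (i # w) K \<noteq> mono (cnt (i # w)) K"
  proof -
    have "E i (cnt w) K \<noteq> mono (inc i (cnt w)) K \<or> X i ?r K \<noteq> 0"
      using ne unfolding eq cnt_Cons by (auto simp del: fun_upd_apply)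
    then show ?thesis
    proof
      assume "E i (cnt w) K \<noteq> mono (inc i (cnt w)) K"
      then have "K \<in> Mon n (deg n (cnt w))" by (rule pbw_lower[OF i miw])
      then show ?thesis by (simp add: Mon_def deg_cnt[OF w])
    next
      assume "X i ?r K \<noteq> 0"
      then have "(\<Sum>P | ?r P \<noteq> 0. ?r P * E i P K) \<noteq> 0" by (simp only: xact_def fpair_def not_False_eq_True)
      then obtain P where P: "P \<in> {P. ?r P \<noteq> 0}" "?r P * E i P K \<noteq> 0"
        by (rule sum.not_neutral_contains_not_neutral)
      then have "rep w P \<noteq> mono (cnt w) P" by (simp only: mem_Collect_eq right_minus_eq not_False_eq_True)
      then have P': "mi n P" "deg n P < length w" using IH[of P] by blast+
      have "E i P K \<noteq> 0" using P(2) by (metis mult_zero_right)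
      from pbw_supp[OF i P'(1) this] show ?thesis
      proof
        assume "K = inc i P"
        then show ?thesis using P' i by (simp add: deg_inc mi_inc del: fun_upd_apply)
      next
        assume "K \<in> Mon n (deg n P)"
        then show ?thesis using P' by (simp add: Mon_def)
      qed
    qed
  qed
  have "mi n K" if "rep (i # w) K \<noteq> 0"
  proof (cases "rep (i # w) K = mono (cnt (i # w)) K")
    case True
    then have "mono (cnt (i # w)) K \<noteq> (0 :: 'k)" using that by simp
    then have "K = cnt (i # w)" unfolding mono_def by meson
    then show ?thesis using Cons.prems by (simp only: mi_cnt)
  next
    case False
    then show ?thesis using low by blast
  qed
  then show ?case using low fin by blast
qed

text \<open>Letters to the left of the relation act linearly, so induction on u leaves only the
  relation acting on \<open>rep v\<close>, which is \<open>pbw_commute\<close> lifted from monomials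
  by \<open>X_comm_lift\<close>.\<close>

lemma annih_rep: "annih n c (\<lambda>w. rep w K)"
  unfolding annih_def
proof (intro allI impI)
  fix u v i j assume uv: "over n u" "over n v" and ij: "i < n" "j < n"
  have fin: "fin_supp (rep w)" if "over n w" for w using rep_lower[OF that] by blast
  have mi: "rep w P \<noteq> 0 \<Longrightarrow> mi n P" if "over n w" for w P using rep_lower[OF that] by blast
  show "rep (u @ [i, j] @ v) K = rep (u @ [j, i] @ v) K + (\<Sum>k<n. c i j k * rep (u @ [k] @ v) K)"
    using uv(1)
  proof (induction u arbitrary: K)
    case Nil
    show ?case
      using X_comm_lift[OF ij fin[OF uv(2)] mi[OF uv(2)] pbw_commute[OF ij mi[OF uv(2)]]] by simp
  next
    case (Cons x u)
    have "rep (u @ [i, j] @ v) = (\<lambda>K. rep (u @ [j, i] @ v) K + (\<Sum>k<n. c i j k * rep (u @ [k] @ v) K))"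
      using Cons by (intro ext) auto
    moreover have "fin_supp (rep (u @ [j, i] @ v))" "k < n \<Longrightarrow> fin_supp (rep (u @ [k] @ v))" for k
      by (rule fin; use Cons.prems uv ij in auto)+
    ultimately show ?case
      using X_lincomb[of "rep (u @ [j, i] @ v)" "\<lambda>k. rep (u @ [k] @ v)" x "c i j" K]
      by (simp del: append.simps(2) add: append_Cons[of x])
  qed
qed

text \<open>Take M of maximal degree in h. No word in the support of \<open>xi n h\<close> is longer
  than \<open>deg n M\<close>, so only leading terms of \<open>rep\<close> can reach M, and the
  coefficient of \<open>rep\<close> at M evaluates to h M on \<open>xi n h\<close>. The same
  functional vanishes on the ideal.\<close>

lemma xi_injective:
  assumes h: "spoly n h" and I: "xi n h \<in> lie_ideal n c"
  shows "h = (\<lambda>_. 0)"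
proof (rule ccontr)
  assume "h \<noteq> (\<lambda>_. 0)"
  then have ne: "{m. h m \<noteq> 0} \<noteq> {}" by auto
  obtain M where M: "h M \<noteq> 0" and max: "\<And>m. h m \<noteq> 0 \<Longrightarrow> deg n m \<le> deg n M"
  proof -
    have "finite (deg n ` {m. h m \<noteq> 0})" using spoly_fin[OF h] by simp
    then have "Max (deg n ` {m. h m \<noteq> 0}) \<in> deg n ` {m. h m \<noteq> 0}" using ne by (intro Max_in) auto
    then obtain M where "h M \<noteq> 0" "deg n M = Max (deg n ` {m. h m \<noteq> 0})" by auto
    then show thesis using that \<open>finite (deg n ` {m. h m \<noteq> 0})\<close> by simp
  qed
  have "fpair (\<lambda>w. rep w M) (xi n h) = fpair (mono M) h"
    unfolding fpair_xi[OF h]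
  proof (rule fpair_cong)
    fix m assume m: "h m \<noteq> 0"
    have mi: "mi n m" using spolyD[OF h m] .
    have "avg n m (\<lambda>w. rep w M) = avg n m (\<lambda>w. mono M m)"
    proof (rule avg_cong[OF mi])
      fix w assume w: "w \<in> words m" "over n w"
      have "\<not> deg n M < length w" using max[OF m] words_length[OF mi w(1)] by simp
      then have "rep w M = mono (cnt w) M" using rep_lower[OF w(2), of M] by blast
      then show "rep w M = mono M m" using w(1) by (auto simp: words_def mono_def)
    qed
    then have "mfact n m * avg n m (\<lambda>w. rep w M)
        = (of_nat (card (words m)) * mfact n m) * mono M m / fact (deg n m)"
      by (simp add: avg_def)
    then show "mfact n m * avg n m (\<lambda>w. rep w M) = mono M m"
      unfolding card_words[OF mi] by simp
  qed
  also have "fpair (mono M) h = h M"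
  proof -
    have "fpair (mono M) h = (\<Sum>m | h m \<noteq> 0. if m = M then h m else 0)"
      unfolding fpair_def by (rule sum.cong) (auto simp: mono_def)
    then show ?thesis using M spoly_fin[OF h] by (simp add: sum.delta')
  qed
  finally show False using annih_lie_ideal[OF annih_rep I] M by simp
qed

text \<open>\<open>h\<close> is the image of \<open>a\<close> under T(g) \<open>\<rightarrow>\<close> U(g) followed by the inverse of xi.\<close>
definition nfs :: "(nat list \<Rightarrow> 'k) \<Rightarrow> ((nat \<Rightarrow> nat) \<Rightarrow> 'k) \<Rightarrow> bool" where
  "nfs a h \<longleftrightarrow> spoly n h \<and> (\<lambda>w. xi n h w - a w) \<in> lie_ideal n c"

lemma nfs_add:
  assumes "nfs a h" "nfs b g"
  shows "nfs (\<lambda>w. a w + b w) (\<lambda>m. h m + g m)"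
proof -
  have "(\<lambda>w. (xi n h w - a w) + (xi n g w - b w)) \<in> lie_ideal n c"
    using assms by (intro lie_ideal.add) (auto simp: nfs_def)
  then show ?thesis using assms by (simp add: nfs_def spoly_add xi_add algebra_simps)
qed

lemma nfs_scale:
  assumes "nfs a h"
  shows "nfs (\<lambda>w. r * a w) (\<lambda>m. r * h m)"
proof -
  have "(\<lambda>w. r * (xi n h w - a w)) \<in> lie_ideal n c"
    using assms by (intro lie_ideal_scale) (auto simp: nfs_def)
  then show ?thesis using assms by (simp add: nfs_def spoly_scale xi_scale algebra_simps)
qed

lemma nfs_ideal: "a \<in> lie_ideal n c \<Longrightarrow> nfs a (\<lambda>m. 0)"
  using lie_ideal_scale[of a n c "-1"] by (simp add: nfs_def spoly_zero xi_zero)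

lemma nfs_zero: "nfs (\<lambda>w. 0) (\<lambda>m. 0)"
  by (intro nfs_ideal lie_ideal.zero)

lemma nfs_xi: "spoly n h \<Longrightarrow> nfs (xi n h) h"
  by (simp add: nfs_def lie_ideal.zero)

lemma nfs_sum:
  "finite T \<Longrightarrow> (\<And>t. t \<in> T \<Longrightarrow> nfs (a t) (h t)) \<Longrightarrow>
    nfs (\<lambda>w. \<Sum>t\<in>T. a t w) (\<lambda>m. \<Sum>t\<in>T. h t m)"
  by (induction T rule: finite_induct) (auto simp: nfs_zero nfs_add)

lemma nfs_unique:
  assumes "nfs a h" "nfs a g"
  shows "h = g"
proof -
  have "nfs (\<lambda>w. a w + (-1) * a w) (\<lambda>m. h m + (-1) * g m)"
    by (intro nfs_add nfs_scale assms)
  then have "nfs (\<lambda>w. 0) (\<lambda>m. h m - g m)" by simp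
  then have "(\<lambda>m. h m - g m) = (\<lambda>_. 0)" by (intro xi_injective) (simp_all add: nfs_def)
  then show ?thesis by (metis eq_iff_diff_eq_0 ext)
qed

section \<open>Poincare-Birkhoff-Witt: spanning by symmetrized monomials\<close>

definition reducible :: "(nat list \<Rightarrow> 'k) \<Rightarrow> bool" where
  "reducible a \<longleftrightarrow> (\<exists>h. nfs a h)"

lemma reducible_add: "reducible a \<Longrightarrow> reducible b \<Longrightarrow> reducible (\<lambda>w. a w + b w)"
  unfolding reducible_def using nfs_add by blast

lemma reducible_scale: "reducible a \<Longrightarrow> reducible (\<lambda>w. r * a w)"
  unfolding reducible_def using nfs_scale by blast

lemma reducible_sum: "finite T \<Longrightarrow> (\<And>t. t \<in> T \<Longrightarrow> reducible (a t)) \<Longrightarrow> reducible (\<lambda>w. \<Sum>t\<in>T. a t w)"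
  unfolding reducible_def using nfs_sum[of T a] by metis

lemma reducible_trans: "reducible (\<lambda>w. a w - b w) \<Longrightarrow> reducible (\<lambda>w. b w - d w) \<Longrightarrow> reducible (\<lambda>w. a w - d w)"
  using reducible_add[of "\<lambda>w. a w - b w" "\<lambda>w. b w - d w"] by simp

text \<open>Exchanging neighbours changes a word by an element of the ideal plus words that are one
  letter shorter. The premise \<open>lower\<close> is the induction hypothesis of
  \<open>reducible_word\<close>, handed through this lemma and the next two.\<close>

lemma reducible_swap:
  assumes lower: "\<And>w. over n w \<Longrightarrow> length w < k \<Longrightarrow> reducible (single w)"
    and "over n (u @ [i, j] @ v)" "length (u @ [i, j] @ v) = k"
  shows "reducible (\<lambda>w. single (u @ [i, j] @ v) w - single (u @ [j, i] @ v) w)"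
proof -
  have "reducible (\<lambda>w. \<Sum>l<n. c i j l * single (u @ [l] @ v) w)"
    using assms by (intro reducible_sum reducible_scale lower) auto
  moreover have "reducible (\<lambda>w. single (u @ [i, j] @ v) w - single (u @ [j, i] @ v) w
      - (\<Sum>k<n. c i j k * single (u @ [k] @ v) w))"
    unfolding reducible_def by (rule exI, rule nfs_ideal, rule lie_ideal_words) (use assms(2) in auto)
  ultimately have "reducible (\<lambda>w. (\<Sum>l<n. c i j l * single (u @ [l] @ v) w)
      + (single (u @ [i, j] @ v) w - single (u @ [j, i] @ v) w
      - (\<Sum>k<n. c i j k * single (u @ [k] @ v) w)))" by (rule reducible_add)
  moreover have "x + (y - z - x) = y - z" for x y z :: 'k by simp
  ultimately show ?thesis by (simp only:)
qed

lemma reducible_move: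
  assumes lower: "\<And>w. over n w \<Longrightarrow> length w < k \<Longrightarrow> reducible (single w)"
    and "over n (t @ x # p @ q)" "length (t @ x # p @ q) = k"
  shows "reducible (\<lambda>w. single (t @ x # p @ q) w - single (t @ p @ x # q) w)"
  using assms(2,3)
proof (induction p arbitrary: t)
  case Nil
  then show ?case using nfs_zero reducible_def by auto
next
  case (Cons y p)
  have "reducible (\<lambda>w. single (t @ [x, y] @ (p @ q)) w - single (t @ [y, x] @ (p @ q)) w)"
    by (rule reducible_swap[OF lower]) (use Cons.prems in auto)
  moreover have "reducible (\<lambda>w. single ((t @ [y]) @ x # p @ q) w - single ((t @ [y]) @ p @ x # q) w)"
    by (rule Cons.IH) (use Cons.prems in auto)
  ultimately show ?case
    using reducible_trans[of "single (t @ [x, y] @ (p @ q))" "single (t @ [y, x] @ (p @ q))"] by simp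
qed

lemma reducible_permute:
  assumes lower: "\<And>w. over n w \<Longrightarrow> length w < k \<Longrightarrow> reducible (single w)"
    and "mset xs = mset ys" "over n (t @ xs)" "length (t @ xs) = k"
  shows "reducible (\<lambda>w. single (t @ xs) w - single (t @ ys) w)"
  using assms(2-4)
proof (induction xs arbitrary: t ys)
  case Nil
  then show ?case using nfs_zero reducible_def by auto
next
  case (Cons x xs)
  have "x \<in> set ys" using Cons.prems(1) by (metis list.set_intros(1) mset_eq_setD)
  then obtain p q where ys: "ys = p @ x # q" by (metis split_list)
  then have m: "mset xs = mset (p @ q)" using Cons.prems(1) by simp
  have s: "set xs = set (p @ q)" "length xs = length (p @ q)" using mset_eq_setD[OF m] mset_eq_length[OF m] .
  have "reducible (\<lambda>w. single ((t @ [x]) @ xs) w - single ((t @ [x]) @ (p @ q)) w)"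
    by (rule Cons.IH[OF m]) (use Cons.prems in auto)
  moreover have "reducible (\<lambda>w. single (t @ x # p @ q) w - single (t @ p @ x # q) w)"
    by (rule reducible_move[OF lower]) (use Cons.prems s in auto)
  ultimately show ?case
    using reducible_trans[of "single (t @ x # xs)" "single (t @ x # p @ q)"] ys by simp
qed

lemma reducible_word: "over n w \<Longrightarrow> reducible (single w)"
proof (induction "length w" arbitrary: w rule: less_induct)
  case less
  define m where "m = cnt w"
  have m: "mi n m" using less.prems by (simp add: m_def mi_cnt)
  have w: "w \<in> words m" by (simp add: words_def m_def)
  \<comment> \<open>With this weight the sum of \<open>\<kappa> * single u\<close> over
    \<open>words m\<close> is \<open>xi n (mono m)\<close>, which has a preimage under xi from the
    start; w differs from it by a combination of differences of rearrangements of w.\<close>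
  define \<kappa> :: 'k where "\<kappa> = 1 / of_nat (card (words m))"
  have k: "of_nat (card (words m)) * \<kappa> = 1"
    unfolding \<kappa>_def using w finite_words[OF m] by auto
  have "reducible (\<lambda>v. \<kappa> * (single w v - single u v))" if "u \<in> words m" for u
  proof (rule reducible_scale)
    have "mset w = mset u" using that w by (simp add: words_letters[OF m] permutations_of_multiset_def)
    then show "reducible (\<lambda>v. single w v - single u v)"
      using reducible_permute[of "length w" w u "[]"] less by simp
  qed
  then have "reducible (\<lambda>v. \<Sum>u\<in>words m. \<kappa> * (single w v - single u v))"
    by (intro reducible_sum finite_words[OF m])
  moreover have "reducible (xi n (mono m))"
    unfolding reducible_def using nfs_xi[OF spoly_mono[OF m]] by blast
  ultimately have "reducible (\<lambda>v. (\<Sum>u\<in>words m. \<kappa> * (single w v - single u v)) + xi n (mono m) v)"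
    by (rule reducible_add)
  moreover have "(\<Sum>u\<in>words m. \<kappa> * (single w v - single u v)) + xi n (mono m) v = single w v" for v
  proof -
    have "(\<Sum>u\<in>words m. \<kappa> * single u v) = xi n (mono m) v"
      using finite_words[OF m] by (simp add: xi_mono[OF m] single_def sum.delta' \<kappa>_def if_distrib cong: if_cong)
    moreover have "(\<Sum>u\<in>words m. \<kappa> * single w v) = single w v"
      using k by (simp add: mult.assoc[symmetric])
    ultimately show ?thesis by (simp add: right_diff_distrib sum_subtractf)
  qed
  ultimately show ?case by simp
qed

section \<open>Normal forms and the dual basis\<close>

definition nf :: "(nat list \<Rightarrow> 'k) \<Rightarrow> (nat \<Rightarrow> nat) \<Rightarrow> 'k" where
  "nf a = (THE h. nfs a h)"

lemma nf_eq: "nfs a h \<Longrightarrow> nf a = h"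
  unfolding nf_def using nfs_unique by blast

lemma nfs_nf_word: "over n w \<Longrightarrow> nfs (single w) (nf (single w))"
  using reducible_word[of w] nf_eq unfolding reducible_def by blast

lemma nfs_nf:
  assumes "tpoly n a"
  shows "nfs a (\<lambda>K. fpair (\<lambda>w. nf (single w) K) a)"
proof -
  have "nfs (\<lambda>v. \<Sum>w | a w \<noteq> 0. a w * single w v) (\<lambda>K. \<Sum>w | a w \<noteq> 0. a w * nf (single w) K)"
    using assms by (intro nfs_sum nfs_scale nfs_nf_word) (auto simp: tpoly_def)
  moreover have "(\<Sum>w | a w \<noteq> 0. a w * single w v) = a v" for v
    using assms by (simp add: tpoly_def single_def sum.delta if_distrib cong: if_cong)
  ultimately show ?thesis by (simp add: fpair_def)
qed

lemma star_nf: "star n c f g = nf (fmul (xi n f) (xi n g))"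
  unfolding star_def nf_def nfs_def ..

text \<open>The basis dual to the divided powers xi(x^m) / m!, as \<open>avg_phi\<close> shows.
  Without the factorial the product rule \<open>phi_add\<close> would carry binomial
  coefficients.\<close>

definition phi :: "(nat \<Rightarrow> nat) \<Rightarrow> nat list \<Rightarrow> 'k" where
  "phi K w = mfact n K * nf (single w) K"

lemma nf_phi: "tpoly n a \<Longrightarrow> mfact n K * nf a K = fpair (phi K) a"
  unfolding nf_eq[OF nfs_nf] phi_def by (simp add: fpair_def sum_distrib_left mult.left_commute)

lemma annih_phi: "annih n c (phi K)"
  unfolding annih_def
proof (intro allI impI)
  fix u v i j assume a: "over n u" "over n v" "i < n" "j < n"
  let ?e = "\<lambda>w. single (u @ [i, j] @ v) w - single (u @ [j, i] @ v) w
    - (\<Sum>k<n. c i j k * single (u @ [k] @ v) w)"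
  have e: "?e \<in> lie_ideal n c" by (rule lie_ideal_words[OF a])
  have "fpair (phi K) ?e = 0"
    using nf_phi[OF lie_ideal_tpoly[OF e], of K] nf_eq[OF nfs_ideal[OF e]] by simp
  then show "phi K (u @ [i, j] @ v) = phi K (u @ [j, i] @ v) + (\<Sum>k<n. c i j k * phi K (u @ [k] @ v))"
    unfolding fpair_words by (simp add: algebra_simps)
qed

lemma avg_phi:
  assumes "mi n m"
  shows "avg n m (phi K) = (if m = K then 1 else 0)"
proof -
  have "mfact n m * avg n m (phi K) = fpair (phi K) (xi n (mono m))"
    by (simp add: fpair_xi spoly_mono assms fpair_mono)
  also have "\<dots> = mfact n K * mono m K"
    using nf_phi[OF tpoly_xi[OF spoly_mono[OF assms]], of K] nf_eq[OF nfs_xi[OF spoly_mono[OF assms]]] by simp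
  finally show ?thesis by (auto simp: mono_def)
qed

text \<open>Modulo the ideal every word is the image under xi of its normal form, so a functional
  that kills the ideal is fixed by its values on symmetrized monomials.\<close>

lemma annih_determined:
  assumes "annih n c F" "annih n c G" "\<And>m. mi n m \<Longrightarrow> avg n m F = avg n m G" "over n w"
  shows "F w = G w"
proof -
  let ?h = "nf (single w)"
  have h: "spoly n ?h" "(\<lambda>v. xi n ?h v - single w v) \<in> lie_ideal n c"
    using nfs_nf_word[OF assms(4)] by (auto simp: nfs_def)
  have "F w = fpair F (xi n ?h)" if "annih n c F" for F
    using annih_lie_ideal[OF that h(2)] tpoly_xi[OF h(1)]
    by (simp add: fpair_diff fin_supp_word fpair_word tpoly_def)
  moreover have "fpair F (xi n ?h) = fpair G (xi n ?h)"
    unfolding fpair_xi[OF h(1)] by (rule fpair_cong) (use assms(3) spolyD[OF h(1)] in simp)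
  ultimately show ?thesis using assms by simp
qed

end

section \<open>Unshuffling of words\<close>

lemma fpair_mult_left: "fpair (\<lambda>x. r * F x) p = r * fpair F p"
  by (simp add: fpair_def sum_distrib_left mult.left_commute)

text \<open>The sum of H over all splittings of a word into two complementary subwords, that is, H
  evaluated on the coproduct for which letters are primitive. Recursing through H, with no sets of
  positions, makes the laws below inductions on the word.\<close>

fun unshuffle :: "('a list \<Rightarrow> 'a list \<Rightarrow> 'k::comm_ring_1) \<Rightarrow> 'a list \<Rightarrow> 'k" where
  "unshuffle H [] = H [] []"
| "unshuffle H (x # w) = unshuffle (\<lambda>u v. H (x # u) v) w + unshuffle (\<lambda>u v. H u (x # v)) w"

lemma unshuffle_append: "unshuffle H (w @ w') = unshuffle (\<lambda>u v. unshuffle (\<lambda>u' v'. H (u @ u') (v @ v')) w') w"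
  by (induction w arbitrary: H) simp_all

lemma unshuffle_cong:
  assumes "\<And>u v. set u \<subseteq> set w \<Longrightarrow> set v \<subseteq> set w \<Longrightarrow> H u v = G u v"
  shows "unshuffle H w = unshuffle G w"
  using assms
proof (induction w arbitrary: H G)
  case (Cons x w)
  have "unshuffle (\<lambda>u v. H (x # u) v) w = unshuffle (\<lambda>u v. G (x # u) v) w"
    by (rule Cons.IH, rule Cons.prems) auto
  moreover have "unshuffle (\<lambda>u v. H u (x # v)) w = unshuffle (\<lambda>u v. G u (x # v)) w"
    by (rule Cons.IH, rule Cons.prems) auto
  ultimately show ?case by simp
qed simp

lemma unshuffle_add: "unshuffle (\<lambda>u v. H u v + G u v) w = unshuffle H w + unshuffle G w"
  by (induction w arbitrary: H G) (simp_all add: algebra_simps)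

lemma unshuffle_scale: "unshuffle (\<lambda>u v. r * H u v) w = r * unshuffle H w"
  by (induction w arbitrary: H) (simp_all add: algebra_simps)

lemma unshuffle_zero: "unshuffle (\<lambda>u v. 0) w = 0"
  by (induction w) simp_all

lemma unshuffle_sum: "unshuffle (\<lambda>u v. \<Sum>t\<in>T. H t u v) w = (\<Sum>t\<in>T. unshuffle (H t) w)"
  by (induction T rule: infinite_finite_induct) (simp_all add: unshuffle_zero unshuffle_add)

lemma unshuffle_swap:
  "unshuffle (\<lambda>x y. unshuffle (\<lambda>u v. K x y u v) w') w = unshuffle (\<lambda>u v. unshuffle (\<lambda>x y. K x y u v) w) w'"
  by (induction w arbitrary: K) (simp_all add: unshuffle_add)

text \<open>A splitting distributes all letters of w, so the joint content of its two parts is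
  always \<open>cnt w\<close>. In \<open>avg_unshuffle\<close> this moves a condition on the content
  under the sum.\<close>

lemma unshuffle_cnt:
  "unshuffle (\<lambda>u v. f (\<lambda>i. cnt u i + cnt v i) * H u v) w = f (cnt w) * unshuffle H w"
proof (induction w arbitrary: f H)
  case Nil
  then show ?case by (simp add: cnt_Nil[unfolded mset.simps])
next
  case (Cons x w)
  have 1: "(\<lambda>i. cnt (x # u) i + cnt v i) = inc x (\<lambda>i. cnt u i + cnt v i)"
    and 2: "(\<lambda>i. cnt u i + cnt (x # v) i) = inc x (\<lambda>i. cnt u i + cnt v i)" for u v
    by auto
  show ?case
    unfolding unshuffle.simps 1 2
    using Cons[of "\<lambda>m. f (inc x m)" "\<lambda>u v. H (x # u) v"] Cons[of "\<lambda>m. f (inc x m)" "\<lambda>u v. H u (x # v)"]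
    by (simp only: cnt_Cons distrib_left)
qed

definition words_of_length :: "nat \<Rightarrow> nat \<Rightarrow> nat list set" where
  "words_of_length n k = {w. over n w \<and> length w = k}"

lemma finite_words_of_length: "finite (words_of_length n k)"
  unfolding words_of_length_def by (rule finite_lists_length_eq) simp

lemma words_of_length_0: "words_of_length n 0 = {[]}"
  by (auto simp: words_of_length_def)

lemma sum_words_of_length_Suc: "(\<Sum>w\<in>words_of_length n (Suc k). F w) = (\<Sum>x<n. \<Sum>w\<in>words_of_length n k. F (x # w))"
proof -
  have "words_of_length n (Suc k) = (\<lambda>(x, w). x # w) ` ({..<n} \<times> words_of_length n k)"
    by (auto simp: words_of_length_def length_Suc_conv)
  moreover have "inj_on (\<lambda>(x, w). x # w) ({..<n} \<times> words_of_length n k)"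
    by (auto intro: inj_onI)
  ultimately show ?thesis
    by (simp add: sum.reindex sum.cartesian_product case_prod_unfold comp_def)
qed

text \<open>Over all words of length k, a pair of words of lengths j and k - j arises once for each
  choice of j positions. In the induction the first letter goes to u or to v, and the two sums
  combine by Pascal's rule.\<close>

lemma sum_unshuffle_words_of_length:
  "(\<Sum>w\<in>words_of_length n k. unshuffle H w)
    = (\<Sum>j\<le>k. of_nat (k choose j) * (\<Sum>u\<in>words_of_length n j. \<Sum>v\<in>words_of_length n (k - j). H u v))"
proof (induction k arbitrary: H)
  case 0
  show ?case by (simp add: words_of_length_0)
next
  case (Suc k)
  define T where "T i j = (\<Sum>u\<in>words_of_length n i. \<Sum>v\<in>words_of_length n j. H u v)" for i j
  have 1: "(\<Sum>x<n. \<Sum>j\<le>k. of_nat (k choose j) * (\<Sum>u\<in>words_of_length n j. \<Sum>v\<in>words_of_length n (k - j). H (x # u) v))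
      = (\<Sum>j\<le>k. of_nat (k choose j) * T (Suc j) (k - j))"
    unfolding T_def sum_words_of_length_Suc sum_distrib_left by (rule sum.swap)
  have 2: "(\<Sum>x<n. \<Sum>j\<le>k. of_nat (k choose j) * (\<Sum>u\<in>words_of_length n j. \<Sum>v\<in>words_of_length n (k - j). H u (x # v)))
      = (\<Sum>j\<le>k. of_nat (k choose j) * T j (Suc k - j))"
  proof -
    have "(\<Sum>x<n. \<Sum>u\<in>words_of_length n j. \<Sum>v\<in>words_of_length n (k - j). H u (x # v)) = T j (Suc k - j)" if "j \<le> k" for j
    proof -
      have "Suc k - j = Suc (k - j)" using that by simp
      then show ?thesis unfolding T_def by (simp only: sum_words_of_length_Suc) (rule sum.swap)
    qed
    then show ?thesis
      by (subst sum.swap) (simp add: sum_distrib_left[symmetric])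
  qed
  have "(\<Sum>w\<in>words_of_length n (Suc k). unshuffle H w)
      = (\<Sum>j\<le>k. of_nat (k choose j) * T (Suc j) (k - j)) + (\<Sum>j\<le>k. of_nat (k choose j) * T j (Suc k - j))"
    unfolding sum_words_of_length_Suc unshuffle.simps sum.distrib Suc 1 2 ..
  \<comment> \<open>The added term j = Suc k has binomial coefficient 0; it aligns the two sums for
    Pascal's rule.\<close>
  also have "(\<Sum>j\<le>k. of_nat (k choose j) * T j (Suc k - j))
      = (\<Sum>j\<le>Suc k. of_nat (k choose j) * T j (Suc k - j))"
    by (simp add: binomial_eq_0)
  also have "\<dots> = T 0 (Suc k) + (\<Sum>j\<le>k. of_nat (k choose Suc j) * T (Suc j) (k - j))"
    by (subst sum.atMost_Suc_shift) simp
  also have "(\<Sum>j\<le>k. of_nat (k choose j) * T (Suc j) (k - j)) + \<dots>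
      = (\<Sum>j\<le>Suc k. of_nat (Suc k choose j) * T j (Suc k - j))"
    by (subst sum.atMost_Suc_shift) (simp add: sum.distrib distrib_right)
  finally show ?case by (simp add: T_def)
qed

section \<open>Coproduct of symmetrized monomials\<close>

abbreviation down :: "(nat \<Rightarrow> nat) \<Rightarrow> (nat \<Rightarrow> nat) set" where
  "down m \<equiv> {a. \<forall>i. a i \<le> m i}"

abbreviation msub :: "(nat \<Rightarrow> nat) \<Rightarrow> (nat \<Rightarrow> nat) \<Rightarrow> nat \<Rightarrow> nat" where
  "msub m a \<equiv> (\<lambda>i. m i - a i)"

abbreviation madd :: "(nat \<Rightarrow> nat) \<Rightarrow> (nat \<Rightarrow> nat) \<Rightarrow> nat \<Rightarrow> nat" where
  "madd m a \<equiv> (\<lambda>i. m i + a i)"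

lemma mi_down: "mi n m \<Longrightarrow> a \<in> down m \<Longrightarrow> mi n a"
  unfolding mi_def by (metis (no_types, lifting) le_zero_eq mem_Collect_eq)

lemma mi_msub: "mi n m \<Longrightarrow> mi n (msub m a)"
  unfolding mi_def by simp

lemma mi_madd: "mi n (madd m a) \<longleftrightarrow> mi n m \<and> mi n a"
  unfolding mi_def by auto

lemma deg_madd: "deg n (madd m a) = deg n m + deg n a"
  unfolding deg_def by (simp add: sum.distrib)

lemma madd_msub: "a \<in> down m \<Longrightarrow> madd a (msub m a) = m"
  by auto

lemma finite_down: "mi n m \<Longrightarrow> finite (down m)"
proof (rule finite_subset[OF _ finite_Mon[of n "deg n m"]])
  assume m: "mi n m"
  show "down m \<subseteq> Mon n (deg n m)"
    using mi_down[OF m] by (auto simp: Mon_def deg_def intro: sum_mono)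
qed

text \<open>Splittings are counted over all words of length \<open>deg n m\<close>, where each pair
  occurs a binomial number of times, with the content m imposed by an indicator. The binomial
  coefficient then cancels against the factorials in \<open>avg\<close>. In terms of U(g) this is
  the coproduct of the divided power xi(x^m) / m!.\<close>

lemma avg_unshuffle:
  assumes m: "mi n m"
  shows "avg n m (unshuffle H) = (\<Sum>a\<in>down m. avg n a (\<lambda>u. avg n (msub m a) (\<lambda>v. H u v)))"
proof -
  let ?k = "deg n m"
  let ?G = "\<lambda>u v. of_nat (?k choose length u) * H u v"
  define P where "P = {(u, v). madd (cnt u) (cnt v) = m}"
  have Pover: "over n u \<and> over n v \<and> length u + length v = ?k" if "(u, v) \<in> P" for u v
  proof -
    have "mi n (cnt u)" "mi n (cnt v)" using that m unfolding P_def by (auto simp: mi_def)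
    then show ?thesis using that deg_cnt[of u n] deg_cnt[of v n] unfolding P_def
      by (auto simp: mi_cnt deg_madd)
  qed
  have "(\<Sum>w\<in>words m. unshuffle H w) = (\<Sum>w\<in>words_of_length n ?k. (if cnt w = m then 1 else 0) * unshuffle H w)"
  proof (rule sum.mono_neutral_cong_left)
    show "words m \<subseteq> words_of_length n ?k"
      using words_over[OF m] words_length[OF m] by (auto simp: words_of_length_def)
  qed (auto simp: finite_words_of_length words_def)
  also have "\<dots> = (\<Sum>w\<in>words_of_length n ?k. unshuffle (\<lambda>u v. (if madd (cnt u) (cnt v) = m then 1 else 0) * H u v) w)"
    unfolding unshuffle_cnt[of "\<lambda>x. if x = m then 1 else 0"] ..
  also have "\<dots> = (\<Sum>j\<le>?k. \<Sum>u\<in>words_of_length n j. \<Sum>v\<in>words_of_length n (?k - j).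
      of_nat (?k choose j) * ((if madd (cnt u) (cnt v) = m then 1 else 0) * H u v))"
    unfolding sum_unshuffle_words_of_length sum_distrib_left ..
  also have "\<dots> = (\<Sum>(j, u, v)\<in>(SIGMA j:{..?k}. words_of_length n j \<times> words_of_length n (?k - j)).
      of_nat (?k choose j) * ((if madd (cnt u) (cnt v) = m then 1 else 0) * H u v))"
    by (simp add: sum.Sigma finite_words_of_length sum.cartesian_product)
  also have "\<dots> = (\<Sum>(j, u, v)\<in>{z \<in> (SIGMA j:{..?k}. words_of_length n j \<times> words_of_length n (?k - j)). snd z \<in> P}.
      of_nat (?k choose j) * H u v)"
  proof (rule sum.mono_neutral_cong_right)
    show "finite (SIGMA j:{..?k}. words_of_length n j \<times> words_of_length n (?k - j))"
      by (intro finite_SigmaI finite_cartesian_product) (auto simp: finite_words_of_length)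
  qed (auto simp: P_def split: if_splits)
  also have "\<dots> = (\<Sum>(u, v)\<in>P. ?G u v)"
  proof (rule sum.reindex_bij_witness[where i = "\<lambda>(u, v). (length u, u, v)" and j = snd])
    fix p assume "p \<in> P"
    moreover obtain u v where p: "p = (u, v)" by (cases p)
    ultimately have "over n u" "over n v" "length u + length v = ?k" "(u, v) \<in> P" using Pover by auto
    then show "(case p of (u, v) \<Rightarrow> (length u, u, v)) \<in> {z \<in> (SIGMA j:{..?k}. words_of_length n j \<times> words_of_length n (?k - j)). snd z \<in> P}"
      by (auto simp: p words_of_length_def)
  qed (auto simp: words_of_length_def)
  also have "\<dots> = (\<Sum>(a, u, v)\<in>(SIGMA a:down m. words a \<times> words (msub m a)). ?G u v)"
  proof (rule sum.reindex_bij_witness[where i = snd and j = "\<lambda>(u, v). (cnt u, u, v)"])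
    fix p assume "p \<in> P"
    moreover obtain u v where p: "p = (u, v)" by (cases p)
    ultimately have "m = madd (cnt u) (cnt v)" by (simp add: P_def)
    then show "(case p of (u, v) \<Rightarrow> (cnt u, u, v)) \<in> (SIGMA a:down m. words a \<times> words (msub m a))"
      by (simp add: p words_def)
  next
    fix z assume "z \<in> (SIGMA a:down m. words a \<times> words (msub m a))"
    moreover obtain a u v where z: "z = (a, u, v)" by (cases z)
    ultimately have "a \<in> down m" "cnt u = a" "cnt v = msub m a" by (auto simp: words_def)
    then show "snd z \<in> P" by (simp add: z P_def madd_msub)
  qed (auto simp: words_def)
  also have "\<dots> = (\<Sum>a\<in>down m. \<Sum>u\<in>words a. \<Sum>v\<in>words (msub m a). ?G u v)"
    using finite_down[OF m] finite_words[OF mi_down[OF m]] finite_words[OF mi_msub[OF m]]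
    by (simp add: sum.Sigma sum.cartesian_product)
  finally have eq: "(\<Sum>w\<in>words m. unshuffle H w) = (\<Sum>a\<in>down m. \<Sum>u\<in>words a. \<Sum>v\<in>words (msub m a). ?G u v)" .
  have "avg n m (unshuffle H) = (\<Sum>a\<in>down m. (\<Sum>u\<in>words a. \<Sum>v\<in>words (msub m a). ?G u v) / fact ?k)"
    by (simp add: avg_def eq sum_divide_distrib)
  also have "\<dots> = (\<Sum>a\<in>down m. avg n a (\<lambda>u. avg n (msub m a) (\<lambda>v. H u v)))"
  proof (rule sum.cong[OF refl])
    fix a assume a: "a \<in> down m"
    have d: "deg n a + deg n (msub m a) = ?k"
      using deg_madd[of n a "msub m a"] madd_msub[OF a] by simp
    have "(of_nat (?k choose deg n a) :: 'a) = fact ?k / (fact (deg n a) * fact (deg n (msub m a)))"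
      using binomial_fact[of "deg n a" ?k] d by (metis add_diff_cancel_left' le_add1)
    moreover have "(\<Sum>u\<in>words a. \<Sum>v\<in>words (msub m a). ?G u v)
        = of_nat (?k choose deg n a) * (\<Sum>u\<in>words a. \<Sum>v\<in>words (msub m a). H u v)"
      using words_length[OF mi_down[OF m a]] by (simp add: sum_distrib_left)
    ultimately show "(\<Sum>u\<in>words a. \<Sum>v\<in>words (msub m a). ?G u v) / fact ?k
        = avg n a (\<lambda>u. avg n (msub m a) (\<lambda>v. H u v))"
      by (simp add: avg_def sum_divide_distrib[symmetric] del: of_nat_mult)
  qed
  finally show ?thesis .
qed

lemma avg_sum: "avg n m (\<lambda>w. \<Sum>t\<in>T. F t w) = (\<Sum>t\<in>T. avg n m (F t))"
proof -
  have "(\<Sum>w\<in>words m. \<Sum>t\<in>T. F t w) = (\<Sum>t\<in>T. \<Sum>w\<in>words m. F t w)" by (rule sum.swap)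
  then show ?thesis by (simp add: avg_def sum_divide_distrib)
qed

lemma avg_scale: "avg n m (\<lambda>w. r * F w) = r * avg n m F"
  by (simp add: avg_def sum_distrib_left[symmetric])

lemma avg_prod: "avg n a (\<lambda>u. avg n b (\<lambda>v. F u * G v)) = avg n a F * avg n b G"
  using avg_scale[of n a "avg n b G" F] by (simp add: avg_scale mult.commute)

lemma avg_unshuffle_swap: "avg n m (\<lambda>w. unshuffle (\<lambda>x y. K x y w) u) = unshuffle (\<lambda>x y. avg n m (K x y)) u"
proof -
  have "unshuffle (\<lambda>x y. (1 / fact (deg n m)) * (\<Sum>w\<in>words m. K x y w)) u = avg n m (\<lambda>w. unshuffle (\<lambda>x y. K x y w) u)"
    unfolding unshuffle_scale unshuffle_sum by (simp add: avg_def)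
  then show ?thesis by (simp add: avg_def)
qed

lemma avg_fpair: "avg n m (\<lambda>u. fpair (\<lambda>B. G B u) g) = fpair (\<lambda>B. avg n m (G B)) g"
  unfolding fpair_def avg_sum avg_scale ..

section \<open>Products of functionals and the coefficient series\<close>

context lie_alg
begin

text \<open>When i j - j i is split, the mixed terms i (x) j and j (x) i cancel. What remains is the
  relation in one factor with the other untouched, and this matches the splitting of the single
  letters k.\<close>

lemma annih_unshuffle:
  assumes F: "annih n c F" and G: "annih n c G"
  shows "annih n c (unshuffle (\<lambda>u v. F u * G v))"
  unfolding annih_def
proof (intro allI impI)
  fix u v i j assume u: "over n u" and v: "over n v" and ij: "i < n" "j < n"
  \<comment> \<open>The block y is split last, with the splittings of u and v held fixed, so the
    relation has to be checked only for blocks of one or two letters.\<close>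
  let ?T = "\<lambda>u1 u2 y v1 v2. unshuffle (\<lambda>x1 x2. F (u1 @ x1 @ v1) * G (u2 @ x2 @ v2)) y"
  have split: "unshuffle (\<lambda>u v. F u * G v) (u @ y @ v) = unshuffle (\<lambda>u1 u2. unshuffle (?T u1 u2 y) v) u" for y
    unfolding unshuffle_append by (subst (2) unshuffle_swap) simp
  have "unshuffle (\<lambda>u1 u2. unshuffle (?T u1 u2 [i, j]) v) u
      = unshuffle (\<lambda>u1 u2. unshuffle (\<lambda>v1 v2. ?T u1 u2 [j, i] v1 v2 + (\<Sum>k<n. c i j k * ?T u1 u2 [k] v1 v2)) v) u"
  proof (intro unshuffle_cong)
    fix u1 u2 v1 v2
    assume "set u1 \<subseteq> set u" "set u2 \<subseteq> set u" "set v1 \<subseteq> set v" "set v2 \<subseteq> set v"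
    then have o: "over n u1" "over n u2" "over n v1" "over n v2" using u v by auto
    have "(\<Sum>k<n. c i j k * ?T u1 u2 [k] v1 v2)
        = (\<Sum>k<n. c i j k * F (u1 @ [k] @ v1)) * G (u2 @ v2) + F (u1 @ v1) * (\<Sum>k<n. c i j k * G (u2 @ [k] @ v2))"
      by (simp add: sum_distrib_left sum_distrib_right sum.distrib distrib_left mult_ac)
    then show "?T u1 u2 [i, j] v1 v2 = ?T u1 u2 [j, i] v1 v2 + (\<Sum>k<n. c i j k * ?T u1 u2 [k] v1 v2)"
      using annihD[OF F o(1,3) ij] annihD[OF G o(2,4) ij] by (simp add: algebra_simps)
  qed
  then show "unshuffle (\<lambda>u v. F u * G v) (u @ [i, j] @ v) = unshuffle (\<lambda>u v. F u * G v) (u @ [j, i] @ v)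
      + (\<Sum>k<n. c i j k * unshuffle (\<lambda>u v. F u * G v) (u @ [k] @ v))"
    unfolding split unshuffle_add unshuffle_sum unshuffle_scale .
qed

lemma phi_add:
  assumes "mi n K" "mi n L" "over n w"
  shows "phi (madd K L) w = unshuffle (\<lambda>u v. phi K u * phi L v) w"
proof (rule annih_determined[OF annih_phi annih_unshuffle[OF annih_phi annih_phi] _ assms(3)])
  fix m assume m: "mi n m"
  have "avg n m (unshuffle (\<lambda>u v. phi K u * phi L v)) = (\<Sum>a\<in>down m. avg n a (phi K) * avg n (msub m a) (phi L))"
    unfolding avg_unshuffle[OF m] avg_prod ..
  also have "\<dots> = (\<Sum>a\<in>down m. if a = K then (if m = madd K L then 1 else 0) else 0)"
  proof (rule sum.cong[OF refl])
    fix a assume a: "a \<in> down m"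
    then have "msub m a = L \<longleftrightarrow> m = madd a L" using madd_msub[OF a] by auto
    then show "avg n a (phi K) * avg n (msub m a) (phi L)
        = (if a = K then (if m = madd K L then 1 else 0) else 0)"
      by (simp add: avg_phi mi_down[OF m a] mi_msub[OF m])
  qed
  also have "\<dots> = (if m = madd K L then 1 else 0)"
    using finite_down[OF m] by (auto simp: sum.delta)
  finally show "avg n m (phi (madd K L)) = avg n m (unshuffle (\<lambda>u v. phi K u * phi L v))"
    by (simp add: avg_phi m)
qed

text \<open>Reading off the empty word also vanishes on the relations, which have no constant term,
  and it takes the same values on symmetrized monomials. This is the counit, and it gives Z_0 = 1 in
  \<open>star_coeff_zero\<close>.\<close>

lemma phi_zero:
  assumes "over n w"
  shows "phi (\<lambda>_. 0) w = (if w = [] then 1 else 0)"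
proof (rule annih_determined[OF annih_phi _ _ assms])
  show "annih n c (\<lambda>w. if w = [] then 1 else 0)" by (simp add: annih_def)
  fix m assume m: "mi n m"
  have "[] \<in> words m \<longleftrightarrow> m = (\<lambda>_. 0)" unfolding words_def mem_Collect_eq cnt_Nil by auto
  then show "avg n m (phi (\<lambda>_. 0)) = avg n m (\<lambda>w. if w = [] then 1 else 0)"
    unfolding avg_phi[OF m] by (simp add: avg_def sum.delta finite_words[OF m] deg_def)
qed

definition star_coeff :: "(nat \<Rightarrow> nat) \<Rightarrow> (nat \<Rightarrow> nat) \<Rightarrow> (nat \<Rightarrow> nat) \<Rightarrow> 'k" where
  "star_coeff K A B = (if mi n A \<and> mi n B then avg n A (\<lambda>u. avg n B (\<lambda>v. phi K (u @ v))) else 0)"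

text \<open>Unshuffling a concatenation unshuffles its two blocks independently. So
  \<open>phi_add\<close>, followed by \<open>avg_unshuffle\<close> in each block, produces the
  Cauchy product in the two groups of variables with no factorials left over.\<close>

lemma star_coeff_madd:
  assumes K: "mi n K" and L: "mi n L"
  shows "star_coeff (madd K L) = ser_mul (star_coeff K) (star_coeff L)"
proof (intro ext)
  fix A B
  show "star_coeff (madd K L) A B = ser_mul (star_coeff K) (star_coeff L) A B"
  proof (cases "mi n A \<and> mi n B")
    case True
    then have A: "mi n A" and B: "mi n B" by auto
    let ?H = "\<lambda>u1 u2 v1 v2. phi K (u1 @ v1) * phi L (u2 @ v2)"
    have "star_coeff (madd K L) A B = avg n A (\<lambda>u. avg n B (\<lambda>v. unshuffle (\<lambda>u1 u2. unshuffle (?H u1 u2) v) u))"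
      unfolding star_coeff_def if_P[OF True] by (intro avg_cong A B) (simp add: phi_add K L unshuffle_append)
    also have "\<dots> = avg n A (unshuffle (\<lambda>u1 u2. \<Sum>b\<in>down B. avg n b (\<lambda>v1. avg n (msub B b) (\<lambda>v2. ?H u1 u2 v1 v2))))"
      unfolding avg_unshuffle_swap avg_unshuffle[OF B] ..
    also have "\<dots> = (\<Sum>a\<in>down A. avg n a (\<lambda>u1. avg n (msub A a) (\<lambda>u2.
        \<Sum>b\<in>down B. avg n b (\<lambda>v1. phi K (u1 @ v1)) * avg n (msub B b) (\<lambda>v2. phi L (u2 @ v2)))))"
      unfolding avg_unshuffle[OF A] avg_prod ..
    also have "\<dots> = (\<Sum>a\<in>down A. \<Sum>b\<in>down B. avg n a (\<lambda>u1. avg n b (\<lambda>v1. phi K (u1 @ v1)))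
        * avg n (msub A a) (\<lambda>u2. avg n (msub B b) (\<lambda>v2. phi L (u2 @ v2))))"
      unfolding avg_sum avg_prod ..
    also have "\<dots> = (\<Sum>a\<in>down A. \<Sum>b\<in>down B. star_coeff K a b * star_coeff L (msub A a) (msub B b))"
      by (intro sum.cong refl) (simp add: star_coeff_def mi_down[OF A] mi_down[OF B] mi_msub[OF A] mi_msub[OF B])
    finally show ?thesis by (simp add: ser_mul_def sum.cartesian_product)
  next
    case False
    have "star_coeff K a b * star_coeff L (msub A a) (msub B b) = 0" if "a \<in> down A" "b \<in> down B" for a b
    proof -
      have "\<not> (mi n a \<and> mi n (msub A a) \<and> mi n b \<and> mi n (msub B b))"
        using False mi_madd[of n a "msub A a"] mi_madd[of n b "msub B b"] madd_msub[OF that(1)] madd_msub[OF that(2)]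
        by auto
      then show ?thesis by (auto simp: star_coeff_def)
    qed
    then show ?thesis using False by (auto simp: star_coeff_def ser_mul_def intro!: sum.neutral)
  qed
qed

lemma star_coeff_zero: "star_coeff (\<lambda>_. 0) = ser_one"
proof (intro ext)
  fix A B
  let ?\<epsilon> = "\<lambda>w. if w = [] then 1 else (0::'k)"
  have e: "avg n m ?\<epsilon> = (if m = (\<lambda>_. 0) then 1 else 0)" if "mi n m" for m
    using avg_phi[OF that, of "\<lambda>_. 0"] avg_cong[OF that phi_zero] by simp
  have "star_coeff (\<lambda>_. 0) A B = avg n A (\<lambda>u. avg n B (\<lambda>v. ?\<epsilon> u * ?\<epsilon> v))" if "mi n A" "mi n B"
    unfolding star_coeff_def if_P[OF conjI[OF that]] by (intro avg_cong that) (simp add: phi_zero)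
  moreover have "mi n (\<lambda>_. 0)" by (simp add: mi_def)
  ultimately show "star_coeff (\<lambda>_. 0) A B = ser_one A B"
    by (auto simp: avg_prod e ser_one_def star_coeff_def)
qed

lemma star_fpair:
  assumes f: "spoly n f" and g: "spoly n g"
  shows "mfact n K * star n c f g K = fpair (\<lambda>A. fpair (\<lambda>B. mfact n A * mfact n B * star_coeff K A B) g) f"
proof -
  have tp: "tpoly n (xi n f)" "tpoly n (xi n g)" using tpoly_xi f g by blast+
  have "mfact n K * star n c f g K = fpair (\<lambda>u. fpair (\<lambda>v. phi K (u @ v)) (xi n g)) (xi n f)"
    unfolding star_nf nf_phi[OF tpoly_fmul[OF tp]] using tp by (simp add: fpair_fmul tpoly_def)
  also have "\<dots> = fpair (\<lambda>A. mfact n A * fpair (\<lambda>B. mfact n B * avg n A (\<lambda>u. avg n B (\<lambda>v. phi K (u @ v)))) g) f"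
    unfolding fpair_xi[OF f] fpair_xi[OF g] avg_fpair avg_scale ..
  also have "\<dots> = fpair (\<lambda>A. fpair (\<lambda>B. mfact n A * mfact n B * star_coeff K A B) g) f"
    unfolding fpair_mult_left[symmetric]
  proof (intro fpair_cong)
    fix A B assume "f A \<noteq> 0" "g B \<noteq> 0"
    then show "mfact n A * (mfact n B * avg n A (\<lambda>u. avg n B (\<lambda>v. phi K (u @ v))))
        = mfact n A * mfact n B * star_coeff K A B"
      using spolyD[OF f] spolyD[OF g] by (simp add: star_coeff_def)
  qed
  finally show ?thesis .
qed

lemma spoly_star:
  assumes "spoly n f" "spoly n g"
  shows "spoly n (star n c f g)"
proof -
  have "nfs (fmul (xi n f) (xi n g)) (nf (fmul (xi n f) (xi n g)))"
    using nfs_nf[OF tpoly_fmul[OF tpoly_xi tpoly_xi, OF assms]] nf_eq by metis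
  then show ?thesis by (simp add: star_nf nfs_def)
qed

end

section \<open>Formal power series\<close>

text \<open>A type cannot depend on n, so the ring of series is built for all finitely supported
  exponents at once. Finite support keeps \<open>down\<close> finite; for other exponents the sum in
  \<open>ser_mul\<close> runs over an infinite set and defaults to 0, which would break the unit
  law.\<close>

definition fin_mi :: "(nat \<Rightarrow> nat) \<Rightarrow> bool" where
  "fin_mi I \<longleftrightarrow> (\<exists>n. mi n I)"

lemma mi_fin_mi: "mi n I \<Longrightarrow> fin_mi I"
  by (auto simp: fin_mi_def)

lemma fin_mi_zero: "fin_mi (\<lambda>_. 0)"
  by (auto simp: fin_mi_def mi_def)

lemma fin_mi_madd: "fin_mi (madd I J) \<longleftrightarrow> fin_mi I \<and> fin_mi J"
proof
  assume "fin_mi I \<and> fin_mi J"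
  then obtain a b where "mi a I" "mi b J" by (auto simp: fin_mi_def)
  then have "mi (max a b) (madd I J)" by (auto simp: mi_def)
  then show "fin_mi (madd I J)" by (rule mi_fin_mi)
qed (auto simp: fin_mi_def mi_madd)

lemma fin_mi_down: "fin_mi I \<Longrightarrow> a \<in> down I \<Longrightarrow> fin_mi a \<and> fin_mi (msub I a)"
  using fin_mi_madd[of a "msub I a"] madd_msub[of a I] by simp

lemma finite_down_fin_mi: "fin_mi I \<Longrightarrow> finite (down I)"
  using finite_down by (auto simp: fin_mi_def)

definition ser_carrier :: "((nat \<Rightarrow> nat) \<Rightarrow> (nat \<Rightarrow> nat) \<Rightarrow> 'k::zero) set" where
  "ser_carrier = {C. \<forall>I J. \<not> (fin_mi I \<and> fin_mi J) \<longrightarrow> C I J = 0}"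

lemma ser_carrierI: "(\<And>I J. \<not> (fin_mi I \<and> fin_mi J) \<Longrightarrow> C I J = 0) \<Longrightarrow> C \<in> ser_carrier"
  by (simp add: ser_carrier_def)

lemma ser_carrierD: "C \<in> ser_carrier \<Longrightarrow> \<not> (fin_mi I \<and> fin_mi J) \<Longrightarrow> C I J = 0"
  by (simp add: ser_carrier_def)

lemma ser_ext:
  assumes "C \<in> ser_carrier" "D \<in> ser_carrier" "\<And>I J. fin_mi I \<Longrightarrow> fin_mi J \<Longrightarrow> C I J = D I J"
  shows "C = D"
proof (intro ext)
  fix I J
  show "C I J = D I J"
    using assms ser_carrierD[of C I J] ser_carrierD[of D I J] by (cases "fin_mi I \<and> fin_mi J") auto
qed

lemma ser_mul_carrier:
  assumes "C \<in> ser_carrier" "D \<in> ser_carrier"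
  shows "ser_mul C D \<in> ser_carrier"
proof (rule ser_carrierI)
  fix I J assume IJ: "\<not> (fin_mi I \<and> fin_mi J)"
  have "C a b * D (msub I a) (msub J b) = 0" if "a \<in> down I" "b \<in> down J" for a b
  proof -
    have "\<not> (fin_mi a \<and> fin_mi b) \<or> \<not> (fin_mi (msub I a) \<and> fin_mi (msub J b))"
      using IJ fin_mi_madd[of a "msub I a"] fin_mi_madd[of b "msub J b"] madd_msub[OF that(1)] madd_msub[OF that(2)]
      by auto
    then have "C a b = 0 \<or> D (msub I a) (msub J b) = 0"
      using ser_carrierD[OF assms(1), of a b] ser_carrierD[OF assms(2), of "msub I a" "msub J b"] by argo
    then show ?thesis by (elim disjE) simp_all
  qed
  then show "ser_mul C D I J = 0" by (auto simp: ser_mul_def intro!: sum.neutral)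
qed

lemma ser_one_carrier: "ser_one \<in> ser_carrier"
  by (rule ser_carrierI) (auto simp: ser_one_def fin_mi_zero)

lemma msub_msub: "a \<in> down I \<Longrightarrow> msub I (msub I a) = a"
  by (rule ext) simp

lemma ser_mul_commute: "ser_mul C D = ser_mul D (C :: _ \<Rightarrow> _ \<Rightarrow> 'k::comm_ring_1)"
proof (intro ext)
  fix I J
  show "ser_mul C D I J = ser_mul D C I J"
    unfolding ser_mul_def
    by (rule sum.reindex_bij_witness[where i = "\<lambda>(a, b). (msub I a, msub J b)" and j = "\<lambda>(a, b). (msub I a, msub J b)"])
      (auto simp: msub_msub mult.commute)
qed

lemma ser_mul_assoc:
  assumes "fin_mi I" "fin_mi J"
  shows "ser_mul (ser_mul C D) E I J = ser_mul C (ser_mul D (E :: _ \<Rightarrow> _ \<Rightarrow> 'k::comm_ring_1)) I J"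
proof -
  let ?P = "down I \<times> down J"
  let ?j = "\<lambda>z. (snd z, (msub (fst (fst z)) (fst (snd z)), msub (snd (fst z)) (snd (snd z))))"
  let ?i = "\<lambda>z. ((madd (fst (fst z)) (fst (snd z)), madd (snd (fst z)) (snd (snd z))), fst z)"
  have fin: "finite ?P" using assms by (simp add: finite_down_fin_mi)
  have fin1: "finite (down (fst p) \<times> down (snd p))" if "p \<in> ?P" for p
    using assms fin_mi_down that by (auto intro!: finite_down_fin_mi)
  have fin2: "finite (down (msub I (fst p)) \<times> down (msub J (snd p)))" if "p \<in> ?P" for p
    using assms fin_mi_down that by (auto intro!: finite_down_fin_mi)
  have "ser_mul (ser_mul C D) E I J
      = (\<Sum>p\<in>?P. \<Sum>q\<in>down (fst p) \<times> down (snd p).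
          C (fst q) (snd q) * D (msub (fst p) (fst q)) (msub (snd p) (snd q)) * E (msub I (fst p)) (msub J (snd p)))"
    by (simp add: ser_mul_def case_prod_unfold sum_distrib_right)
  also have "\<dots> = (\<Sum>(p, q)\<in>(SIGMA p:?P. down (fst p) \<times> down (snd p)).
          C (fst q) (snd q) * D (msub (fst p) (fst q)) (msub (snd p) (snd q)) * E (msub I (fst p)) (msub J (snd p)))"
    using fin fin1 by (intro sum.Sigma) auto
  also have "\<dots> = (\<Sum>(p, q)\<in>(SIGMA p:?P. down (msub I (fst p)) \<times> down (msub J (snd p))).
          C (fst p) (snd p) * (D (fst q) (snd q) * E (msub (msub I (fst p)) (fst q)) (msub (msub J (snd p)) (snd q))))"
  proof (rule sum.reindex_bij_witness[where i = ?i and j = ?j])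
    fix z assume z: "z \<in> (SIGMA p:?P. down (fst p) \<times> down (snd p))"
    obtain a b a' b' where e: "z = ((a, b), (a', b'))" by (metis surj_pair)
    have le: "a' i \<le> a i" "a i \<le> I i" "b' i \<le> b i" "b i \<le> J i" for i using z by (auto simp: e)
    show "?i (?j z) = z"
      using le by (simp add: e)
    show "?j z \<in> (SIGMA p:?P. down (msub I (fst p)) \<times> down (msub J (snd p)))"
      using le order_trans[OF le(1,2)] order_trans[OF le(3,4)] by (simp add: e diff_le_mono)
    have "msub (msub I a') (msub a a') = msub I a" "msub (msub J b') (msub b b') = msub J b"
      using le by (auto simp: fun_eq_iff)
    then show "(case ?j z of (p, q) \<Rightarrow>
          C (fst p) (snd p) * (D (fst q) (snd q) * E (msub (msub I (fst p)) (fst q)) (msub (msub J (snd p)) (snd q))))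
        = (case z of (p, q) \<Rightarrow> C (fst q) (snd q) * D (msub (fst p) (fst q)) (msub (snd p) (snd q))
          * E (msub I (fst p)) (msub J (snd p)))"
      by (simp add: e mult.assoc)
  next
    fix z assume z: "z \<in> (SIGMA p:?P. down (msub I (fst p)) \<times> down (msub J (snd p)))"
    obtain a b a' b' where e: "z = ((a, b), (a', b'))" by (metis surj_pair)
    have le: "a' i \<le> I i - a i" "a i \<le> I i" "b' i \<le> J i - b i" "b i \<le> J i" for i using z by (auto simp: e)
    have le': "a i + a' i \<le> I i" "b i + b' i \<le> J i" for i using le[of i] by linarith+
    show "?j (?i z) = z"
      by (simp add: e)
    show "?i z \<in> (SIGMA p:?P. down (fst p) \<times> down (snd p))"
      using le' by (simp add: e)
  qed
  also have "\<dots> = (\<Sum>p\<in>?P. \<Sum>q\<in>down (msub I (fst p)) \<times> down (msub J (snd p)).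
          C (fst p) (snd p) * (D (fst q) (snd q) * E (msub (msub I (fst p)) (fst q)) (msub (msub J (snd p)) (snd q))))"
    using fin fin2 by (intro sum.Sigma[symmetric]) auto
  also have "\<dots> = ser_mul C (ser_mul D E) I J"
    by (simp add: ser_mul_def case_prod_unfold sum_distrib_left)
  finally show ?thesis .
qed

lemma ser_mul_one:
  assumes "fin_mi I" "fin_mi J"
  shows "ser_mul ser_one C I J = C I J"
proof -
  have "ser_mul ser_one C I J
      = (\<Sum>p\<in>down I \<times> down J. if p = (\<lambda>_. 0, \<lambda>_. 0) then C I J else 0)"
    unfolding ser_mul_def by (rule sum.cong) (auto simp: ser_one_def split: if_splits)
  then show ?thesis using assms by (simp add: finite_down_fin_mi sum.delta')
qed

lemma ser_mul_add_left: "ser_mul (\<lambda>I J. C I J + D I J) E I J = ser_mul C E I J + ser_mul D E I J"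
  by (simp add: ser_mul_def case_prod_unfold distrib_right sum.distrib)

text \<open>A type in the class \<open>comm_ring_1\<close> gives access to finite products and to
  \<open>binomial_ring\<close>, on which the final expansion rests.\<close>

typedef (overloaded) 'k mser = "ser_carrier :: ((nat \<Rightarrow> nat) \<Rightarrow> (nat \<Rightarrow> nat) \<Rightarrow> 'k::zero) set"
  by (rule exI[of _ "\<lambda>_ _. 0"]) (simp add: ser_carrier_def)

lemma mser_ext:
  assumes "\<And>I J. fin_mi I \<Longrightarrow> fin_mi J \<Longrightarrow> Rep_mser x I J = Rep_mser y I J"
  shows "x = y"
  using ser_ext[OF Rep_mser Rep_mser assms] by (simp add: Rep_mser_inject)

instantiation mser :: (comm_ring_1) comm_ring_1
begin

definition "0 = Abs_mser (\<lambda>I J. 0)"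
definition "1 = Abs_mser ser_one"
definition "x + y = Abs_mser (\<lambda>I J. Rep_mser x I J + Rep_mser y I J)"
definition "x - y = Abs_mser (\<lambda>I J. Rep_mser x I J - Rep_mser y I J)"
definition "- x = Abs_mser (\<lambda>I J. - Rep_mser x I J)"
definition "x * y = Abs_mser (ser_mul (Rep_mser x) (Rep_mser y))"

lemma Rep_mser_0: "Rep_mser 0 = (\<lambda>I J. 0)"
  unfolding zero_mser_def by (rule Abs_mser_inverse) (simp add: ser_carrier_def)

lemma Rep_mser_1: "Rep_mser 1 = ser_one"
  unfolding one_mser_def by (rule Abs_mser_inverse) (rule ser_one_carrier)

lemma Rep_mser_add: "Rep_mser (x + y) = (\<lambda>I J. Rep_mser x I J + Rep_mser y I J)"
  unfolding plus_mser_def by (rule Abs_mser_inverse) (simp add: ser_carrier_def ser_carrierD[OF Rep_mser])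

lemma Rep_mser_diff: "Rep_mser (x - y) = (\<lambda>I J. Rep_mser x I J - Rep_mser y I J)"
  unfolding minus_mser_def by (rule Abs_mser_inverse) (simp add: ser_carrier_def ser_carrierD[OF Rep_mser])

lemma Rep_mser_uminus: "Rep_mser (- x) = (\<lambda>I J. - Rep_mser x I J)"
  unfolding uminus_mser_def by (rule Abs_mser_inverse) (simp add: ser_carrier_def ser_carrierD[OF Rep_mser])

lemma Rep_mser_mult: "Rep_mser (x * y) = ser_mul (Rep_mser x) (Rep_mser y)"
  unfolding times_mser_def by (rule Abs_mser_inverse) (intro ser_mul_carrier Rep_mser)

instance
proof
  fix x y z :: "'a mser"
  show "x * y * z = x * (y * z)"
    by (rule mser_ext) (simp add: Rep_mser_mult ser_mul_assoc)
  show "x * y = y * x"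
    by (rule mser_ext) (simp add: Rep_mser_mult ser_mul_commute[of "Rep_mser x"])
  show "1 * x = x"
    by (rule mser_ext) (simp add: Rep_mser_mult Rep_mser_1 ser_mul_one)
  show "(x + y) * z = x * z + y * z"
    by (rule mser_ext) (simp add: Rep_mser_mult Rep_mser_add ser_mul_add_left)
  show "x + y + z = x + (y + z)" "x + y = y + x" "0 + x = x" "- x + x = 0" "x - y = x + - y"
    by (rule mser_ext; simp add: Rep_mser_add Rep_mser_0 Rep_mser_uminus Rep_mser_diff)+
  have "Rep_mser (0 :: 'a mser) (\<lambda>_. 0) (\<lambda>_. 0) \<noteq> Rep_mser 1 (\<lambda>_. 0) (\<lambda>_. 0)"
    by (simp add: Rep_mser_0 Rep_mser_1 ser_one_def)
  then show "(0 :: 'a mser) \<noteq> 1" by auto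
qed

end

lemma Rep_mser_of_nat_mult: "Rep_mser (of_nat k * x) I J = of_nat k * Rep_mser x I J"
  by (induction k) (simp_all add: Rep_mser_0 Rep_mser_add distrib_right)

lemma Rep_mser_sum: "Rep_mser (\<Sum>t\<in>T. x t) I J = (\<Sum>t\<in>T. Rep_mser (x t) I J)"
  by (induction T rule: infinite_finite_induct) (simp_all add: Rep_mser_0 Rep_mser_add)

lemma Rep_mser_power: "Rep_mser (x ^ k) = ser_pow (Rep_mser x) k"
  unfolding ser_pow_def by (induction k) (simp_all add: Rep_mser_1 Rep_mser_mult)

lemma Rep_mser_prod:
  "Rep_mser (\<Prod>l<n. x l ^ i l) = foldr (\<lambda>l D. ser_mul (ser_pow (Rep_mser (x l)) (i l)) D) [0..<n] ser_one"
proof -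
  have "Rep_mser (\<Prod>l\<leftarrow>ls. x l ^ i l) = foldr (\<lambda>l D. ser_mul (ser_pow (Rep_mser (x l)) (i l)) D) ls ser_one" for ls
    by (induction ls) (simp_all add: Rep_mser_1 Rep_mser_mult Rep_mser_power)
  moreover have "(\<Prod>l<n. x l ^ i l) = (\<Prod>l\<leftarrow>[0..<n]. x l ^ i l)"
    using prod.distinct_set_conv_list[of "[0..<n]" "\<lambda>l. x l ^ i l"] by (simp add: atLeast0LessThan)
  ultimately show ?thesis by simp
qed

section \<open>Powers with exponent vectors\<close>

definition monpow :: "nat \<Rightarrow> (nat \<Rightarrow> 'r) \<Rightarrow> (nat \<Rightarrow> nat) \<Rightarrow> 'r::comm_ring_1" where
  "monpow n x M = (\<Prod>l<n. x l ^ M l)"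

lemma monpow_madd: "monpow n x (madd A B) = monpow n x A * monpow n x B"
  by (simp add: monpow_def power_add prod.distrib)

lemma monpow_unitv: "l < n \<Longrightarrow> monpow n x (unitv l) = x l"
proof -
  assume "l < n"
  have "monpow n x (unitv l) = (\<Prod>k<n. if k = l then x k else 1)"
    unfolding monpow_def unitv_def by (rule prod.cong) auto
  then show ?thesis using \<open>l < n\<close> by simp
qed

lemma monpow_zero: "monpow n x (\<lambda>_. 0) = 1"
  by (simp add: monpow_def)

lemma monpow_binomial:
  fixes x y :: "nat \<Rightarrow> 'r::comm_ring_1"
  assumes M: "mi n M"
  shows "monpow n (\<lambda>l. x l + y l) M
    = (\<Sum>i\<in>down M. of_nat (\<Prod>l<n. M l choose i l) * (monpow n x i * monpow n y (msub M i)))"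
proof -
  have "monpow n (\<lambda>l. x l + y l) M = (\<Prod>l<n. \<Sum>k\<le>M l. of_nat (M l choose k) * x l ^ k * y l ^ (M l - k))"
    by (simp add: monpow_def binomial_ring)
  also have "\<dots> = (\<Sum>i\<in>PiE {..<n} (\<lambda>l. {..M l}). \<Prod>l<n. of_nat (M l choose i l) * x l ^ i l * y l ^ (M l - i l))"
    by (rule prod_sum_PiE) auto
  also have "\<dots> = (\<Sum>i\<in>down M. \<Prod>l<n. of_nat (M l choose i l) * x l ^ i l * y l ^ (M l - i l))"
  proof (rule sum.reindex_bij_witness[where i = "\<lambda>i. restrict i {..<n}" and j = "\<lambda>i l. if l < n then i l else 0"])
    fix i assume i: "i \<in> PiE {..<n} (\<lambda>l. {..M l})"
    show "restrict (\<lambda>l. if l < n then i l else 0) {..<n} = i"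
      using i by (auto simp: restrict_def PiE_def extensional_def)
    show "(\<lambda>l. if l < n then i l else 0) \<in> down M"
      using i by (auto simp: PiE_def Pi_def)
  next
    fix i assume i: "i \<in> down M"
    then have "mi n i" using mi_down[OF M] by simp
    then show "(\<lambda>l. if l < n then restrict i {..<n} l else 0) = i"
      by (auto simp: mi_def)
    show "restrict i {..<n} \<in> PiE {..<n} (\<lambda>l. {..M l})" using i by auto
  qed auto
  finally show ?thesis
    by (simp add: monpow_def prod.distrib mult.assoc)
qed

lemma mi_induct [consumes 1, case_names zero step]:
  assumes "mi n M" "P (\<lambda>_. 0)"
    and "\<And>l M. l < n \<Longrightarrow> mi n M \<Longrightarrow> P M \<Longrightarrow> P (madd (unitv l) M)"
  shows "P M"
  using assms(1)
proof (induction "deg n M" arbitrary: M rule: less_induct)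
  case less
  show ?case
  proof (cases "M = (\<lambda>_. 0)")
    case False
    then obtain l where "M l \<noteq> 0" by auto
    from least_letter[OF less.prems this] obtain j N where N: "j < n" "M = inc j N" "mi n N" by metis
    have "M = madd (unitv j) N" by (auto simp: N unitv_def)
    moreover have "deg n N < deg n M" unfolding N(2) by (simp only: deg_inc[OF N(1)])
    ultimately show ?thesis using assms(3)[OF N(1,3)] less.hyps[OF _ N(3)] by simp
  qed (use assms(2) in simp)
qed

section \<open>Action of power series\<close>

lemma mfact_madd_unitv: "l < n \<Longrightarrow> mfact n (madd (unitv l) M) = of_nat (Suc (M l)) * mfact n M"
proof -
  assume l: "l < n"
  have "(mfact n (madd (unitv l) M) :: 'a) = fact (Suc (M l)) * (\<Prod>i\<in>{..<n} - {l}. fact (M i))"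
    unfolding mfact_def using l by (subst prod.remove[of _ l]) (auto simp: unitv_def intro!: prod.cong)
  moreover have "(mfact n M :: 'a) = fact (M l) * (\<Prod>i\<in>{..<n} - {l}. fact (M i))"
    unfolding mfact_def using l by (subst prod.remove[of _ l]) auto
  ultimately show ?thesis by (simp add: mult.assoc)
qed

lemma pder_power:
  "(pder \<alpha> ^^ k) p M = fact (M \<alpha> + k) / fact (M \<alpha>) * (p (M(\<alpha> := M \<alpha> + k)) :: 'k::field_char_0)"
proof (induction k arbitrary: M)
  case (Suc k)
  have f: "of_nat (Suc m) / fact (Suc m) = (1 / fact m :: 'k)" for m
    by (simp add: fact_Suc del: of_nat_Suc)
  have "(pder \<alpha> ^^ Suc k) p M = of_nat (Suc (M \<alpha>)) * (pder \<alpha> ^^ k) p (inc \<alpha> M)"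
    by (simp add: pder_def)
  also have "\<dots> = of_nat (Suc (M \<alpha>)) / fact (Suc (M \<alpha>)) * fact (Suc (M \<alpha>) + k) * p (M(\<alpha> := Suc (M \<alpha>) + k))"
    unfolding Suc by simp
  finally show ?case by (simp only: f add_Suc_shift times_divide_eq_left mult_1_left)
qed simp

lemma pderI_eq:
  assumes "mi n I"
  shows "pderI n I p M = mfact n (madd M I) / mfact n M * (p (madd M I) :: 'k::field_char_0)"
proof -
  have *: "foldr (\<lambda>\<alpha> h. (pder \<alpha> ^^ I \<alpha>) \<circ> h) xs id p M
      = (\<Prod>i\<in>set xs. fact (M i + I i) / fact (M i)) * p (\<lambda>i. M i + (if i \<in> set xs then I i else 0))"
    if "distinct xs" for xs M
    using that
  proof (induction xs arbitrary: M)
    case (Cons x xs)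
    let ?M = "M(x := M x + I x)"
    have "(\<Prod>i\<in>set xs. fact (?M i + I i) / fact (?M i)) = (\<Prod>i\<in>set xs. fact (M i + I i) / fact (M i) :: 'k)"
      by (rule prod.cong) (use Cons.prems in auto)
    moreover have "(\<lambda>i. ?M i + (if i \<in> set xs then I i else 0))
        = (\<lambda>i. M i + (if i \<in> set (x # xs) then I i else 0))"
      using Cons.prems by auto
    ultimately show ?case
      using Cons.prems Cons.IH[of ?M] by (simp add: pder_power del: fun_upd_apply)
  qed simp
  have "(\<lambda>i. M i + (if i \<in> set [0..<n] then I i else 0)) = madd M I"
    using assms by (auto simp: mi_def)
  then show ?thesis
    using *[of "[0..<n]" M] by (simp add: pderI_def mfact_def prod_dividef atLeast0LessThan)
qed

lemma spoly_pderI: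
  assumes "mi n I" "spoly n (f :: _ \<Rightarrow> 'k::field_char_0)"
  shows "spoly n (pderI n I f)"
proof -
  have sub: "{M. pderI n I f M \<noteq> 0} \<subseteq> (\<lambda>K. msub K I) ` {K. f K \<noteq> 0}"
  proof
    fix M assume "M \<in> {M. pderI n I f M \<noteq> 0}"
    then have "f (madd M I) \<noteq> 0" by (simp add: pderI_eq[OF assms(1)])
    then show "M \<in> (\<lambda>K. msub K I) ` {K. f K \<noteq> 0}"
      by (intro image_eqI[of _ _ "madd M I"]) simp_all
  qed
  have "fin_supp (pderI n I f)" by (rule finite_subset[OF sub]) (use assms spoly_fin in auto)
  moreover have "mi n M" if "pderI n I f M \<noteq> 0" for M
  proof -
    have "M \<in> (\<lambda>K. msub K I) ` {K. f K \<noteq> 0}" using that sub by blast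
    then show ?thesis using spolyD[OF assms(2)] mi_msub by auto
  qed
  ultimately show ?thesis by (simp add: spoly_def)
qed

lemma dd_eq:
  assumes "mi n I" "mi n J"
  shows "mfact n A * mfact n B * dd n I J T A B
    = mfact n (madd A I) * mfact n (madd B J) * (T (madd A I) (madd B J) :: 'k::field_char_0)"
  by (simp add: dd_def pderI_eq assms)

lemma dd_tensor: "mi n I \<Longrightarrow> mi n J \<Longrightarrow>
    dd n I J (tensor f g) = tensor (pderI n I f) (pderI n J (g :: _ \<Rightarrow> 'k::field_char_0))"
  by (intro ext) (simp add: dd_def pderI_eq tensor_def mult_ac)

section \<open>Polynomial tensors paired with series\<close>

definition spoly2 :: "nat \<Rightarrow> ((nat \<Rightarrow> nat) \<Rightarrow> (nat \<Rightarrow> nat) \<Rightarrow> 'k::zero) \<Rightarrow> bool" where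
  "spoly2 n T \<longleftrightarrow> finite {(A, B). T A B \<noteq> 0} \<and> (\<forall>A B. T A B \<noteq> 0 \<longrightarrow> mi n A \<and> mi n B)"

text \<open>The pairing of S(g) \<open>\<otimes>\<close> S(g) with power series in the derivatives,
  i.e. the value at the origin of the series applied to the tensor.\<close>
definition pairing :: "nat \<Rightarrow> ((nat \<Rightarrow> nat) \<Rightarrow> (nat \<Rightarrow> nat) \<Rightarrow> 'k::field_char_0) \<Rightarrow> ((nat \<Rightarrow> nat) \<Rightarrow> (nat \<Rightarrow> nat) \<Rightarrow> 'k) \<Rightarrow> 'k" where
  "pairing n T D = (\<Sum>(A, B) | T A B \<noteq> 0. mfact n A * mfact n B * T A B * D A B)"

lemma spoly2_tensor: "spoly n f \<Longrightarrow> spoly n g \<Longrightarrow> spoly2 n (tensor f (g :: _ \<Rightarrow> 'k::field_char_0))"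
proof -
  assume a: "spoly n f" "spoly n g"
  have "{(A, B). tensor f g A B \<noteq> 0} = {A. f A \<noteq> 0} \<times> {B. g B \<noteq> 0}"
    by (auto simp: tensor_def)
  then show ?thesis using a by (auto simp: spoly2_def tensor_def spoly_def)
qed

lemma pairing_superset:
  assumes "finite S" "\<And>A B. T A B \<noteq> 0 \<Longrightarrow> (A, B) \<in> S"
  shows "pairing n T D = (\<Sum>(A, B)\<in>S. mfact n A * mfact n B * T A B * D A B)"
  unfolding pairing_def using assms by (intro sum.mono_neutral_left) auto

lemma pairing_sum: "pairing n T (\<lambda>A B. \<Sum>t\<in>S. r t * D t A B) = (\<Sum>t\<in>S. r t * pairing n T (D t))"
proof -
  have "pairing n T (\<lambda>A B. \<Sum>t\<in>S. r t * D t A B)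
      = (\<Sum>p | T (fst p) (snd p) \<noteq> 0. \<Sum>t\<in>S. r t * (mfact n (fst p) * mfact n (snd p) * T (fst p) (snd p) * D t (fst p) (snd p)))"
    by (simp add: pairing_def case_prod_unfold sum_distrib_left mult_ac)
  also have "\<dots> = (\<Sum>t\<in>S. r t * pairing n T (D t))"
    by (subst sum.swap) (simp add: pairing_def case_prod_unfold sum_distrib_left)
  finally show ?thesis .
qed

lemma pairing_tensor:
  "pairing n (tensor f g) D = fpair (\<lambda>A. fpair (\<lambda>B. mfact n A * mfact n B * D A B) g) f"
proof -
  have "{(A, B). tensor f g A B \<noteq> 0} = {A. f A \<noteq> 0} \<times> {B. g B \<noteq> 0}"
    by (auto simp: tensor_def)
  then have "pairing n (tensor f g) D = (\<Sum>(A, B)\<in>{A. f A \<noteq> 0} \<times> {B. g B \<noteq> 0}. mfact n A * mfact n B * tensor f g A B * D A B)"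
    unfolding pairing_def by simp
  also have "\<dots> = fpair (\<lambda>A. fpair (\<lambda>B. mfact n A * mfact n B * D A B) g) f"
    unfolding sum.cartesian_product[symmetric]
    by (simp add: fpair_def tensor_def sum_distrib_left mult_ac)
  finally show ?thesis .
qed

lemma fsum_superset:
  assumes "finite U" "\<And>x. x \<in> S \<Longrightarrow> P x \<noteq> 0 \<Longrightarrow> x \<in> U" "\<And>x. x \<in> U \<Longrightarrow> x \<in> S"
  shows "fsum P S = sum P U"
  unfolding fsum_def using assms by (intro sum.mono_neutral_left) auto

text \<open>A common finite index set: it contains the exponents of every derivative that does not
  kill T and the exponents of every monomial left after differentiation. The formally infinite sums
  in \<open>act\<close> and in the coproduct identity can therefore be taken over it.\<close>

definition down_supp :: "((nat \<Rightarrow> nat) \<Rightarrow> (nat \<Rightarrow> nat) \<Rightarrow> 'k::zero) \<Rightarrow> ((nat \<Rightarrow> nat) \<times> (nat \<Rightarrow> nat)) set" where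
  "down_supp T = (\<Union>p\<in>{(A, B). T A B \<noteq> 0}. down (fst p) \<times> down (snd p))"

lemma down_supp_props:
  assumes "spoly2 n T"
  shows "finite (down_supp T)" "\<And>I J. (I, J) \<in> down_supp T \<Longrightarrow> mi n I \<and> mi n J"
    and "\<And>A B I J. T (madd A I) (madd B J) \<noteq> 0 \<Longrightarrow> (A, B) \<in> down_supp T \<and> (I, J) \<in> down_supp T"
proof -
  have mi: "mi n (fst p) \<and> mi n (snd p)" if "p \<in> {(A, B). T A B \<noteq> 0}" for p
    using assms that by (auto simp: spoly2_def)
  show "finite (down_supp T)"
    unfolding down_supp_def using assms mi
    by (intro finite_UN_I finite_cartesian_product) (auto simp: spoly2_def intro: finite_down[of n])
  show "mi n I \<and> mi n J" if "(I, J) \<in> down_supp T" for I J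
  proof -
    from that obtain p where "p \<in> {(A, B). T A B \<noteq> 0}" and p: "I \<in> down (fst p)" "J \<in> down (snd p)"
      unfolding down_supp_def by blast
    then show ?thesis using mi[of p] mi_down[OF _ p(1)] mi_down[OF _ p(2)] by blast
  qed
  show "(A, B) \<in> down_supp T \<and> (I, J) \<in> down_supp T" if "T (madd A I) (madd B J) \<noteq> 0" for A B I J
    unfolding down_supp_def using that
    by (intro conjI UN_I[of "(madd A I, madd B J)"]) simp_all
qed

lemma dd_nonzero:
  assumes "spoly2 n T" "mi n I" "mi n J" "dd n I J T A B \<noteq> (0 :: 'k::field_char_0)"
  shows "T (madd A I) (madd B J) \<noteq> 0"
  using dd_eq[OF assms(2,3), of A B T] assms(4) by auto

lemma pairing_dd:
  assumes T: "spoly2 n (T :: _ \<Rightarrow> _ \<Rightarrow> 'k::field_char_0)" and I: "mi n I" and J: "mi n J"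
  shows "pairing n (dd n I J T) D
    = (\<Sum>(A, B)\<in>down_supp T. mfact n (madd A I) * mfact n (madd B J) * T (madd A I) (madd B J) * D A B)"
proof -
  have "pairing n (dd n I J T) D = (\<Sum>(A, B)\<in>down_supp T. mfact n A * mfact n B * dd n I J T A B * D A B)"
    using down_supp_props[OF T] dd_nonzero[OF T I J] by (intro pairing_superset) blast+
  then show ?thesis by (simp add: dd_eq I J)
qed

text \<open>After differentiation by (I, J), the entry at (A, B) sees T at (A + I, B + J), with
  factorials matching by \<open>dd_eq\<close>. Collecting the terms by these sums of exponents
  leaves the Cauchy product of C and D.\<close>

lemma sum_dd_eq_pairing_ser_mul:
  assumes T: "spoly2 n (T :: _ \<Rightarrow> _ \<Rightarrow> 'k::field_char_0)"
  shows "(\<Sum>(I, J)\<in>down_supp T. C I J * pairing n (dd n I J T) D) = pairing n T (ser_mul C D)"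
proof -
  let ?g = "\<lambda>A B. mfact n A * mfact n B * T A B"
  let ?S = "{(A, B). T A B \<noteq> 0}"
  let ?F = "\<lambda>(p, q). C (fst p) (snd p) * (?g (madd (fst q) (fst p)) (madd (snd q) (snd p)) * D (fst q) (snd q))"
  have fin: "finite (down_supp T)" using down_supp_props[OF T] by blast
  have finS: "finite ?S" using T by (simp add: spoly2_def)
  have find: "finite (down (fst p) \<times> down (snd p))" if "p \<in> ?S" for p
    using that T by (auto simp: spoly2_def intro!: finite_cartesian_product intro: finite_down[of n])
  have "(\<Sum>(I, J)\<in>down_supp T. C I J * pairing n (dd n I J T) D) = (\<Sum>p\<in>down_supp T. \<Sum>q\<in>down_supp T. ?F (p, q))"
  proof (rule sum.cong[OF refl])
    fix p assume p: "p \<in> down_supp T"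
    then have "mi n (fst p)" "mi n (snd p)" using down_supp_props(2)[OF T, of "fst p" "snd p"] by auto
    then show "(case p of (I, J) \<Rightarrow> C I J * pairing n (dd n I J T) D) = (\<Sum>q\<in>down_supp T. ?F (p, q))"
      by (simp add: case_prod_unfold pairing_dd[OF T] sum_distrib_left)
  qed
  also have "\<dots> = (\<Sum>z\<in>down_supp T \<times> down_supp T. ?F z)"
    by (simp add: sum.cartesian_product)
  also have "\<dots> = (\<Sum>z\<in>{z \<in> down_supp T \<times> down_supp T. T (madd (fst (snd z)) (fst (fst z))) (madd (snd (snd z)) (snd (fst z))) \<noteq> 0}. ?F z)"
    by (rule sum.mono_neutral_right) (use fin in auto)
  also have "\<dots> = (\<Sum>(p, q)\<in>(SIGMA p:?S. down (fst p) \<times> down (snd p)).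
      ?g (fst p) (snd p) * (C (fst q) (snd q) * D (msub (fst p) (fst q)) (msub (snd p) (snd q))))"
  proof (rule sum.reindex_bij_witness[where
        j = "\<lambda>z. ((madd (fst (snd z)) (fst (fst z)), madd (snd (snd z)) (snd (fst z))), fst z)"
        and i = "\<lambda>z. (snd z, (msub (fst (fst z)) (fst (snd z)), msub (snd (fst z)) (snd (snd z))))"])
    fix z assume z: "z \<in> (SIGMA p:?S. down (fst p) \<times> down (snd p))"
    obtain A B I J where e: "z = ((A, B), (I, J))" by (metis surj_pair)
    have le: "I i \<le> A i" "J i \<le> B i" for i using z by (auto simp: e)
    have m: "madd (msub A I) I = A" "madd (msub B J) J = B" using le by auto
    have "T A B \<noteq> 0" using z by (simp add: e)
    then have "T (madd (msub A I) I) (madd (msub B J) J) \<noteq> 0" unfolding m .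
    from down_supp_props(3)[OF T this] this
    show "(snd z, (msub (fst (fst z)) (fst (snd z)), msub (snd (fst z)) (snd (snd z))))
        \<in> {z \<in> down_supp T \<times> down_supp T. T (madd (fst (snd z)) (fst (fst z))) (madd (snd (snd z)) (snd (fst z))) \<noteq> 0}"
      by (simp only: e fst_conv snd_conv mem_Collect_eq mem_Times_iff simp_thms)
    show "((madd (fst (snd (snd z, (msub (fst (fst z)) (fst (snd z)), msub (snd (fst z)) (snd (snd z))))))
        (fst (fst (snd z, (msub (fst (fst z)) (fst (snd z)), msub (snd (fst z)) (snd (snd z)))))),
        madd (snd (snd (snd z, (msub (fst (fst z)) (fst (snd z)), msub (snd (fst z)) (snd (snd z))))))
        (snd (fst (snd z, (msub (fst (fst z)) (fst (snd z)), msub (snd (fst z)) (snd (snd z))))))),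
        fst (snd z, (msub (fst (fst z)) (fst (snd z)), msub (snd (fst z)) (snd (snd z))))) = z"
      by (simp only: e fst_conv snd_conv m)
  qed (auto simp: case_prod_unfold mult_ac)
  also have "\<dots> = (\<Sum>p\<in>?S. \<Sum>q\<in>down (fst p) \<times> down (snd p).
      ?g (fst p) (snd p) * (C (fst q) (snd q) * D (msub (fst p) (fst q)) (msub (snd p) (snd q))))"
    using finS find by (intro sum.Sigma[symmetric]) auto
  also have "\<dots> = pairing n T (ser_mul C D)"
    by (simp add: pairing_def ser_mul_def case_prod_unfold sum_distrib_left)
  finally show ?thesis .
qed

lemma act_down_supp:
  assumes T: "spoly2 n (T :: _ \<Rightarrow> _ \<Rightarrow> 'k::field_char_0)"
  shows "act n C T A B = (\<Sum>(I, J)\<in>down_supp T. C I J * dd n I J T A B)"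
  unfolding act_def
proof (rule fsum_superset)
  fix p :: "(nat \<Rightarrow> nat) \<times> (nat \<Rightarrow> nat)"
  obtain I J where p: "p = (I, J)" by (cases p)
  show "p \<in> {(I, J). mi n I \<and> mi n J}" if "p \<in> down_supp T"
    using that down_supp_props(2)[OF T, of I J] by (simp add: p)
  assume "p \<in> {(I, J). mi n I \<and> mi n J}" "(case p of (I, J) \<Rightarrow> C I J * dd n I J T A B) \<noteq> 0"
  then have "mi n I" "mi n J" "dd n I J T A B \<noteq> 0" by (auto simp: p)
  then show "p \<in> down_supp T" using down_supp_props(3)[OF T dd_nonzero[OF T]] by (simp add: p)
qed (rule down_supp_props(1)[OF T])

lemma spoly2_act:
  assumes T: "spoly2 n (T :: _ \<Rightarrow> _ \<Rightarrow> 'k::field_char_0)"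
  shows "spoly2 n (act n C T)" "act n C T A B \<noteq> 0 \<Longrightarrow> (A, B) \<in> down_supp T"
proof -
  have *: "(A, B) \<in> down_supp T" if "act n C T A B \<noteq> 0" for A B
  proof -
    have "(\<Sum>(I, J)\<in>down_supp T. C I J * dd n I J T A B) \<noteq> 0" using that unfolding act_down_supp[OF T] .
    then obtain p where p: "p \<in> down_supp T" "(case p of (I, J) \<Rightarrow> C I J * dd n I J T A B) \<noteq> 0"
      by (rule sum.not_neutral_contains_not_neutral)
    obtain I J where e: "p = (I, J)" by (cases p)
    have "dd n I J T A B \<noteq> 0" using p by (auto simp: e)
    moreover have "mi n I" "mi n J" using p down_supp_props(2)[OF T] by (auto simp: e)
    ultimately show ?thesis using dd_nonzero[OF T] down_supp_props(3)[OF T] by blast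
  qed
  then have "{(A, B). act n C T A B \<noteq> 0} \<subseteq> down_supp T" by auto
  then show "spoly2 n (act n C T)" unfolding spoly2_def
    using * down_supp_props(1,2)[OF T] by (meson finite_subset)
  show "(A, B) \<in> down_supp T" if "act n C T A B \<noteq> 0" using * that .
qed

text \<open>An exchange of finite sums reduces this to \<open>sum_dd_eq_pairing_ser_mul\<close>. It
  expresses that acting by C on tensors is adjoint to multiplying series by C.\<close>

lemma pairing_act:
  assumes T: "spoly2 n (T :: _ \<Rightarrow> _ \<Rightarrow> 'k::field_char_0)"
  shows "pairing n (act n C T) D = pairing n T (ser_mul C D)"
proof -
  have sup: "pairing n (act n C T) D = (\<Sum>q\<in>down_supp T. mfact n (fst q) * mfact n (snd q) * act n C T (fst q) (snd q) * D (fst q) (snd q))"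
    unfolding case_prod_unfold[symmetric]
    by (subst pairing_superset[of "down_supp T"]) (use down_supp_props(1)[OF T] spoly2_act(2)[OF T] in \<open>auto simp: case_prod_unfold\<close>)
  also have "\<dots> = (\<Sum>q\<in>down_supp T. \<Sum>p\<in>down_supp T. C (fst p) (snd p) *
      (mfact n (fst q) * mfact n (snd q) * dd n (fst p) (snd p) T (fst q) (snd q) * D (fst q) (snd q)))"
    by (simp add: act_down_supp[OF T] case_prod_unfold sum_distrib_left sum_distrib_right mult_ac)
  also have "\<dots> = (\<Sum>p\<in>down_supp T. C (fst p) (snd p) * (\<Sum>q\<in>down_supp T.
      mfact n (fst q) * mfact n (snd q) * dd n (fst p) (snd p) T (fst q) (snd q) * D (fst q) (snd q)))"
    by (subst sum.swap) (simp add: sum_distrib_left)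
  also have "\<dots> = (\<Sum>(I, J)\<in>down_supp T. C I J * pairing n (dd n I J T) D)"
  proof (rule sum.cong[OF refl])
    fix p assume p: "p \<in> down_supp T"
    obtain I J where e: "p = (I, J)" by (cases p)
    have "mi n I" "mi n J" using p down_supp_props(2)[OF T] by (auto simp: e)
    then have "pairing n (dd n I J T) D = (\<Sum>(A, B)\<in>down_supp T. mfact n A * mfact n B * dd n I J T A B * D A B)"
      using down_supp_props[OF T] dd_nonzero[OF T] by (intro pairing_superset) blast+
    then show "C (fst p) (snd p) * (\<Sum>q\<in>down_supp T. mfact n (fst q) * mfact n (snd q) * dd n (fst p) (snd p) T (fst q) (snd q) * D (fst q) (snd q))
        = (case p of (I, J) \<Rightarrow> C I J * pairing n (dd n I J T) D)"
      by (simp add: e case_prod_unfold)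
  qed
  finally show ?thesis by (simp only: sum_dd_eq_pairing_ser_mul[OF T])
qed

text \<open>The coefficients of the product of the \<open>Delta0 l\<close> to the powers M l, in the
  closed form given by the binomial theorem; \<open>Delta0_pow_monpow\<close> proves the
  agreement.\<close>

definition Delta0_pow :: "nat \<Rightarrow> (nat \<Rightarrow> nat) \<Rightarrow> (nat \<Rightarrow> nat) \<Rightarrow> (nat \<Rightarrow> nat) \<Rightarrow> 'k::field_char_0" where
  "Delta0_pow n M A B = (if madd A B = M then mfact n M / (mfact n A * mfact n B) else 0)"

lemma unitv_down: "unitv l \<in> down A \<longleftrightarrow> 0 < A l"
  by (auto simp: unitv_def Suc_le_eq)

lemma ser_mul_Delta0:
  assumes "fin_mi A" "fin_mi B"
  shows "ser_mul (Delta0 l) X A B = (if 0 < A l then X (msub A (unitv l)) B else 0)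
    + (if 0 < B l then X A (msub B (unitv l)) else (0 :: 'k::comm_ring_1))"
proof -
  have fin: "finite (down A \<times> down B)" using assms by (simp add: finite_down_fin_mi)
  have "ser_mul (Delta0 l) X A B = (\<Sum>p\<in>down A \<times> down B.
      (if p = (unitv l, \<lambda>_. 0) then X (msub A (unitv l)) B else 0)
      + (if p = (\<lambda>_. 0, unitv l) then X A (msub B (unitv l)) else 0))"
    unfolding ser_mul_def
  proof (rule sum.cong[OF refl])
    fix p :: "(nat \<Rightarrow> nat) \<times> (nat \<Rightarrow> nat)"
    obtain a b where p: "p = (a, b)" by (cases p)
    have if_elim_mult: "(if P then 1 else 0) * x = (if P then y else 0)" if "P \<Longrightarrow> x = y" for P and x y :: 'k
      using that by simp
    have 1: "(if a = unitv l \<and> b = (\<lambda>_. 0) then 1 else 0) * X (msub A a) (msub B b)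
        = (if p = (unitv l, \<lambda>_. 0) then X (msub A (unitv l)) B else 0)"
      unfolding p prod.inject by (rule if_elim_mult) simp
    have 2: "(if a = (\<lambda>_. 0) \<and> b = unitv l then 1 else 0) * X (msub A a) (msub B b)
        = (if p = (\<lambda>_. 0, unitv l) then X A (msub B (unitv l)) else 0)"
      unfolding p prod.inject by (rule if_elim_mult) simp
    show "(case p of (I', J') \<Rightarrow> Delta0 l I' J' * X (msub A I') (msub B J'))
        = (if p = (unitv l, \<lambda>_. 0) then X (msub A (unitv l)) B else 0)
          + (if p = (\<lambda>_. 0, unitv l) then X A (msub B (unitv l)) else 0)"
      unfolding 1[symmetric] 2[symmetric] by (simp add: p Delta0_def distrib_right)
  qed
  also have "\<dots> = (if (unitv l, \<lambda>_. 0) \<in> down A \<times> down B then X (msub A (unitv l)) B else 0)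
      + (if (\<lambda>_. 0, unitv l) \<in> down A \<times> down B then X A (msub B (unitv l)) else 0)"
    by (simp only: sum.distrib sum.delta[OF fin])
  also have "(unitv l, \<lambda>_. 0) \<in> down A \<times> down B \<longleftrightarrow> 0 < A l"
    unfolding mem_Times_iff fst_conv snd_conv unitv_down by simp
  also have "(\<lambda>_. 0, unitv l) \<in> down A \<times> down B \<longleftrightarrow> 0 < B l"
    unfolding mem_Times_iff fst_conv snd_conv unitv_down by simp
  finally show ?thesis .
qed

section \<open>The deformed coproduct\<close>

lemma fin_mi_unitv: "fin_mi (unitv l)"
  by (rule mi_fin_mi[of "Suc l"]) (simp add: mi_def unitv_def)

lemma mi_unitv: "l < n \<Longrightarrow> mi n (unitv l)"
  by (simp add: mi_def unitv_def)

lemma madd_commute: "madd A B = madd B A"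
  by (rule ext) simp

lemma Delta0_pow_commute: "Delta0_pow n M A B = Delta0_pow n M B A"
  unfolding Delta0_pow_def by (simp add: madd_commute[of A] mult.commute)

lemma Delta0_pow_carrier: "mi n M \<Longrightarrow> Delta0_pow n M \<in> ser_carrier"
proof (rule ser_carrierI)
  fix A B assume M: "mi n M" and "\<not> (fin_mi A \<and> fin_mi B)"
  then have "madd A B \<noteq> M" using mi_fin_mi[OF M] fin_mi_madd by blast
  then show "Delta0_pow n M A B = 0" by (simp add: Delta0_pow_def)
qed

lemma Delta0_carrier: "Delta0 l \<in> ser_carrier"
proof (rule ser_carrierI)
  fix A B assume "\<not> (fin_mi A \<and> fin_mi B)"
  then have "\<not> (A = unitv l \<and> B = (\<lambda>_. 0))" "\<not> (A = (\<lambda>_. 0) \<and> B = unitv l)"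
    using fin_mi_unitv fin_mi_zero by auto
  then show "Delta0 l A B = 0" unfolding Delta0_def by (simp only: if_False add_0)
qed

lemma madd_unitv_msub: "0 < A l \<Longrightarrow> madd (unitv l) (msub A (unitv l)) = A"
  by (rule madd_msub) (simp only: unitv_down)

lemma Delta0_pow_msub:
  assumes "l < n" "0 < A l"
  shows "Delta0_pow n M (msub A (unitv l)) B = (if madd A B = madd (unitv l) M
    then of_nat (A l) * mfact n M / (mfact n A * mfact n B) else (0 :: 'k::field_char_0))"
proof -
  define A' where "A' = msub A (unitv l)"
  have A: "A = madd (unitv l) A'" unfolding A'_def using madd_unitv_msub[of A l] assms(2) by simp
  have "madd A B = madd (unitv l) M \<longleftrightarrow> madd A' B = M"
    unfolding A by (auto simp: fun_eq_iff)
  moreover have "A l = Suc (A' l)" unfolding A by (simp add: unitv_def)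
  moreover have "mfact n A = (of_nat (Suc (A' l)) * mfact n A' :: 'k)"
    unfolding A by (rule mfact_madd_unitv[OF assms(1)])
  ultimately show ?thesis
    unfolding A'_def[symmetric] Delta0_pow_def by (simp del: of_nat_Suc)
qed

lemma Delta0_pow_step:
  assumes l: "l < n" and M: "mi n M"
  shows "Delta0_pow n (madd (unitv l) M) = (ser_mul (Delta0 l) (Delta0_pow n M) :: _ \<Rightarrow> _ \<Rightarrow> 'k::field_char_0)"
proof (rule ser_ext)
  have M': "mi n (madd (unitv l) M)" using M mi_unitv[OF l] by (simp add: mi_madd)
  show "Delta0_pow n (madd (unitv l) M) \<in> (ser_carrier :: (_ \<Rightarrow> _ \<Rightarrow> 'k) set)" by (rule Delta0_pow_carrier[OF M'])
  show "ser_mul (Delta0 l) (Delta0_pow n M) \<in> (ser_carrier :: (_ \<Rightarrow> _ \<Rightarrow> 'k) set)"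
    by (intro ser_mul_carrier Delta0_carrier Delta0_pow_carrier M)
  fix A B assume f: "fin_mi A" "fin_mi B"
  let ?t = "\<lambda>k. if madd A B = madd (unitv l) M
    then of_nat k * mfact n M / (mfact n A * mfact n B) else (0 :: 'k)"
  have a: "(if 0 < A l then Delta0_pow n M (msub A (unitv l)) B else 0) = ?t (A l)"
    by (simp add: Delta0_pow_msub[OF l])
  have b: "(if 0 < B l then Delta0_pow n M A (msub B (unitv l)) else 0) = ?t (B l)"
    by (simp add: Delta0_pow_commute[of n M A] Delta0_pow_msub[OF l] madd_commute[of B] mult.commute)
  have "?t (A l) + ?t (B l) = Delta0_pow n (madd (unitv l) M) A B"
  proof (cases "madd A B = madd (unitv l) M")
    case True
    \<comment> \<open>The two shifts contribute with a common denominator and weights A l and B l.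
      These add up to M l + 1, the factor by which \<open>mfact\<close> grows from M to
      \<open>madd (unitv l) M\<close>.\<close>
    then have "A l + B l = Suc (M l)" by (metis add_Suc plus_nat.add_0 unitv_def One_nat_def)
    then have s: "of_nat (A l) + of_nat (B l) = (of_nat (Suc (M l)) :: 'k)" by (metis of_nat_add)
    have "?t (A l) + ?t (B l) = (of_nat (A l) + of_nat (B l)) * mfact n M / (mfact n A * mfact n B)"
      unfolding if_P[OF True] by (simp only: add_divide_distrib distrib_right)
    then show ?thesis
      unfolding s Delta0_pow_def if_P[OF True] mfact_madd_unitv[OF l] .
  next
    case False
    show ?thesis unfolding Delta0_pow_def if_not_P[OF False] by simp
  qed
  moreover have "ser_mul (Delta0 l) (Delta0_pow n M) A B = ?t (A l) + ?t (B l)"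
    by (rule trans[OF ser_mul_Delta0[OF f] arg_cong2[where f = "(+)", OF a b]])
  ultimately show "Delta0_pow n (madd (unitv l) M) A B = (ser_mul (Delta0 l) (Delta0_pow n M) A B :: 'k)"
    by simp
qed

definition Delta0_ser :: "nat \<Rightarrow> 'k::field_char_0 mser" where
  "Delta0_ser l = Abs_mser (Delta0 l)"

lemma Rep_Delta0_ser: "Rep_mser (Delta0_ser l) = Delta0 l"
  unfolding Delta0_ser_def by (rule Abs_mser_inverse[OF Delta0_carrier])

lemma Delta0_pow_monpow:
  assumes "mi n M"
  shows "Rep_mser (monpow n Delta0_ser M) = (Delta0_pow n M :: _ \<Rightarrow> _ \<Rightarrow> 'k::field_char_0)"
  using assms
proof (induction M rule: mi_induct)
  case zero
  show ?case
  proof (intro ext)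
    fix A B :: "nat \<Rightarrow> nat"
    have "madd A B = (\<lambda>_. 0) \<longleftrightarrow> A = (\<lambda>_. 0) \<and> B = (\<lambda>_. 0)" by (auto simp: fun_eq_iff)
    then show "Rep_mser (monpow n Delta0_ser (\<lambda>_. 0)) A B = (Delta0_pow n (\<lambda>_. 0) A B :: 'k)"
      unfolding monpow_zero Rep_mser_1 ser_one_def Delta0_pow_def by (simp add: mfact_def)
  qed
next
  case (step l M)
  then show ?case
    by (simp only: monpow_madd monpow_unitv Rep_mser_mult Rep_Delta0_ser Delta0_pow_step)
qed

text \<open>The commutative counterpart of \<open>star_pairing\<close>: the factorials in
  \<open>Delta0_pow\<close> cancel those in \<open>pairing\<close>, and only pairs of exponents with
  sum M survive.\<close>

lemma mT_pairing:
  assumes S: "spoly2 n (S :: _ \<Rightarrow> _ \<Rightarrow> 'k::field_char_0)" and M: "mi n M"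
  shows "mT S M = pairing n S (Delta0_pow n M) / mfact n M"
proof -
  let ?s = "{(A, B). S A B \<noteq> 0}"
  have fin: "finite ?s" using S by (simp add: spoly2_def)
  have "pairing n S (Delta0_pow n M) = (\<Sum>p\<in>?s. if madd (fst p) (snd p) = M then mfact n M * S (fst p) (snd p) else 0)"
    unfolding pairing_def by (rule sum.cong) (auto simp: Delta0_pow_def)
  also have "\<dots> = (\<Sum>p\<in>{p \<in> ?s. madd (fst p) (snd p) = M}. mfact n M * S (fst p) (snd p))"
    by (rule sum.inter_filter[symmetric, OF fin])
  also have "\<dots> = (\<Sum>A\<in>{A \<in> down M. S A (msub M A) \<noteq> 0}. mfact n M * S A (msub M A))"
    by (rule sum.reindex_bij_witness[where i = "\<lambda>A. (A, msub M A)" and j = fst]) auto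
  also have "\<dots> = (\<Sum>A\<in>down M. mfact n M * S A (msub M A))"
    by (rule sum.mono_neutral_left) (use finite_down[OF M] in auto)
  finally show ?thesis by (simp add: mT_def sum_distrib_left[symmetric])
qed

lemma mT_not_mi:
  assumes S: "spoly2 n S" and M: "\<not> mi n M"
  shows "mT S M = (0 :: 'k::field_char_0)"
  unfolding mT_def
proof (rule sum.neutral, rule ballI)
  fix A assume A: "A \<in> down M"
  have "\<not> (mi n A \<and> mi n (msub M A))" using M mi_madd[of n A "msub M A"] madd_msub[OF A] by simp
  then show "S A (msub M A) = 0" using S unfolding spoly2_def by blast
qed

lemma pmul_mono:
  assumes "mi n M"
  shows "pmul (mono i) q M = (if i \<in> down M then q (msub M i) else 0)"
proof -
  have "pmul (mono i) q M = (\<Sum>A\<in>down M. if A = i then q (msub M i) else 0)"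
    unfolding pmul_def by (rule sum.cong) (auto simp: mono_def)
  then show ?thesis by (simp only: sum.delta[OF finite_down[OF assms]])
qed

lemma pmul_mono_not_mi:
  assumes "mi n i" "\<not> mi n M" "\<And>K. \<not> mi n K \<Longrightarrow> q K = 0"
  shows "pmul (mono i) q M = 0"
  unfolding pmul_def
proof (rule sum.neutral, rule ballI)
  fix A assume A: "A \<in> down M"
  show "mono i A * q (msub M A) = 0"
  proof (cases "A = i")
    case True
    then have "\<not> mi n (msub M A)"
      using assms(1,2) mi_madd[of n A "msub M A"] madd_msub[OF A] by simp
    then show ?thesis using assms(3) by simp
  qed (simp add: mono_def)
qed

text \<open>Order of vanishing at the origin. A series of order k annihilates tensors of total
  degree below k (\<open>act_ord_ge\<close>), which is what makes the final sum finite.\<close>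

definition ord_ge :: "nat \<Rightarrow> nat \<Rightarrow> ((nat \<Rightarrow> nat) \<Rightarrow> (nat \<Rightarrow> nat) \<Rightarrow> 'k::comm_ring_1) \<Rightarrow> bool" where
  "ord_ge n k C \<longleftrightarrow> (\<forall>A B. deg n A + deg n B < k \<longrightarrow> C A B = 0)"

lemma ord_ge_mul:
  assumes "ord_ge n k C" "ord_ge n l D"
  shows "ord_ge n (k + l) (ser_mul C D)"
  unfolding ord_ge_def
proof (intro allI impI)
  fix A B assume lt: "deg n A + deg n B < k + l"
  have "C a b * D (msub A a) (msub B b) = 0" if "a \<in> down A" "b \<in> down B" for a b
  proof -
    have "deg n A = deg n a + deg n (msub A a)" "deg n B = deg n b + deg n (msub B b)"
      using deg_madd[of n a "msub A a"] deg_madd[of n b "msub B b"] madd_msub[OF that(1)] madd_msub[OF that(2)]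
      by simp_all
    then have "deg n a + deg n b < k \<or> deg n (msub A a) + deg n (msub B b) < l" using lt by linarith
    then have "C a b = 0 \<or> D (msub A a) (msub B b) = 0" using assms unfolding ord_ge_def by blast
    then show ?thesis by (elim disjE) simp_all
  qed
  then show "ser_mul C D A B = 0" by (auto simp: ser_mul_def intro!: sum.neutral)
qed

lemma deg_unitv: "l < n \<Longrightarrow> deg n (unitv l) = 1"
  by (simp add: deg_def unitv_def)

lemma ord_ge_monpow:
  assumes "\<And>l. l < n \<Longrightarrow> ord_ge n 1 (Rep_mser (x l))" "mi n i"
  shows "ord_ge n (deg n i) (Rep_mser (monpow n x i))"
  using assms(2)
proof (induction i rule: mi_induct)
  case zero
  show ?case by (simp add: ord_ge_def deg_def)
next
  case (step l i)
  then show ?case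
    using ord_ge_mul[OF assms(1)[OF step(1)] step(3)]
    by (simp only: monpow_madd monpow_unitv Rep_mser_mult deg_madd deg_unitv)
qed

lemma act_ord_ge:
  assumes T: "spoly2 n (T :: _ \<Rightarrow> _ \<Rightarrow> 'k::field_char_0)"
    and bound: "\<And>A B. T A B \<noteq> 0 \<Longrightarrow> deg n A + deg n B < k" and C: "ord_ge n k C"
  shows "act n C T = (\<lambda>_ _. 0)"
proof (intro ext)
  fix A B
  show "act n C T A B = 0"
    unfolding act_down_supp[OF T]
  proof (rule sum.neutral, rule ballI)
    fix p assume p: "p \<in> down_supp T"
    obtain I J where e: "p = (I, J)" by (cases p)
    have mi: "mi n I" "mi n J" using p down_supp_props(2)[OF T] by (auto simp: e)
    have "C I J = 0 \<or> dd n I J T A B = 0"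
    proof (rule ccontr)
      assume "\<not> (C I J = 0 \<or> dd n I J T A B = 0)"
      then have *: "C I J \<noteq> 0" "dd n I J T A B \<noteq> 0" by auto
      have "deg n (madd A I) + deg n (madd B J) < k" using bound[OF dd_nonzero[OF T mi *(2)]] .
      then have "deg n I + deg n J < k" by (simp add: deg_madd)
      then show False using C *(1) unfolding ord_ge_def by blast
    qed
    then show "(case p of (I, J) \<Rightarrow> C I J * dd n I J T A B) = 0" by (auto simp: e)
  qed
qed

section \<open>The coproduct identity for the star product\<close>

context lie_alg
begin

lemma star_pairing:
  assumes "spoly n f" "spoly n g"
  shows "star n c f g K = pairing n (tensor f g) (star_coeff K) / mfact n K"
  unfolding pairing_tensor star_fpair[OF assms, symmetric] by simp

text \<open>Each star product of derivatives is a pairing by \<open>star_pairing\<close>, and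
  adjointness moves the derivatives onto the series. Existence and uniqueness of the coproduct
  series both become statements about the product of C with \<open>star_coeff M\<close>.\<close>

lemma fsum_star_pderI:
  assumes f: "spoly n f" and g: "spoly n g"
  shows "fsum (\<lambda>(I, J). C I J * star n c (pderI n I f) (pderI n J g) M) {(I, J). mi n I \<and> mi n J}
    = pairing n (tensor f g) (ser_mul C (star_coeff M)) / mfact n M"
proof -
  let ?T = "tensor f g"
  have T: "spoly2 n ?T" by (rule spoly2_tensor[OF f g])
  have s: "star n c (pderI n I f) (pderI n J g) M = pairing n (dd n I J ?T) (star_coeff M) / mfact n M"
    if "mi n I" "mi n J" for I J
    using that star_pairing[OF spoly_pderI[OF _ f] spoly_pderI[OF _ g]] by (simp add: dd_tensor)
  have "fsum (\<lambda>(I, J). C I J * star n c (pderI n I f) (pderI n J g) M) {(I, J). mi n I \<and> mi n J}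
      = (\<Sum>(I, J)\<in>down_supp ?T. C I J * star n c (pderI n I f) (pderI n J g) M)"
  proof (rule fsum_superset)
    fix p :: "(nat \<Rightarrow> nat) \<times> (nat \<Rightarrow> nat)"
    obtain I J where p: "p = (I, J)" by (cases p)
    show "p \<in> {(I, J). mi n I \<and> mi n J}" if "p \<in> down_supp ?T"
      using that down_supp_props(2)[OF T, of I J] by (simp add: p)
    assume "p \<in> {(I, J). mi n I \<and> mi n J}" "(case p of (I, J) \<Rightarrow> C I J * star n c (pderI n I f) (pderI n J g) M) \<noteq> 0"
    then have mi: "mi n I" "mi n J" and "C I J * star n c (pderI n I f) (pderI n J g) M \<noteq> 0"
      by (auto simp: p)
    then have "pairing n (dd n I J ?T) (star_coeff M) \<noteq> 0" by (auto simp: s)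
    then obtain A B where "dd n I J ?T A B \<noteq> 0"
      unfolding pairing_def by (metis (mono_tags, lifting) case_prodE mem_Collect_eq sum.not_neutral_contains_not_neutral)
    then show "p \<in> down_supp ?T" using down_supp_props(3)[OF T dd_nonzero[OF T mi]] by (simp add: p)
  qed (rule down_supp_props(1)[OF T])
  also have "\<dots> = (\<Sum>(I, J)\<in>down_supp ?T. C I J * pairing n (dd n I J ?T) (star_coeff M)) / mfact n M"
    unfolding sum_divide_distrib
  proof (rule sum.cong[OF refl])
    fix p assume "p \<in> down_supp ?T"
    moreover obtain I J where p: "p = (I, J)" by (cases p)
    ultimately have "mi n I" "mi n J" using down_supp_props(2)[OF T] by auto
    then show "(case p of (I, J) \<Rightarrow> C I J * star n c (pderI n I f) (pderI n J g) M)
        = (case p of (I, J) \<Rightarrow> C I J * pairing n (dd n I J ?T) (star_coeff M)) / mfact n M"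
      by (simp add: p s)
  qed
  finally show ?thesis by (simp only: sum_dd_eq_pairing_ser_mul[OF T])
qed

text \<open>Differentiation moves the coefficient index from M to \<open>madd (unitv l) M\<close>,
  and its factor M l + 1 is absorbed by the factorial in \<open>star_pairing\<close>. Then
  \<open>star_coeff_madd\<close> splits off \<open>star_coeff (unitv l)\<close>.\<close>

lemma pder_star:
  assumes l: "l < n" and f: "spoly n f" and g: "spoly n g"
  shows "pder l (star n c f g) M
    = fsum (\<lambda>(I, J). star_coeff (unitv l) I J * star n c (pderI n I f) (pderI n J g) M) {(I, J). mi n I \<and> mi n J}"
proof -
  have inc: "M(l := M l + 1) = madd (unitv l) M" by (auto simp: unitv_def)
  show ?thesis
  proof (cases "mi n M")
    case True
    have "pder l (star n c f g) M = pairing n (tensor f g) (star_coeff (madd (unitv l) M)) / mfact n M"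
      unfolding pder_def inc star_pairing[OF f g] mfact_madd_unitv[OF l] by (simp del: of_nat_Suc)
    then show ?thesis
      unfolding fsum_star_pderI[OF f g] star_coeff_madd[OF mi_unitv[OF l] True] .
  next
    case False
    then have "\<not> mi n (madd (unitv l) M)" by (simp add: mi_madd)
    then have "pder l (star n c f g) M = 0"
      unfolding pder_def inc using spolyD[OF spoly_star[OF f g]] by (metis mult_zero_right)
    moreover have "star n c (pderI n I f) (pderI n J g) M = 0" if "mi n I" "mi n J" for I J
      using spolyD[OF spoly_star[OF spoly_pderI[OF that(1) f] spoly_pderI[OF that(2) g]]] False by metis
    ultimately show ?thesis
      by (subst fsum_superset[of "{}"]) auto
  qed
qed

lemma Delta_eq_star_coeff:
  assumes l: "l < n"
  shows "Delta n c l = star_coeff (unitv l)"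
  unfolding Delta_def
proof (rule the_equality)
  show "(\<forall>I J. \<not> (mi n I \<and> mi n J) \<longrightarrow> star_coeff (unitv l) I J = 0) \<and>
     (\<forall>f g. spoly n f \<and> spoly n g \<longrightarrow> pder l (star n c f g) =
        (\<lambda>M. fsum (\<lambda>(I, J). star_coeff (unitv l) I J * star n c (pderI n I f) (pderI n J g) M)
                   {(I, J). mi n I \<and> mi n J}))"
  proof (intro conjI allI impI ext)
    show "star_coeff (unitv l) I J = 0" if "\<not> (mi n I \<and> mi n J)" for I J
      unfolding star_coeff_def by (rule if_not_P[OF that])
  qed (use pder_star[OF l] in blast)
next
  fix C :: "(nat \<Rightarrow> nat) \<Rightarrow> (nat \<Rightarrow> nat) \<Rightarrow> 'k"
  assume C: "(\<forall>I J. \<not> (mi n I \<and> mi n J) \<longrightarrow> C I J = 0) \<and>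
     (\<forall>f g. spoly n f \<and> spoly n g \<longrightarrow> pder l (star n c f g) =
        (\<lambda>M. fsum (\<lambda>(I, J). C I J * star n c (pderI n I f) (pderI n J g) M)
                   {(I, J). mi n I \<and> mi n J}))"
  show "C = star_coeff (unitv l)"
  proof (intro ext)
    fix I J
    show "C I J = star_coeff (unitv l) I J"
    proof (cases "mi n I \<and> mi n J")
      case False
      then show ?thesis using C unfolding star_coeff_def by (metis (no_types, lifting))
    next
      case True
      then have I: "mi n I" and J: "mi n J" by auto
      note fg = spoly_mono[OF I, where 'k = 'k] spoly_mono[OF J, where 'k = 'k]
      let ?T = "tensor (mono I) (mono J) :: _ \<Rightarrow> _ \<Rightarrow> 'k"
      have "pder l (star n c (mono I) (mono J)) = (\<lambda>M. fsum (\<lambda>(I', J'). C I' J' * star n c (pderI n I' (mono I)) (pderI n J' (mono J)) M)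
                   {(I, J). mi n I \<and> mi n J})"
        using C fg by blast
      \<comment> \<open>Evaluation at M = 0 suffices: there \<open>star_coeff\<close> is the unit
        series, so the pairing with the tensor of the monomials I and J returns the coefficient of C
        at (I, J) up to I! J!.\<close>
      then have "pairing n ?T (ser_mul C (star_coeff (\<lambda>_. 0))) / mfact n (\<lambda>_. 0) = pairing n ?T (ser_mul (star_coeff (unitv l)) (star_coeff (\<lambda>_. 0))) / mfact n (\<lambda>_. 0)"
        unfolding fsum_star_pderI[OF fg, symmetric] pder_star[OF l fg, symmetric] by (rule fun_cong[symmetric])
      moreover have "pairing n ?T (ser_mul D (star_coeff (\<lambda>_. 0))) = mfact n I * mfact n J * D I J" for D
        unfolding pairing_tensor fpair_mono star_coeff_zero ser_mul_commute[of D] ser_mul_one[OF mi_fin_mi[OF I] mi_fin_mi[OF J]] ..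
      ultimately show ?thesis by simp
    qed
  qed
qed

definition Delta_ser :: "nat \<Rightarrow> 'k mser" where
  "Delta_ser l = Abs_mser (star_coeff (unitv l))"

lemma Rep_Delta_ser: "Rep_mser (Delta_ser l) = star_coeff (unitv l)"
  unfolding Delta_ser_def
proof (rule Abs_mser_inverse, rule ser_carrierI)
  fix I J assume "\<not> (fin_mi I \<and> fin_mi J)"
  then have "\<not> (mi n I \<and> mi n J)" using mi_fin_mi by blast
  then show "star_coeff (unitv l) I J = 0" unfolding star_coeff_def by (rule if_not_P)
qed

lemma star_coeff_monpow: "mi n M \<Longrightarrow> Rep_mser (monpow n Delta_ser M) = star_coeff M"
proof (induction M rule: mi_induct)
  case zero
  show ?case by (simp add: monpow_zero Rep_mser_1 star_coeff_zero)
next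
  case (step l M)
  then show ?case by (simp only: monpow_madd monpow_unitv Rep_mser_mult Rep_Delta_ser star_coeff_madd mi_unitv)
qed

section \<open>Finiteness and the binomial expansion\<close>

definition Diff_ser :: "nat \<Rightarrow> 'k mser" where
  "Diff_ser l = Delta_ser l - Delta0_ser l"

lemma star_term_eq:
  "star_term n c f g i M = 1 / mfact n i
    * pmul (mono i) (mT (act n (Rep_mser (monpow n Diff_ser i)) (tensor f g))) M"
proof -
  have "foldr (\<lambda>l D. ser_mul (ser_pow (\<lambda>I J. Delta n c l I J - Delta0 l I J) (i l)) D) [0..<n] ser_one
      = Rep_mser (monpow n Diff_ser i)"
    unfolding monpow_def Rep_mser_prod
    by (intro foldr_cong) (simp_all add: Diff_ser_def Rep_mser_diff Rep_Delta_ser Rep_Delta0_ser Delta_eq_star_coeff)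
  then show ?thesis by (simp add: star_term_def mfact_def)
qed

lemma ord_ge_Diff_ser:
  assumes l: "l < n"
  shows "ord_ge n 1 (Rep_mser (Diff_ser l))"
  unfolding ord_ge_def
proof (intro allI impI)
  fix A B assume lt: "deg n A + deg n B < 1"
  \<comment> \<open>\<open>deg n\<close> ignores coordinates from n on, so degree 0 alone does not
    make A and B zero. Exponents that leave the first n variables are treated apart; both series
    vanish there.\<close>
  have d0: "Delta0 l A B = (0::'k)" if "\<not> (mi n A \<and> mi n B)"
  proof -
    have "mi n (\<lambda>_. 0)" by (simp add: mi_def)
    then have "\<not> (A = unitv l \<and> B = (\<lambda>_. 0))" "\<not> (A = (\<lambda>_. 0) \<and> B = unitv l)"
      using that mi_unitv[OF l] by auto
    then show ?thesis unfolding Delta0_def by (simp only: if_False add_0)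
  qed
  show "Rep_mser (Diff_ser l) A B = 0"
  proof (cases "mi n A \<and> mi n B")
    case False
    then have "star_coeff (unitv l) A B = 0" unfolding star_coeff_def by (rule if_not_P)
    then show ?thesis using d0[OF False] by (simp add: Diff_ser_def Rep_mser_diff Rep_Delta_ser Rep_Delta0_ser)
  next
    case True
    have zero: "C = (\<lambda>_. 0)" if "mi n C" "deg n C = 0" for C
    proof
      fix i
      show "C i = 0" using that deg_ge[of i n C] by (cases "i < n") (simp_all add: mi_def)
    qed
    have z: "A = (\<lambda>_. 0)" "B = (\<lambda>_. 0)" using True lt by (simp_all add: zero)
    have ne: "(\<lambda>_. 0) \<noteq> unitv l" by (auto simp: unitv_def fun_eq_iff)
    have mi0: "mi n (\<lambda>_. 0)" by (simp add: mi_def)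
    have "words (\<lambda>_. 0) = {[]}" unfolding words_def by (auto simp: fun_eq_iff count_eq_zero_iff)
    then have avg0: "avg n (\<lambda>_. 0) F = F []" for F :: "nat list \<Rightarrow> 'k" by (simp add: avg_def deg_def)
    \<comment> \<open>The constant term is \<open>phi (unitv l)\<close> at the empty word, the only
      word of content 0; duality makes it 0 because the index is not the zero vector.\<close>
    have "star_coeff (unitv l) A B = phi (unitv l) []" using mi0 by (simp add: star_coeff_def z avg0)
    also have "\<dots> = 0" using avg_phi[OF mi0, of "unitv l"] ne by (simp add: avg0)
    finally show ?thesis using ne by (simp add: Diff_ser_def Rep_mser_diff Rep_Delta_ser Rep_Delta0_ser Delta0_def z)
  qed
qed

lemma finite_star_terms:
  assumes f: "spoly n f" and g: "spoly n g"
  shows "finite {i. mi n i \<and> star_term n c f g i \<noteq> (\<lambda>_. 0)}"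
proof -
  let ?T = "tensor f g"
  have T: "spoly2 n ?T" by (rule spoly2_tensor[OF f g])
  \<comment> \<open>A crude strict upper bound for the total degree of every monomial of the
    tensor.\<close>
  define k where "k = Suc (\<Sum>(A, B)\<in>{(A, B). ?T A B \<noteq> 0}. deg n A + deg n B)"
  have bound: "deg n A + deg n B < k" if "?T A B \<noteq> 0" for A B
    unfolding k_def less_Suc_eq_le
    using member_le_sum[of "(A, B)" "{(A, B). ?T A B \<noteq> 0}" "\<lambda>(A, B). deg n A + deg n B"] that T
    by (simp add: spoly2_def)
  have "star_term n c f g i = (\<lambda>_. 0)" if "mi n i" "k \<le> deg n i" for i
  proof
    fix M
    have "ord_ge n k (Rep_mser (monpow n Diff_ser i))"
      using ord_ge_monpow[OF ord_ge_Diff_ser that(1)] that(2) unfolding ord_ge_def by auto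
    then have "act n (Rep_mser (monpow n Diff_ser i)) ?T = (\<lambda>_ _. 0)"
      by (rule act_ord_ge[OF T, rotated]) (rule bound)
    then show "star_term n c f g i M = 0"
      unfolding star_term_eq by (simp add: mT_def[abs_def] pmul_def)
  qed
  then have "{i. mi n i \<and> star_term n c f g i \<noteq> (\<lambda>_. 0)} \<subseteq> Mon n k"
    unfolding Mon_def by (blast intro: nat_le_linear[THEN disjE])
  then show ?thesis using finite_Mon by (rule finite_subset)
qed

text \<open>Only indices i below M reach x^M, and by \<open>mT_pairing\<close> and
  \<open>pairing_act\<close> term i is the pairing of f (x) g with the product of the i-th power of
  Delta - Delta_0 and the (M - i)-th power of Delta_0, divided by i! (M - i)!. Times M! this weight
  is the product of the binomial coefficients, so the sum is the expansion of the M-th power of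
  Delta.\<close>

lemma sum_star_terms:
  assumes f: "spoly n f" and g: "spoly n g" and M: "mi n M"
  shows "(\<Sum>i\<in>down M. star_term n c f g i M) = star n c f g M"
proof -
  let ?T = "tensor f g"
  let ?P = "\<lambda>i. monpow n Diff_ser i * monpow n Delta0_ser (msub M i)"
  let ?b = "\<lambda>i. of_nat (\<Prod>l<n. M l choose i l)"
  have T: "spoly2 n ?T" by (rule spoly2_tensor[OF f g])
  have "star_term n c f g i M = (?b i * pairing n ?T (Rep_mser (?P i))) / mfact n M" if i: "i \<in> down M" for i
  proof -
    have "star_term n c f g i M
        = 1 / mfact n i * (pairing n (act n (Rep_mser (monpow n Diff_ser i)) ?T) (Delta0_pow n (msub M i)) / mfact n (msub M i))"
      unfolding star_term_eq pmul_mono[OF M] using i mT_pairing[OF spoly2_act(1)[OF T] mi_msub[OF M]] by simp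
    also have "pairing n (act n (Rep_mser (monpow n Diff_ser i)) ?T) (Delta0_pow n (msub M i)) = pairing n ?T (Rep_mser (?P i))"
      unfolding pairing_act[OF T] Rep_mser_mult Delta0_pow_monpow[OF mi_msub[OF M]] ..
    also have "1 / mfact n i * (x / mfact n (msub M i)) = ?b i * x / mfact n M" for x :: 'k
    proof -
      have "?b i = (mfact n M / (mfact n i * mfact n (msub M i)) :: 'k)"
        using i by (simp add: mfact_def binomial_fact prod_dividef prod.distrib)
      then show ?thesis by simp
    qed
    finally show ?thesis .
  qed
  then have "(\<Sum>i\<in>down M. star_term n c f g i M) = (\<Sum>i\<in>down M. ?b i * pairing n ?T (Rep_mser (?P i))) / mfact n M"
    by (simp add: sum_divide_distrib)
  also have "(\<Sum>i\<in>down M. ?b i * pairing n ?T (Rep_mser (?P i))) = pairing n ?T (Rep_mser (\<Sum>i\<in>down M. ?b i * ?P i))"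
    unfolding pairing_sum[symmetric] by (intro arg_cong[of _ _ "pairing n ?T"] ext) (simp only: Rep_mser_sum Rep_mser_of_nat_mult)
  also have "(\<Sum>i\<in>down M. ?b i * ?P i) = monpow n Delta_ser M"
    unfolding monpow_binomial[OF M, symmetric] by (simp add: Diff_ser_def)
  finally show ?thesis unfolding star_coeff_monpow[OF M] star_pairing[OF f g] .
qed

lemma star_term_vanishes:
  assumes f: "spoly n f" and g: "spoly n g" and i: "mi n i"
  shows "\<not> mi n M \<Longrightarrow> star_term n c f g i M = 0"
    and "mi n M \<Longrightarrow> i \<notin> down M \<Longrightarrow> star_term n c f g i M = 0"
proof -
  have T: "spoly2 n (act n C (tensor f g))" for C by (rule spoly2_act(1)[OF spoly2_tensor[OF f g]])
  show "star_term n c f g i M = 0" if "\<not> mi n M"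
    unfolding star_term_eq
    by (subst pmul_mono_not_mi[OF i that]) (simp_all add: mT_not_mi[OF T])
  show "star_term n c f g i M = 0" if "mi n M" "i \<notin> down M"
    unfolding star_term_eq pmul_mono[OF that(1)] if_not_P[OF that(2)] by simp
qed

end

theorem mainTheorem11:
  fixes n :: nat and c :: "nat \<Rightarrow> nat \<Rightarrow> nat \<Rightarrow> 'k::field_char_0"
    and f g :: "(nat \<Rightarrow> nat) \<Rightarrow> 'k"
  assumes "is_lie_algebra n c" and "spoly n f" and "spoly n g"
  shows "finite {i. mi n i \<and> star_term n c f g i \<noteq> (\<lambda>_. 0)} \<and>
         star n c f g = (\<lambda>M. \<Sum>i\<in>{i. mi n i \<and> star_term n c f g i \<noteq> (\<lambda>_. 0)}. star_term n c f g i M)"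
proof -
  interpret lie_alg n c by standard (rule assms(1))
  note f = assms(2) and g = assms(3)
  let ?F = "{i. mi n i \<and> star_term n c f g i \<noteq> (\<lambda>_. 0)}"
  have fin: "finite ?F" by (rule finite_star_terms[OF f g])
  have "star n c f g M = (\<Sum>i\<in>?F. star_term n c f g i M)" for M
  proof (cases "mi n M")
    case True
    \<comment> \<open>At a fixed M the index set can be traded for \<open>down M\<close>: outside
      \<open>down M\<close> the terms vanish at M, and an index of \<open>down M\<close> missing
      from \<open>?F\<close> has a zero term.\<close>
    have "(\<Sum>i\<in>?F. star_term n c f g i M) = (\<Sum>i\<in>?F \<inter> down M. star_term n c f g i M)"
      using fin star_term_vanishes(2)[OF f g _ True] by (intro sum.mono_neutral_right) auto
    also have "\<dots> = (\<Sum>i\<in>down M. star_term n c f g i M)"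
    proof (rule sum.mono_neutral_left)
      show "\<forall>i\<in>down M - ?F \<inter> down M. star_term n c f g i M = 0"
      proof
        fix i assume i: "i \<in> down M - ?F \<inter> down M"
        then have "mi n i" using mi_down[OF True] by blast
        then have "star_term n c f g i = (\<lambda>_. 0)" using i by blast
        then show "star_term n c f g i M = 0" by simp
      qed
    qed (auto simp: finite_down[OF True])
    finally show ?thesis using sum_star_terms[OF f g True] by simp
  next
    case False
    then have "star n c f g M = 0" using spolyD[OF spoly_star[OF f g]] by blast
    moreover have "(\<Sum>i\<in>?F. star_term n c f g i M) = 0"
      by (rule sum.neutral) (use star_term_vanishes(1)[OF f g _ False] in blast)
    ultimately show ?thesis by simp
  qed
  then show ?thesis using fin by (intro conjI ext)
qed

end
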